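(* Let $\Gamma$ be a discrete group with Kazhdan's property (T), and let $\{\Gamma_\alpha\}_{\alpha\in I}$ be an uncountable family of pairwise non-isomorphic quotient groups of $\Gamma$, each of which is simple and ICC. Then the full group $C^*$-algebra $C^*\Gamma_\alpha$ of $\Gamma_\alpha$ fails the lifting property (LP) for some $\alpha\in I$.
   Context: A discrete group $\Gamma$ has Kazhdan's property (T) if the trivial representation is isolated in the dual $\hat{\Gamma}$ equipped with the Fell topology. A group is ICC (infinite conjugacy classes) if every conjugacy class other than that of the identity is infinite. "Pairwise non-isomorphic" means that $\Gamma_\alpha\not\cong\Gamma_\beta$ as groups for $\alpha\neq\beta$ in the (uncountable) index set $I$. A separable unital $C^*$-algebra $A$ has the lifting property (LP) if for every unital $C^*$-algebra $B$, every closed two-sided ideal $J$ of $B$ and every unital completely positive map $\theta\colon A\to B/J$, there is a unital completely positive map $\tilde\theta\colon A\to B$ with $q\tilde\theta=\theta$, where $q\colon B\to B/J$ is the quotient map. *)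

theory Defs
  imports "HOL-Analysis.Analysis" "HOL-Algebra.QuotRing" "HOL-Algebra.Module"
begin

section \<open>Complex linear structure\<close>

definition complex_ring :: "complex ring" where
  "complex_ring = \<lparr>carrier = UNIV, mult = (*), one = 1, zero = 0, add = (+)\<rparr>"

definition complex_linear ::
    "(complex, 'a, 'm) module_scheme \<Rightarrow> (complex, 'b, 'n) module_scheme \<Rightarrow> ('a \<Rightarrow> 'b) \<Rightarrow> bool" where
  "complex_linear V W f \<longleftrightarrow>
     f \<in> carrier V \<rightarrow> carrier W \<and>
     (\<forall>x\<in>carrier V. \<forall>y\<in>carrier V. f (x \<oplus>\<^bsub>V\<^esub> y) = f x \<oplus>\<^bsub>W\<^esub> f y) \<and>
     (\<forall>c. \<forall>x\<in>carrier V. f (c \<odot>\<^bsub>V\<^esub> x) = c \<odot>\<^bsub>W\<^esub> f x)"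

section \<open>Hilbert spaces and unitary representations\<close>

text \<open>The fields \<open>mult\<close> and \<open>one\<close> that are inherited from the module record play no role for
  Hilbert spaces. Inner products are linear in the first argument.\<close>

record 'h hilbert = "(complex, 'h) module" +
  inner_prod :: "'h \<Rightarrow> 'h \<Rightarrow> complex"

definition hnorm :: "('h, 'm) hilbert_scheme \<Rightarrow> 'h \<Rightarrow> real" where
  "hnorm H v = sqrt (Re (inner_prod H v v))"

locale hilbert_space = H?: Module.module complex_ring H
  for H :: "('h, 'm) hilbert_scheme" (structure) +
  assumes inner_add: "\<lbrakk>u \<in> carrier H; v \<in> carrier H; w \<in> carrier H\<rbrakk> \<Longrightarrow>
      inner_prod H (u \<oplus> v) w = inner_prod H u w + inner_prod H v w"
    and inner_smult: "\<lbrakk>u \<in> carrier H; v \<in> carrier H\<rbrakk> \<Longrightarrow>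
      inner_prod H (c \<odot> u) v = c * inner_prod H u v"
    and inner_cnj: "\<lbrakk>u \<in> carrier H; v \<in> carrier H\<rbrakk> \<Longrightarrow>
      inner_prod H u v = cnj (inner_prod H v u)"
    and inner_nonneg: "u \<in> carrier H \<Longrightarrow> 0 \<le> Re (inner_prod H u u)"
    and inner_definite: "\<lbrakk>u \<in> carrier H; inner_prod H u u = 0\<rbrakk> \<Longrightarrow> u = \<zero>"
    and hilbert_complete:
      "\<lbrakk>\<And>n :: nat. s n \<in> carrier H;
        \<And>e. e > 0 \<Longrightarrow> \<exists>N. \<forall>m\<ge>N. \<forall>n\<ge>N. hnorm H (s m \<ominus> s n) < e\<rbrakk> \<Longrightarrow>
       \<exists>v\<in>carrier H. (\<lambda>n. hnorm H (s n \<ominus> v)) \<longlonglongrightarrow> 0"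

definition unitary_map ::
    "('h, 'm) hilbert_scheme \<Rightarrow> ('k, 'n) hilbert_scheme \<Rightarrow> ('h \<Rightarrow> 'k) \<Rightarrow> bool" where
  "unitary_map H K U \<longleftrightarrow>
     complex_linear H K U \<and> bij_betw U (carrier H) (carrier K) \<and>
     (\<forall>v\<in>carrier H. \<forall>w\<in>carrier H. inner_prod K (U v) (U w) = inner_prod H v w)"

definition unitary_rep ::
    "('g, 'm) monoid_scheme \<Rightarrow> ('h, 'n) hilbert_scheme \<Rightarrow> ('g \<Rightarrow> 'h \<Rightarrow> 'h) \<Rightarrow> bool" where
  "unitary_rep G H \<pi> \<longleftrightarrow>
     hilbert_space H \<and> (\<forall>g\<in>carrier G. unitary_map H H (\<pi> g)) \<and>
     (\<forall>g\<in>carrier G. \<forall>h\<in>carrier G. \<forall>v\<in>carrier H. \<pi> (g \<otimes>\<^bsub>G\<^esub> h) v = \<pi> g (\<pi> h v))"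

definition closed_invariant_subspace ::
    "('g, 'm) monoid_scheme \<Rightarrow> ('h, 'n) hilbert_scheme \<Rightarrow> ('g \<Rightarrow> 'h \<Rightarrow> 'h) \<Rightarrow> 'h set \<Rightarrow> bool" where
  "closed_invariant_subspace G H \<pi> W \<longleftrightarrow>
     submodule W complex_ring H \<and>
     (\<forall>s v. (\<forall>n :: nat. s n \<in> W) \<and> v \<in> carrier H \<and>
        (\<lambda>n. hnorm H (s n \<ominus>\<^bsub>H\<^esub> v)) \<longlonglongrightarrow> 0 \<longrightarrow> v \<in> W) \<and>
     (\<forall>g\<in>carrier G. \<pi> g ` W \<subseteq> W)"

definition irreducible_rep ::
    "('g, 'm) monoid_scheme \<Rightarrow> ('h, 'n) hilbert_scheme \<Rightarrow> ('g \<Rightarrow> 'h \<Rightarrow> 'h) \<Rightarrow> bool" where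
  "irreducible_rep G H \<pi> \<longleftrightarrow>
     unitary_rep G H \<pi> \<and> carrier H \<noteq> {\<zero>\<^bsub>H\<^esub>} \<and>
     (\<forall>W. closed_invariant_subspace G H \<pi> W \<longrightarrow> W = {\<zero>\<^bsub>H\<^esub>} \<or> W = carrier H)"

section \<open>The unitary dual, the Fell topology, and property (T)\<close>

text \<open>A cyclic representation of \<open>G\<close> lives on a Hilbert space whose dimension is at most the
  cardinality of \<open>G\<close>. Every such space has a unitary copy whose carrier is a subset of \<open>'g \<Rightarrow> complex\<close>, where \<open>'g\<close> is the
  type of elements of \<open>G\<close>. Irreducible representations are cyclic, so representations with such
  carriers exhaust the dual up to unitary equivalence.\<close>

type_synonym 'g rep = "('g \<Rightarrow> complex) hilbert \<times> ('g \<Rightarrow> ('g \<Rightarrow> complex) \<Rightarrow> ('g \<Rightarrow> complex))"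

definition irreps :: "('g, 'm) monoid_scheme \<Rightarrow> 'g rep set" where
  "irreps G = {(H, \<pi>). irreducible_rep G H \<pi>}"

definition unitary_equivalence :: "('g, 'm) monoid_scheme \<Rightarrow> ('g rep \<times> 'g rep) set" where
  "unitary_equivalence G = {((H, \<pi>), (K, \<rho>)). (H, \<pi>) \<in> irreps G \<and> (K, \<rho>) \<in> irreps G \<and>
     (\<exists>U. unitary_map H K U \<and> (\<forall>g\<in>carrier G. \<forall>v\<in>carrier H. U (\<pi> g v) = \<rho> g (U v)))}"

definition unitary_dual :: "('g, 'm) monoid_scheme \<Rightarrow> 'g rep set set" where
  "unitary_dual G = irreps G // unitary_equivalence G"

text \<open>The basic neighbourhood of \<open>(H, \<pi>)\<close> given by the functions of positive type
  \<open>g \<mapsto> \<langle>\<pi>(g)\<xi>, \<xi>\<rangle>\<close> with \<open>\<xi> \<in> F\<close>, the finite (that is, compact) set \<open>Q\<close> and \<open>\<epsilon>\<close>: each of these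
  functions is, up to \<open>\<epsilon>\<close> on \<open>Q\<close>, a finite sum of functions of positive type associated
  with \<open>\<rho>\<close>.\<close>

definition fell_nbhd ::
    "('g, 'm) monoid_scheme \<Rightarrow> 'g rep \<Rightarrow> ('g \<Rightarrow> complex) set \<Rightarrow> 'g set \<Rightarrow> real \<Rightarrow> 'g rep set set" where
  "fell_nbhd G = (\<lambda>(H, \<pi>) F Q \<epsilon>.
     {C \<in> unitary_dual G. \<exists>(K, \<rho>)\<in>C. \<forall>\<xi>\<in>F. \<exists>\<eta>s. set \<eta>s \<subseteq> carrier K \<and>
        (\<forall>g\<in>Q. cmod (inner_prod H (\<pi> g \<xi>) \<xi> - (\<Sum>\<eta>\<leftarrow>\<eta>s. inner_prod K (\<rho> g \<eta>) \<eta>)) < \<epsilon>)})"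

definition fell_topology :: "('g, 'm) monoid_scheme \<Rightarrow> 'g rep set topology" where
  "fell_topology G = topology_generated_by
     {fell_nbhd G (H, \<pi>) F Q \<epsilon> | H \<pi> F Q \<epsilon>.
        (H, \<pi>) \<in> irreps G \<and> finite F \<and> F \<subseteq> carrier H \<and> finite Q \<and> Q \<subseteq> carrier G \<and> \<epsilon> > 0}"

text \<open>The one-dimensional Hilbert space is carried by the constant functions.\<close>

definition trivial_rep :: "('g, 'm) monoid_scheme \<Rightarrow> 'g rep" where
  "trivial_rep G =
     (\<lparr>carrier = range (\<lambda>c _. c), mult = (\<lambda>v w x. v x * w x), one = (\<lambda>_. 1),
       zero = (\<lambda>_. 0), add = (\<lambda>v w x. v x + w x), smult = (\<lambda>c v x. c * v x),
       inner_prod = (\<lambda>v w. v \<one>\<^bsub>G\<^esub> * cnj (w \<one>\<^bsub>G\<^esub>))\<rparr>,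
      \<lambda>g v. v)"

definition kazhdan_property_T :: "('g, 'm) monoid_scheme \<Rightarrow> bool" where
  "kazhdan_property_T G \<longleftrightarrow>
     openin (fell_topology G) {unitary_equivalence G `` {trivial_rep G}}"

section \<open>C*-algebras\<close>

record 'a cstar = "(complex, 'a) module" +
  star :: "'a \<Rightarrow> 'a"
  cnorm :: "'a \<Rightarrow> real"

locale unital_cstar_algebra = A?: ring A + module?: Module.module complex_ring A
  for A :: "('a, 'm) cstar_scheme" (structure) +
  assumes smult_mult_left: "\<lbrakk>x \<in> carrier A; y \<in> carrier A\<rbrakk> \<Longrightarrow> (c \<odot> x) \<otimes> y = c \<odot> (x \<otimes> y)"
    and smult_mult_right: "\<lbrakk>x \<in> carrier A; y \<in> carrier A\<rbrakk> \<Longrightarrow> x \<otimes> (c \<odot> y) = c \<odot> (x \<otimes> y)"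
    and star_closed: "x \<in> carrier A \<Longrightarrow> star A x \<in> carrier A"
    and star_star: "x \<in> carrier A \<Longrightarrow> star A (star A x) = x"
    and star_add: "\<lbrakk>x \<in> carrier A; y \<in> carrier A\<rbrakk> \<Longrightarrow> star A (x \<oplus> y) = star A x \<oplus> star A y"
    and star_smult: "x \<in> carrier A \<Longrightarrow> star A (c \<odot> x) = cnj c \<odot> star A x"
    and star_mult: "\<lbrakk>x \<in> carrier A; y \<in> carrier A\<rbrakk> \<Longrightarrow> star A (x \<otimes> y) = star A y \<otimes> star A x"
    and cnorm_nonneg: "x \<in> carrier A \<Longrightarrow> 0 \<le> cnorm A x"
    and cnorm_eq_zero: "x \<in> carrier A \<Longrightarrow> cnorm A x = 0 \<longleftrightarrow> x = \<zero>"
    and cnorm_add: "\<lbrakk>x \<in> carrier A; y \<in> carrier A\<rbrakk> \<Longrightarrow> cnorm A (x \<oplus> y) \<le> cnorm A x + cnorm A y"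
    and cnorm_smult: "x \<in> carrier A \<Longrightarrow> cnorm A (c \<odot> x) = cmod c * cnorm A x"
    and cnorm_mult: "\<lbrakk>x \<in> carrier A; y \<in> carrier A\<rbrakk> \<Longrightarrow> cnorm A (x \<otimes> y) \<le> cnorm A x * cnorm A y"
    and cnorm_star: "x \<in> carrier A \<Longrightarrow> cnorm A (star A x \<otimes> x) = (cnorm A x)\<^sup>2"
    and cstar_complete:
      "\<lbrakk>\<And>n :: nat. s n \<in> carrier A;
        \<And>e. e > 0 \<Longrightarrow> \<exists>N. \<forall>m\<ge>N. \<forall>n\<ge>N. cnorm A (s m \<ominus> s n) < e\<rbrakk> \<Longrightarrow>
       \<exists>x\<in>carrier A. (\<lambda>n. cnorm A (s n \<ominus> x)) \<longlonglongrightarrow> 0"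

definition closed_ideal :: "('a, 'm) cstar_scheme \<Rightarrow> 'a set \<Rightarrow> bool" where
  "closed_ideal B J \<longleftrightarrow> ideal J B \<and>
     (\<forall>s x. (\<forall>n :: nat. s n \<in> J) \<and> x \<in> carrier B \<and>
        (\<lambda>n. cnorm B (s n \<ominus>\<^bsub>B\<^esub> x)) \<longlonglongrightarrow> 0 \<longrightarrow> x \<in> J)"

text \<open>The ring \<open>B Quot J\<close> with the induced scalar multiplication and involution and the quotient
  norm.\<close>

definition cstar_quot :: "('a, 'm) cstar_scheme \<Rightarrow> 'a set \<Rightarrow> 'a set cstar" where
  "cstar_quot B J =
     \<lparr>carrier = carrier (B Quot J), mult = mult (B Quot J), one = one (B Quot J),
      zero = zero (B Quot J), add = add (B Quot J),
      smult = (\<lambda>c X. \<Union>x\<in>X. J +>\<^bsub>B\<^esub> (c \<odot>\<^bsub>B\<^esub> x)),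
      star = (\<lambda>X. \<Union>x\<in>X. J +>\<^bsub>B\<^esub> star B x),
      cnorm = (\<lambda>X. INF x\<in>X. cnorm B x)\<rparr>"

text \<open>Matrices over \<open>A\<close> are functions \<open>a :: nat \<Rightarrow> nat \<Rightarrow> 'a\<close>, of which only the entries \<open>a i j\<close> with
  \<open>i, j < n\<close> matter. A matrix is a positive element of the C*-algebra of \<open>n \<times> n\<close> matrices if it
  has the form \<open>x\<^sup>* x\<close>.\<close>

definition positive_matrix ::
    "('a, 'm) cstar_scheme \<Rightarrow> nat \<Rightarrow> (nat \<Rightarrow> nat \<Rightarrow> 'a) \<Rightarrow> bool" where
  "positive_matrix A n a \<longleftrightarrow>
     (\<exists>x. (\<forall>i<n. \<forall>j<n. x i j \<in> carrier A) \<and>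
        (\<forall>i<n. \<forall>j<n. a i j = (\<Oplus>\<^bsub>A\<^esub>k\<in>{..<n}. star A (x k i) \<otimes>\<^bsub>A\<^esub> x k j)))"

definition completely_positive ::
    "('a, 'm) cstar_scheme \<Rightarrow> ('b, 'n) cstar_scheme \<Rightarrow> ('a \<Rightarrow> 'b) \<Rightarrow> bool" where
  "completely_positive A B \<theta> \<longleftrightarrow> complex_linear A B \<theta> \<and>
     (\<forall>n a. positive_matrix A n a \<longrightarrow> positive_matrix B n (\<lambda>i j. \<theta> (a i j)))"

definition unital_cp ::
    "('a, 'm) cstar_scheme \<Rightarrow> ('b, 'n) cstar_scheme \<Rightarrow> ('a \<Rightarrow> 'b) \<Rightarrow> bool" where
  "unital_cp A B \<theta> \<longleftrightarrow> completely_positive A B \<theta> \<and> \<theta> \<one>\<^bsub>A\<^esub> = \<one>\<^bsub>B\<^esub>"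

text \<open>Since HOL cannot quantify over all types, the algebras \<open>B\<close> range over those carried by subsets
  of a given type \<open>'b\<close>. For separable \<open>A\<close> this is no restriction once \<open>'b\<close> has at least the
  cardinality of the continuum: the range of \<open>\<theta>\<close> is contained in the image of a separable unital
  C*-subalgebra \<open>B\<^sub>0\<close> of \<open>B\<close>, and a lift to \<open>B\<^sub>0\<close> is a lift to \<open>B\<close>. Failure of the property for
  some \<open>'b\<close> is always failure of the unrestricted property.\<close>

definition lifting_property :: "'b itself \<Rightarrow> ('a, 'm) cstar_scheme \<Rightarrow> bool" where
  "lifting_property T A \<longleftrightarrow>
     (\<forall>(B :: 'b cstar) J \<theta>.
        unital_cstar_algebra B \<and> closed_ideal B J \<and> unital_cp A (cstar_quot B J) \<theta> \<longrightarrow>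
        (\<exists>\<theta>'. unital_cp A B \<theta>' \<and> (\<forall>x\<in>carrier A. J +>\<^bsub>B\<^esub> \<theta>' x = \<theta> x)))"

section \<open>The full group C*-algebra\<close>

text \<open>The norm of \<open>x\<close> in the group algebra is the supremum of the operator norms of \<open>\<pi>(x)\<close> over all
  unitary representations \<open>\<pi>\<close>. It suffices to consider cyclic ones, so the restriction on carriers is
  harmless, as for the dual.\<close>

definition unitary_reps :: "('g, 'm) monoid_scheme \<Rightarrow> 'g rep set" where
  "unitary_reps G = {(H, \<pi>). unitary_rep G H \<pi>}"

definition full_norm :: "('g, 'm) monoid_scheme \<Rightarrow> ('g \<Rightarrow> complex) \<Rightarrow> real" where
  "full_norm G x =
     (SUP (H, \<pi>) \<in> unitary_reps G.
        SUP v \<in> {v \<in> carrier H. hnorm H v \<le> 1}.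
          hnorm H (\<Oplus>\<^bsub>H\<^esub>g\<in>{g \<in> carrier G. x g \<noteq> 0}. x g \<odot>\<^bsub>H\<^esub> \<pi> g v))"

definition group_algebra :: "('g, 'm) monoid_scheme \<Rightarrow> ('g \<Rightarrow> complex) cstar" where
  "group_algebra G =
     \<lparr>carrier = {x. finite {g. x g \<noteq> 0} \<and> {g. x g \<noteq> 0} \<subseteq> carrier G},
      mult = (\<lambda>x y g. if g \<in> carrier G
                then \<Sum>h\<in>{h \<in> carrier G. x h \<noteq> 0}. x h * y (inv\<^bsub>G\<^esub> h \<otimes>\<^bsub>G\<^esub> g) else 0),
      one = (\<lambda>g. if g = \<one>\<^bsub>G\<^esub> then 1 else 0),
      zero = (\<lambda>_. 0),
      add = (\<lambda>x y g. x g + y g),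
      smult = (\<lambda>c x g. c * x g),
      star = (\<lambda>x g. if g \<in> carrier G then cnj (x (inv\<^bsub>G\<^esub> g)) else 0),
      cnorm = full_norm G\<rparr>"

text \<open>The completion of a normed *-algebra: Cauchy sequences modulo null sequences. On a coset of
  null sequences the limit of the norms is constant, so the quotient norm is the norm of the
  completion.\<close>

definition cauchy_algebra :: "('a, 'm) cstar_scheme \<Rightarrow> (nat \<Rightarrow> 'a) cstar" where
  "cauchy_algebra A =
     \<lparr>carrier = {s. (\<forall>n. s n \<in> carrier A) \<and>
                   (\<forall>e>0. \<exists>N. \<forall>m\<ge>N. \<forall>n\<ge>N. cnorm A (s m \<ominus>\<^bsub>A\<^esub> s n) < e)},
      mult = (\<lambda>s t n. s n \<otimes>\<^bsub>A\<^esub> t n),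
      one = (\<lambda>n. \<one>\<^bsub>A\<^esub>),
      zero = (\<lambda>n. \<zero>\<^bsub>A\<^esub>),
      add = (\<lambda>s t n. s n \<oplus>\<^bsub>A\<^esub> t n),
      smult = (\<lambda>c s n. c \<odot>\<^bsub>A\<^esub> s n),
      star = (\<lambda>s n. star A (s n)),
      cnorm = (\<lambda>s. lim (\<lambda>n. cnorm A (s n)))\<rparr>"

definition null_sequences :: "('a, 'm) cstar_scheme \<Rightarrow> (nat \<Rightarrow> 'a) set" where
  "null_sequences A = {s. (\<forall>n. s n \<in> carrier A) \<and> (\<lambda>n. cnorm A (s n)) \<longlonglongrightarrow> 0}"

definition cstar_completion :: "('a, 'm) cstar_scheme \<Rightarrow> (nat \<Rightarrow> 'a) set cstar" where
  "cstar_completion A = cstar_quot (cauchy_algebra A) (null_sequences A)"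

definition full_group_cstar :: "('g, 'm) monoid_scheme \<Rightarrow> (nat \<Rightarrow> 'g \<Rightarrow> complex) set cstar" where
  "full_group_cstar G = cstar_completion (group_algebra G)"

section \<open>Group-theoretic conditions\<close>

text \<open>The locale \<open>simple_group\<close> of HOL-Algebra is not used, because it requires \<open>order G > 1\<close>, which
  no infinite group satisfies.\<close>

definition is_simple :: "('g, 'm) monoid_scheme \<Rightarrow> bool" where
  "is_simple G \<longleftrightarrow> group G \<and> carrier G \<noteq> {\<one>\<^bsub>G\<^esub>} \<and>
     (\<forall>N. N \<lhd> G \<longrightarrow> N = {\<one>\<^bsub>G\<^esub>} \<or> N = carrier G)"

definition is_icc :: "('g, 'm) monoid_scheme \<Rightarrow> bool" where
  "is_icc G \<longleftrightarrow> (\<forall>g\<in>carrier G. g \<noteq> \<one>\<^bsub>G\<^esub> \<longrightarrow>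
     infinite {h \<otimes>\<^bsub>G\<^esub> g \<otimes>\<^bsub>G\<^esub> inv\<^bsub>G\<^esub> h | h. h \<in> carrier G})"

end

theory Submission
  imports Defs "HOL-Library.Function_Algebras" "HOL-Algebra.Generated_Groups"
begin

text \<open>The maps \<open>\<phi> \<mapsto> \<phi>(x\<^sup>* x)\<close>, with \<open>\<phi>\<close> a normalized positive definite function on the group, compute the norm
  of the full C*-algebra by the GNS construction. For a group with property (T), isolation of the trivial representation
  among the irreducible ones extends from extreme points to all of this compact convex set: there are a finite set
  \<open>Q\<close> and \<open>\<kappa> > 0\<close> with \<open>\<kappa> Re (1 - \<phi>(g)) \<le> \<Sum>q\<in>Q. Re (1 - \<phi>(q))\<close> for all \<open>\<phi>\<close> and \<open>g\<close>.

  Suppose that the algebras of all quotients have the lifting property. Then the quotient maps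
  from the C*-algebra of \<open>\<Gamma>\<close> have unital completely positive sections \<open>\<sigma>\<^sub>\<alpha>\<close>. As this algebra is separable, two sections, for
  \<open>\<alpha> \<noteq> \<beta>\<close>, nearly agree at the (images of the) elements of \<open>Q\<close>. With \<open>\<tau>\<close> the canonical trace of the quotient
  by \<open>N \<alpha>\<close>, the function sending \<open>g\<close> to \<open>\<tau>\<close> of the product of the image of \<open>\<sigma>\<^sub>\<beta>(g)\<close> and \<open>g\<^sup>-\<^sup>1\<close> is positive definite and close
  to 1 on \<open>Q\<close>, hence close to 1 everywhere; but at an element of \<open>N \<beta>\<close> outside \<open>N \<alpha>\<close> it vanishes. So \<open>N \<beta> \<subseteq> N \<alpha>\<close>, and simplicity
  gives \<open>N \<alpha> = N \<beta>\<close>.\<close>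

section \<open>Semi-inner products and their completions\<close>

text \<open>Property (T) speaks of irreducible representations, whereas the function finally
  compared with 1 need not come from one. The gap closes because the inequality is affine in \<phi>:
  its defect attains its minimum at an extreme point, and the GNS representation of an extreme point
  is irreducible. The dual and the full norm only see representations whose vectors are functions on
  the group; hence the GNS space is built as a reproducing kernel space of such functions.

  To get sections, the C*-algebra of a quotient group must be a quotient of that of \<Gamma>, that
  is, the induced map must be onto. This rests on lifting elements of the group algebra with almost
  no increase of norm: averaging over finite subsets of the kernel produces positive definite
  functions nearly equal to 1 there, and compactness turns them into one that descends to the
  quotient group.

  Positivity of the comparison function uses that \<tau> is a trace: the twisting unitaries can be
  moved to both sides of a positive matrix.\<close>

definition sc :: "complex \<Rightarrow> ('x \<Rightarrow> complex) \<Rightarrow> 'x \<Rightarrow> complex" (infixr \<open>*\<^sub>c\<close> 75) where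
  "c *\<^sub>c x = (\<lambda>g. c * x g)"

lemma sc_simps: "1 *\<^sub>c x = x" "0 *\<^sub>c x = 0" "c *\<^sub>c (0 :: 'x \<Rightarrow> complex) = 0" "(-1) *\<^sub>c x = - x"
  "a *\<^sub>c b *\<^sub>c x = (a * b) *\<^sub>c x"
  by (auto simp: sc_def fun_eq_iff)

lemma sc_distrib: "(a + b) *\<^sub>c x = a *\<^sub>c x + b *\<^sub>c x" "c *\<^sub>c (x + y) = c *\<^sub>c x + c *\<^sub>c y"
  "c *\<^sub>c (x - y) = c *\<^sub>c x - c *\<^sub>c y" "c *\<^sub>c (- y) = - (c *\<^sub>c y)" "(- c) *\<^sub>c y = - (c *\<^sub>c y)"
  by (auto simp: sc_def fun_eq_iff algebra_simps)

locale function_space =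
  fixes V :: "('x \<Rightarrow> complex) set"
  assumes V_zero: "0 \<in> V"
    and V_add: "\<And>x y. x \<in> V \<Longrightarrow> y \<in> V \<Longrightarrow> x + y \<in> V"
    and V_sc: "\<And>c x. x \<in> V \<Longrightarrow> c *\<^sub>c x \<in> V"
begin

lemma V_uminus: "x \<in> V \<Longrightarrow> - x \<in> V"
  using V_sc[of x "-1"] by (simp add: sc_simps)

lemma V_diff: "x \<in> V \<Longrightarrow> y \<in> V \<Longrightarrow> x - y \<in> V"
  using V_add[of x "- y"] V_uminus[of y] by simp

lemmas V_closed = V_zero V_add V_sc V_uminus V_diff

end

locale semi_inner = function_space V for V :: "('x \<Rightarrow> complex) set" +
  fixes s :: "('x \<Rightarrow> complex) \<Rightarrow> ('x \<Rightarrow> complex) \<Rightarrow> complex"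
  assumes s_add_left: "\<And>x y z. \<lbrakk>x \<in> V; y \<in> V; z \<in> V\<rbrakk> \<Longrightarrow> s (x + y) z = s x z + s y z"
    and s_sc_left: "\<And>c x z. \<lbrakk>x \<in> V; z \<in> V\<rbrakk> \<Longrightarrow> s (c *\<^sub>c x) z = c * s x z"
    and s_add_right: "\<And>x y z. \<lbrakk>x \<in> V; y \<in> V; z \<in> V\<rbrakk> \<Longrightarrow> s x (y + z) = s x y + s x z"
    and s_sc_right: "\<And>c x z. \<lbrakk>x \<in> V; z \<in> V\<rbrakk> \<Longrightarrow> s x (c *\<^sub>c z) = cnj c * s x z"
    and s_real: "\<And>x. x \<in> V \<Longrightarrow> Im (s x x) = 0"
    and s_nonneg: "\<And>x. x \<in> V \<Longrightarrow> 0 \<le> Re (s x x)"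
begin

lemma s_minus_left: "x \<in> V \<Longrightarrow> z \<in> V \<Longrightarrow> s (- x) z = - s x z"
  using s_sc_left[of x z "-1"] by (simp add: sc_simps)

lemma s_minus_right: "x \<in> V \<Longrightarrow> z \<in> V \<Longrightarrow> s x (- z) = - s x z"
  using s_sc_right[of x z "-1"] by (simp add: sc_simps)

lemma s_diff_left: "\<lbrakk>x \<in> V; y \<in> V; z \<in> V\<rbrakk> \<Longrightarrow> s (x - y) z = s x z - s y z"
  using s_add_left[of x "- y" z] by (simp add: s_minus_left V_closed)

lemma s_diff_right: "\<lbrakk>x \<in> V; y \<in> V; z \<in> V\<rbrakk> \<Longrightarrow> s x (y - z) = s x y - s x z"
  using s_add_right[of x y "- z"] by (simp add: s_minus_right V_closed)

lemmas s_linear = s_add_left s_sc_left s_add_right s_sc_right s_diff_left s_diff_right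
  s_minus_left s_minus_right

lemma s_zero: "x \<in> V \<Longrightarrow> s 0 x = 0" "x \<in> V \<Longrightarrow> s x 0 = 0"
  using s_sc_left[of x x 0] s_sc_right[of x x 0] by (simp_all add: sc_simps)

text \<open>Polarization: being real at x + y settles the imaginary parts, being real at x + i y the
  real parts.\<close>

lemma s_cnj:
  assumes "x \<in> V" "y \<in> V"
  shows "s y x = cnj (s x y)"
proof -
  have "Im (s (x + y) (x + y)) = 0" "Im (s (x + \<i> *\<^sub>c y) (x + \<i> *\<^sub>c y)) = 0"
    using assms by (auto intro!: s_real V_closed)
  then have "Im (s x y + s y x) = 0" "Im (\<i> * s y x - \<i> * s x y) = 0"
    using assms s_real[of x] s_real[of y] by (simp_all add: s_linear V_closed)
  then show ?thesis by (simp add: complex_eq_iff)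
qed

definition nrm :: "('x \<Rightarrow> complex) \<Rightarrow> real" where
  "nrm x = sqrt (Re (s x x))"

lemma nrm_nonneg: "x \<in> V \<Longrightarrow> 0 \<le> nrm x"
  by (simp add: nrm_def s_nonneg)

lemma nrm_sq: "x \<in> V \<Longrightarrow> (nrm x)\<^sup>2 = Re (s x x)"
  by (simp add: nrm_def s_nonneg)

lemma s_self: "x \<in> V \<Longrightarrow> s x x = of_real ((nrm x)\<^sup>2)"
  by (simp add: nrm_sq complex_eq_iff s_real)

lemma cauchy_schwarz:
  assumes "x \<in> V" "y \<in> V"
  shows "cmod (s x y) \<le> nrm x * nrm y"
proof -
  define a b d where "a = Re (s x x)" and "b = (cmod (s x y))\<^sup>2" and "d = Re (s y y)"
  have quad: "0 \<le> a + 2 * t * b + t\<^sup>2 * b * d" for t :: real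
  proof -
    \<comment> \<open>The phase of \<open>s x y\<close> goes into the scalar, so that the expression
      becomes a real quadratic polynomial in t.\<close>
    define c where "c = of_real t * s x y"
    have "0 \<le> Re (s (x + c *\<^sub>c y) (x + c *\<^sub>c y))"
      using assms by (intro s_nonneg V_closed)
    also have "s (x + c *\<^sub>c y) (x + c *\<^sub>c y)
        = s x x + cnj c * s x y + c * cnj (s x y) + c * cnj c * s y y"
      using assms by (simp add: s_linear V_closed algebra_simps s_cnj[of x y])
    also have "\<dots> = s x x + of_real (2 * t * b) + of_real (t\<^sup>2 * b) * s y y"
      unfolding c_def b_def using complex_norm_square[of "s x y"]
      by (simp add: power2_eq_square algebra_simps)
    also have "Re \<dots> = a + 2 * t * b + t\<^sup>2 * b * d"
      by (simp add: a_def d_def)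
    finally show ?thesis .
  qed
  have "b \<le> a * d"
  proof (cases "d = 0")
    case True
    have "b = 0"
    proof (rule ccontr)
      assume "b \<noteq> 0"
      \<comment> \<open>For d = 0 the polynomial is a + 2 t b, which takes the value -1 at this
        t.\<close>
      with quad[of "- (a + 1) / (2 * b)"] True show False by (simp add: field_simps)
    qed
    then show ?thesis using True by simp
  next
    case False
    then have "d > 0" using s_nonneg[OF assms(2)] by (simp add: d_def)
    \<comment> \<open>The minimum of the quadratic is attained at t = -1/d.\<close>
    with quad[of "- 1 / d"] show ?thesis
      by (simp add: field_simps power2_eq_square)
  qed
  then have "sqrt b \<le> sqrt (a * d)" by simp
  then show ?thesis by (simp add: b_def nrm_def a_def d_def real_sqrt_mult)
qed

lemma nrm_triangle:
  assumes "x \<in> V" "y \<in> V"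
  shows "nrm (x + y) \<le> nrm x + nrm y"
proof (rule power2_le_imp_le)
  have "(nrm (x + y))\<^sup>2 = (nrm x)\<^sup>2 + 2 * Re (s x y) + (nrm y)\<^sup>2"
    using assms by (simp add: nrm_sq V_closed s_linear s_cnj[of x y])
  also have "Re (s x y) \<le> nrm x * nrm y"
    using cauchy_schwarz[OF assms] complex_Re_le_cmod[of "s x y"] by linarith
  finally show "(nrm (x + y))\<^sup>2 \<le> (nrm x + nrm y)\<^sup>2"
    by (simp add: power2_sum)
qed (use assms in \<open>simp add: nrm_nonneg\<close>)

lemma nrm_sc: "x \<in> V \<Longrightarrow> nrm (c *\<^sub>c x) = cmod c * nrm x"
proof -
  assume x: "x \<in> V"
  have "s (c *\<^sub>c x) (c *\<^sub>c x) = of_real ((cmod c)\<^sup>2) * s x x"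
    using x by (simp only: s_linear V_closed complex_norm_square mult_ac)
  then show ?thesis by (simp add: nrm_def real_sqrt_mult)
qed

lemma nrm_minus: "x \<in> V \<Longrightarrow> nrm (- x) = nrm x"
  using nrm_sc[of x "-1"] by (simp add: sc_simps)

lemma nrm_zero: "nrm 0 = 0"
  by (simp add: nrm_def s_zero V_zero)

lemma nrm_diff_commute: "x \<in> V \<Longrightarrow> y \<in> V \<Longrightarrow> nrm (x - y) = nrm (y - x)"
  using nrm_minus[of "x - y"] by (simp add: V_closed)

lemma nrm_diff_triangle: "\<lbrakk>x \<in> V; y \<in> V; z \<in> V\<rbrakk> \<Longrightarrow> nrm (x - z) \<le> nrm (x - y) + nrm (y - z)"
  using nrm_triangle[of "x - y" "y - z"] by (simp add: V_closed)

lemma nrm_diff_abs: "\<lbrakk>x \<in> V; y \<in> V\<rbrakk> \<Longrightarrow> \<bar>nrm x - nrm y\<bar> \<le> nrm (x - y)"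
  using nrm_triangle[of "x - y" y] nrm_triangle[of "y - x" x] nrm_diff_commute[of x y]
  by (simp add: V_closed abs_le_iff)

lemma parallelogram:
  "x \<in> V \<Longrightarrow> y \<in> V \<Longrightarrow> (nrm (x + y))\<^sup>2 + (nrm (x - y))\<^sup>2 = 2 * (nrm x)\<^sup>2 + 2 * (nrm y)\<^sup>2"
  by (simp add: nrm_sq V_closed s_linear)

end

text \<open>Each term of the sequence is replaced by an element of D at distance less than 1/(n+1),
  which affects neither the Cauchy property nor the limit. A bare distance function is used so that
  the argument serves both for Hilbert spaces and for completed star-algebras.\<close>

lemma cauchy_limit_of_dense:
  fixes d :: "'a \<Rightarrow> 'a \<Rightarrow> real"
  assumes tri: "\<And>x y z. \<lbrakk>x \<in> C; y \<in> C; z \<in> C\<rbrakk> \<Longrightarrow> d x z \<le> d x y + d y z"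
    and sym: "\<And>x y. \<lbrakk>x \<in> C; y \<in> C\<rbrakk> \<Longrightarrow> d x y = d y x"
    and nonneg: "\<And>x y. \<lbrakk>x \<in> C; y \<in> C\<rbrakk> \<Longrightarrow> 0 \<le> d x y"
    and D: "D \<subseteq> C" and dense: "\<And>x e. x \<in> C \<Longrightarrow> e > 0 \<Longrightarrow> \<exists>y\<in>D. d x y < e"
    and lim: "\<And>t :: nat \<Rightarrow> 'a. (\<And>n. t n \<in> D) \<Longrightarrow>
      (\<And>e. e > 0 \<Longrightarrow> \<exists>N. \<forall>m\<ge>N. \<forall>n\<ge>N. d (t m) (t n) < e) \<Longrightarrow>
      \<exists>v\<in>C. (\<lambda>n. d (t n) v) \<longlonglongrightarrow> 0"
    and u: "\<And>n :: nat. u n \<in> C"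
    and cauchy: "\<And>e. e > 0 \<Longrightarrow> \<exists>N. \<forall>m\<ge>N. \<forall>n\<ge>N. d (u m) (u n) < e"
  shows "\<exists>v\<in>C. (\<lambda>n. d (u n) v) \<longlonglongrightarrow> 0"
proof -
  have "\<forall>n. \<exists>y\<in>D. d (u n) y < inverse (real (Suc n))"
    using u dense by simp
  then obtain t where t: "\<And>n. t n \<in> D" "\<And>n. d (u n) (t n) < inverse (real (Suc n))"
    by metis
  have tC: "t n \<in> C" for n using t(1) D by blast
  have small: "\<exists>N. \<forall>n\<ge>N. inverse (real (Suc n)) < e" if e: "e > 0" for e :: real
  proof -
    obtain N where "inverse (real (Suc N)) < e" using reals_Archimedean[OF e] by blast
    moreover have "inverse (real (Suc n)) \<le> inverse (real (Suc N))" if "n \<ge> N" for n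
      using that by simp
    ultimately show ?thesis by (intro exI[of _ N]) (meson le_less_trans)
  qed
  have "\<exists>N. \<forall>m\<ge>N. \<forall>n\<ge>N. d (t m) (t n) < e" if e: "e > 0" for e
  proof -
    obtain N1 where N1: "\<forall>n\<ge>N1. inverse (real (Suc n)) < e / 3" using small[of "e / 3"] e by auto
    obtain N2 where N2: "\<forall>m\<ge>N2. \<forall>n\<ge>N2. d (u m) (u n) < e / 3" using cauchy[of "e / 3"] e by auto
    have "d (t m) (t n) < e" if "m \<ge> max N1 N2" "n \<ge> max N1 N2" for m n
    proof -
      have "d (t m) (t n) \<le> d (t m) (u m) + (d (u m) (u n) + d (u n) (t n))"
        using tri[of "t m" "u m" "t n"] tri[of "u m" "u n" "t n"] tC u by force
      moreover have "d (t m) (u m) < e / 3" "d (u n) (t n) < e / 3" "d (u m) (u n) < e / 3"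
        using t(2)[of m] t(2)[of n] N1 N2 that sym[OF tC u, of m m]
        by (auto intro: less_trans)
      ultimately show ?thesis by linarith
    qed
    then show ?thesis by blast
  qed
  from lim[OF t(1) this] obtain v where v: "v \<in> C" "(\<lambda>n. d (t n) v) \<longlonglongrightarrow> 0" by blast
  have "(\<lambda>n. d (u n) v) \<longlonglongrightarrow> 0"
  proof (rule tendsto_sandwich[of "\<lambda>_. 0" _ _ "\<lambda>n. inverse (real (Suc n)) + d (t n) v"])
    show "\<forall>\<^sub>F n in sequentially. d (u n) v \<le> inverse (real (Suc n)) + d (t n) v"
    proof (intro always_eventually allI)
      fix n show "d (u n) v \<le> inverse (real (Suc n)) + d (t n) v"
        using tri[of "u n" "t n" v] u tC v(1) t(2)[of n] by (smt (verit))
    qed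
    show "(\<lambda>n. inverse (real (Suc n)) + d (t n) v) \<longlonglongrightarrow> 0"
      using tendsto_add[OF LIMSEQ_inverse_real_of_nat v(2)] by simp
  qed (use nonneg u v in auto)
  then show ?thesis using v by blast
qed

section \<open>Completion of a semi-inner product space, realised by functions on the index
  set\<close>

locale semi_inner_points = semi_inner V s for V :: "('x \<Rightarrow> complex) set" and s +
  fixes e :: "'x \<Rightarrow> 'x \<Rightarrow> complex"
  assumes e_in: "\<And>g. e g \<in> V"
    and s_expand: "\<And>y. y \<in> V \<Longrightarrow>
      \<exists>S c. finite S \<and> (\<forall>x\<in>V. s x y = (\<Sum>g\<in>S. c g * s x (e g)))"
begin

definition cau :: "(nat \<Rightarrow> 'x \<Rightarrow> complex) \<Rightarrow> bool" where
  "cau X \<longleftrightarrow> (\<forall>n. X n \<in> V) \<and> (\<forall>r>0. \<exists>N. \<forall>m\<ge>N. \<forall>n\<ge>N. nrm (X m - X n) < r)"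

text \<open>A vector of the completion is encoded by its inner products with the points
  \<open>e g\<close>, as in a reproducing kernel space. Classes of Cauchy sequences would have the
  wrong type, since the carriers allowed in \<open>irreps\<close> and \<open>unitary_reps\<close>
  consist of functions on the group.\<close>

definition repr :: "(nat \<Rightarrow> 'x \<Rightarrow> complex) \<Rightarrow> ('x \<Rightarrow> complex) \<Rightarrow> bool" where
  "repr X u \<longleftrightarrow> cau X \<and> (\<forall>g. (\<lambda>n. s (X n) (e g)) \<longlonglongrightarrow> u g)"

definition HC :: "('x \<Rightarrow> complex) set" where
  "HC = {u. \<exists>X. repr X u}"

text \<open>By \<open>ip_lim\<close> any other representing sequences give the same limit.\<close>

definition ip :: "('x \<Rightarrow> complex) \<Rightarrow> ('x \<Rightarrow> complex) \<Rightarrow> complex" where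
  "ip u v = lim (\<lambda>n. s ((SOME X. repr X u) n) ((SOME Y. repr Y v) n))"

lemma cau_V: "cau X \<Longrightarrow> X n \<in> V" by (simp add: cau_def)
lemma repr_V: "repr X u \<Longrightarrow> X n \<in> V" by (simp add: repr_def cau_V)

lemma cauD: "cau X \<Longrightarrow> r > 0 \<Longrightarrow> \<exists>N. \<forall>m\<ge>N. \<forall>n\<ge>N. nrm (X m - X n) < r"
  by (simp add: cau_def)

lemma cau_bounded:
  assumes "cau X" obtains B where "B > 0" "\<And>n. nrm (X n) \<le> B"
proof -
  obtain N where N: "\<forall>m\<ge>N. \<forall>n\<ge>N. nrm (X m - X n) < 1" using cauD[OF assms, of 1] by auto
  define B where "B = Max ((\<lambda>n. nrm (X n)) ` {..N}) + 1"
  have le: "nrm (X n) \<le> B - 1" if "n \<le> N" for n unfolding B_def using that by (simp add: Max_ge)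
  have "nrm (X n) \<le> B" for n
  proof (cases "n \<le> N")
    case False
    then have "nrm (X n - X N) < 1" using N by simp
    then show ?thesis using nrm_diff_abs[OF cau_V cau_V, OF assms assms, of n N] le[of N] by simp
  qed (use le[of n] in auto)
  moreover have "B > 0" using le[of 0] nrm_nonneg[OF cau_V[OF assms, of 0]] by simp
  ultimately show thesis using that by blast
qed

lemma cau_add: assumes "cau X" "cau Y" shows "cau (\<lambda>n. X n + Y n)"
  unfolding cau_def
proof (intro conjI allI impI)
  fix r :: real assume r: "r > 0"
  obtain N M where N: "\<forall>m\<ge>N. \<forall>n\<ge>N. nrm (X m - X n) < r / 2" and M: "\<forall>m\<ge>M. \<forall>n\<ge>M. nrm (Y m - Y n) < r / 2"
    using cauD[OF assms(1), of "r / 2"] cauD[OF assms(2), of "r / 2"] r by auto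
  have "nrm (X m + Y m - (X n + Y n)) < r" if "m \<ge> max N M" "n \<ge> max N M" for m n
  proof -
    have "nrm ((X m - X n) + (Y m - Y n)) \<le> nrm (X m - X n) + nrm (Y m - Y n)"
      by (intro nrm_triangle V_closed cau_V assms)
    moreover have "nrm (X m - X n) < r / 2" "nrm (Y m - Y n) < r / 2" using N M that by auto
    ultimately show ?thesis by (simp add: algebra_simps)
  qed
  then show "\<exists>N. \<forall>m\<ge>N. \<forall>n\<ge>N. nrm (X m + Y m - (X n + Y n)) < r" by blast
qed (use assms in \<open>auto intro: V_closed cau_V\<close>)

lemma cau_sc: assumes "cau X" shows "cau (\<lambda>n. c *\<^sub>c X n)"
  unfolding cau_def
proof (intro conjI allI impI)
  fix r :: real assume r: "r > 0"
  define q where "q = r / (cmod c + 1)"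
  have q: "q > 0" using r by (simp add: q_def add_nonneg_pos)
  obtain N where N: "\<forall>m\<ge>N. \<forall>n\<ge>N. nrm (X m - X n) < q" using cauD[OF assms q] by blast
  have "nrm (c *\<^sub>c X m - c *\<^sub>c X n) < r" if "m \<ge> N" "n \<ge> N" for m n
  proof -
    have "nrm (c *\<^sub>c X m - c *\<^sub>c X n) = cmod c * nrm (X m - X n)"
      using nrm_sc[of "X m - X n" c] cau_V[OF assms] by (simp add: sc_distrib V_closed)
    also have "\<dots> \<le> cmod c * q" using N that by (intro mult_left_mono) (auto intro: less_imp_le)
    also have "\<dots> < (cmod c + 1) * q" using q by (simp add: algebra_simps)
    also have "\<dots> = r" unfolding q_def by (simp add: add_nonneg_eq_0_iff)
    finally show ?thesis .
  qed
  then show "\<exists>N. \<forall>m\<ge>N. \<forall>n\<ge>N. nrm (c *\<^sub>c X m - c *\<^sub>c X n) < r" by blast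
qed (use assms in \<open>auto intro: V_closed cau_V\<close>)

lemma cau_diff: "cau X \<Longrightarrow> cau Y \<Longrightarrow> cau (\<lambda>n. X n - Y n)"
  using cau_add[of X "\<lambda>n. (-1) *\<^sub>c Y n"] cau_sc[of Y "-1"] by (simp add: sc_simps)

lemma s_cauchy: assumes "cau X" "cau Y" shows "convergent (\<lambda>n. s (X n) (Y n))"
proof -
  obtain B where B: "B > 0" "\<And>n. nrm (X n) \<le> B" using cau_bounded[OF assms(1)] by metis
  obtain C where C: "C > 0" "\<And>n. nrm (Y n) \<le> C" using cau_bounded[OF assms(2)] by metis
  have "Cauchy (\<lambda>n. s (X n) (Y n))"
  proof (rule metric_CauchyI)
    fix r :: real assume r: "r > 0"
    obtain N M where N: "\<forall>m\<ge>N. \<forall>n\<ge>N. nrm (X m - X n) < r / (2 * C)"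
      and M: "\<forall>m\<ge>M. \<forall>n\<ge>M. nrm (Y m - Y n) < r / (2 * B)"
      using cauD[OF assms(1), of "r / (2 * C)"] cauD[OF assms(2), of "r / (2 * B)"] r B C by auto
    have "dist (s (X m) (Y m)) (s (X n) (Y n)) < r" if mn: "m \<ge> max N M" "n \<ge> max N M" for m n
    proof -
      note V = cau_V[OF assms(1)] cau_V[OF assms(2)]
      have "s (X m) (Y m) - s (X n) (Y n) = s (X m - X n) (Y m) + s (X n) (Y m - Y n)"
        using V by (simp add: s_linear V_closed)
      then have "dist (s (X m) (Y m)) (s (X n) (Y n))
          \<le> cmod (s (X m - X n) (Y m)) + cmod (s (X n) (Y m - Y n))"
        by (metis dist_norm norm_triangle_ineq)
      also have "\<dots> \<le> nrm (X m - X n) * nrm (Y m) + nrm (X n) * nrm (Y m - Y n)"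
        using V by (intro add_mono cauchy_schwarz V_closed)
      also have "\<dots> \<le> nrm (X m - X n) * C + B * nrm (Y m - Y n)"
        using V B C by (intro add_mono mult_left_mono mult_right_mono nrm_nonneg V_closed)
      also have "nrm (X m - X n) * C < r / 2"
        using N mn C(1) by (simp add: field_simps)
      also have "B * nrm (Y m - Y n) < r / 2"
        using M mn B(1) by (simp add: field_simps)
      finally show ?thesis by simp
    qed
    then show "\<exists>M. \<forall>m\<ge>M. \<forall>n\<ge>M. dist (s (X m) (Y m)) (s (X n) (Y n)) < r" by blast
  qed
  then show ?thesis by (rule Cauchy_convergent)
qed

lemma cau_const: "x \<in> V \<Longrightarrow> cau (\<lambda>_. x)"
  by (simp add: cau_def nrm_zero)

lemma repr_ex: assumes "cau X" obtains u where "repr X u"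
proof -
  have "\<forall>g. \<exists>l. (\<lambda>n. s (X n) (e g)) \<longlonglongrightarrow> l"
    using s_cauchy[OF assms cau_const[OF e_in]] by (auto simp: convergent_def)
  then obtain u where "\<forall>g. (\<lambda>n. s (X n) (e g)) \<longlonglongrightarrow> u g" by metis
  then show thesis using that assms by (auto simp: repr_def)
qed

lemma repr_add: "repr X u \<Longrightarrow> repr Y v \<Longrightarrow> repr (\<lambda>n. X n + Y n) (u + v)"
  unfolding repr_def by (auto simp: s_linear cau_V e_in intro!: cau_add tendsto_intros)

lemma repr_sc: "repr X u \<Longrightarrow> repr (\<lambda>n. c *\<^sub>c X n) (c *\<^sub>c u)"
  unfolding repr_def by (auto simp: s_linear cau_V e_in sc_def[of c u] intro!: cau_sc tendsto_intros)

lemma repr_diff: "repr X u \<Longrightarrow> repr Y v \<Longrightarrow> repr (\<lambda>n. X n - Y n) (u - v)"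
  using repr_add[of X u "\<lambda>n. (-1) *\<^sub>c Y n" "(-1) *\<^sub>c v"] repr_sc[of Y v "-1"] by (simp add: sc_simps)

text \<open>This makes the encoding by functions faithful. By \<open>s_expand\<close> every y in V
  acts as a finite combination of points, so a sequence representing 0 tends weakly to 0. A weakly
  null Cauchy sequence is null in norm: split the square of the norm of X n into its products with X
  n - X N, small by the Cauchy property, and with the fixed vector X N.\<close>

lemma repr_null:
  assumes "repr X 0" shows "(\<lambda>n. nrm (X n)) \<longlonglongrightarrow> 0"
proof -
  have cX: "cau X" and X0: "\<And>g. (\<lambda>n. s (X n) (e g)) \<longlonglongrightarrow> 0" using assms by (auto simp: repr_def)
  note V = cau_V[OF cX]
  have weak: "(\<lambda>n. s (X n) y) \<longlonglongrightarrow> 0" if y: "y \<in> V" for y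
  proof -
    obtain S c where S: "finite S" "\<forall>x\<in>V. s x y = (\<Sum>g\<in>S. c g * s x (e g))" using s_expand[OF y] by blast
    have "(\<lambda>n. \<Sum>g\<in>S. c g * s (X n) (e g)) \<longlonglongrightarrow> (\<Sum>g\<in>S. c g * 0)"
      by (intro tendsto_intros X0)
    then show ?thesis using S V by simp
  qed
  obtain B where B: "B > 0" "\<And>n. nrm (X n) \<le> B" using cau_bounded[OF cX] by metis
  have "(\<lambda>n. (nrm (X n))\<^sup>2) \<longlonglongrightarrow> 0"
  proof (rule LIMSEQ_I)
    fix r :: real assume r: "r > 0"
    obtain N where N: "\<forall>m\<ge>N. \<forall>n\<ge>N. nrm (X m - X n) < r / (2 * B)"
      using cauD[OF cX, of "r / (2 * B)"] r B by auto
    obtain M where M: "\<forall>n\<ge>M. cmod (s (X n) (X N)) < r / 2"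
      using LIMSEQ_D[OF weak[OF V[of N]], of "r / 2"] r by auto
    have "norm ((nrm (X n))\<^sup>2 - 0) < r" if n: "n \<ge> max N M" for n
    proof -
      have "(nrm (X n))\<^sup>2 = Re (s (X n) (X n - X N)) + Re (s (X n) (X N))"
        using V by (simp add: nrm_sq s_linear)
      also have "\<dots> \<le> cmod (s (X n) (X n - X N)) + cmod (s (X n) (X N))"
        by (intro add_mono complex_Re_le_cmod)
      also have "cmod (s (X n) (X n - X N)) \<le> nrm (X n) * nrm (X n - X N)"
        using V by (intro cauchy_schwarz V_closed)
      also have "\<dots> \<le> B * nrm (X n - X N)"
        using V B by (intro mult_right_mono nrm_nonneg V_closed)
      also have "\<dots> < r / 2" using N n B(1) by (simp add: field_simps)
      also have "cmod (s (X n) (X N)) < r / 2" using M n by simp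
      finally show ?thesis by simp
    qed
    then show "\<exists>no. \<forall>n\<ge>no. norm ((nrm (X n))\<^sup>2 - 0) < r" by blast
  qed
  then have "(\<lambda>n. sqrt ((nrm (X n))\<^sup>2)) \<longlonglongrightarrow> sqrt 0" by (rule tendsto_real_sqrt)
  then show ?thesis using V by (simp add: nrm_nonneg)
qed

lemma s_tendsto_zero:
  assumes "cau X" "cau Y" "(\<lambda>n. nrm (X n)) \<longlonglongrightarrow> 0"
  shows "(\<lambda>n. s (X n) (Y n)) \<longlonglongrightarrow> 0" "(\<lambda>n. s (Y n) (X n)) \<longlonglongrightarrow> 0"
proof -
  obtain B where B: "B > 0" "\<And>n. nrm (Y n) \<le> B" using cau_bounded[OF assms(2)] by metis
  have lim: "(\<lambda>n. nrm (X n) * B) \<longlonglongrightarrow> 0" using tendsto_mult_right[OF assms(3), of B] by simp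
  have le: "nrm (X n) * nrm (Y n) \<le> nrm (X n) * B" for n
    using B cau_V[OF assms(1)] by (intro mult_left_mono nrm_nonneg)
  have "cmod (s (X n) (Y n)) \<le> nrm (X n) * B" "cmod (s (Y n) (X n)) \<le> nrm (X n) * B" for n
    using cauchy_schwarz[OF cau_V[OF assms(1)] cau_V[OF assms(2)], of n n]
      cauchy_schwarz[OF cau_V[OF assms(2)] cau_V[OF assms(1)], of n n] le[of n]
    by (auto simp: mult.commute)
  then show "(\<lambda>n. s (X n) (Y n)) \<longlonglongrightarrow> 0" "(\<lambda>n. s (Y n) (X n)) \<longlonglongrightarrow> 0"
    by (auto intro!: Lim_null_comparison[OF _ lim] always_eventually)
qed

text \<open>Two sequences representing the same function differ by one that represents 0, hence by a
  null sequence, and bounded sequences pair with null sequences to 0.\<close>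

lemma ip_lim:
  assumes "repr X u" "repr Y v"
  shows "(\<lambda>n. s (X n) (Y n)) \<longlonglongrightarrow> ip u v"
proof -
  define X' Y' where "X' = (SOME X. repr X u)" and "Y' = (SOME X. repr X v)"
  have X': "repr X' u" and Y': "repr Y' v" unfolding X'_def Y'_def
    using someI[of "\<lambda>X. repr X u" X] someI[of "\<lambda>Y. repr Y v" Y] assms by blast+
  have c: "cau X" "cau Y" "cau X'" "cau Y'" using assms X' Y' by (auto simp: repr_def)
  note V = c[THEN cau_V]
  have n: "(\<lambda>n. nrm (X n - X' n)) \<longlonglongrightarrow> 0" "(\<lambda>n. nrm (Y n - Y' n)) \<longlonglongrightarrow> 0"
    using repr_null[of "\<lambda>n. X n - X' n"] repr_null[of "\<lambda>n. Y n - Y' n"]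
      repr_diff[OF assms(1) X'] repr_diff[OF assms(2) Y'] by auto
  have "(\<lambda>n. s (X' n) (Y' n)) \<longlonglongrightarrow> ip u v"
    unfolding ip_def X'_def[symmetric] Y'_def[symmetric]
    using s_cauchy[OF c(3,4)] by (simp add: convergent_LIMSEQ_iff)
  moreover have "(\<lambda>n. s (X n - X' n) (Y n)) \<longlonglongrightarrow> 0" "(\<lambda>n. s (X' n) (Y n - Y' n)) \<longlonglongrightarrow> 0"
    using s_tendsto_zero(1)[of "\<lambda>n. X n - X' n" Y] s_tendsto_zero(2)[of "\<lambda>n. Y n - Y' n" X'] c n
    by (auto intro!: cau_diff)
  ultimately have "(\<lambda>n. s (X' n) (Y' n) + s (X n - X' n) (Y n) + s (X' n) (Y n - Y' n)) \<longlonglongrightarrow> ip u v + 0 + 0"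
    by (intro tendsto_add)
  then show ?thesis using V by (simp add: s_linear V_closed)
qed

lemma HC_obtain: assumes "u \<in> HC" obtains X where "repr X u"
  using assms by (auto simp: HC_def)

lemma HC_I: "repr X u \<Longrightarrow> u \<in> HC" by (auto simp: HC_def)

sublocale H: semi_inner HC ip
proof
  show "0 \<in> HC" using repr_sc[of "\<lambda>_. 0"] cau_const[OF V_zero] s_zero e_in
    by (intro HC_I[of "\<lambda>_. 0"]) (auto simp: repr_def)
  fix x y z c assume x: "x \<in> HC"
  then obtain X where X: "repr X x" by (rule HC_obtain)
  show "c *\<^sub>c x \<in> HC" using repr_sc[OF X] by (rule HC_I)
  have "(\<lambda>n. s (X n) (X n)) \<longlonglongrightarrow> ip x x" using ip_lim[OF X X] .
  then have l: "(\<lambda>n. Im (s (X n) (X n))) \<longlonglongrightarrow> Im (ip x x)" "(\<lambda>n. Re (s (X n) (X n))) \<longlonglongrightarrow> Re (ip x x)"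
    by (auto intro: tendsto_intros)
  show "Im (ip x x) = 0" using l(1) repr_V[OF X] by (simp add: s_real LIMSEQ_const_iff)
  show "0 \<le> Re (ip x x)" using l(2) repr_V[OF X] by (auto intro!: LIMSEQ_le_const s_nonneg)
  { assume z: "z \<in> HC"
    then obtain Z where Z: "repr Z z" by (rule HC_obtain)
    note V = repr_V[OF X] repr_V[OF Z]
    show "ip (c *\<^sub>c x) z = c * ip x z"
      using LIMSEQ_unique[OF ip_lim[OF repr_sc[OF X] Z] ] tendsto_mult_left[OF ip_lim[OF X Z], of c] V
      by (simp add: s_linear)
    show "ip x (c *\<^sub>c z) = cnj c * ip x z"
      using LIMSEQ_unique[OF ip_lim[OF X repr_sc[OF Z]] ] tendsto_mult_left[OF ip_lim[OF X Z], of "cnj c"] V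
      by (simp add: s_linear)
    assume y: "y \<in> HC"
    then obtain Y where Y: "repr Y y" by (rule HC_obtain)
    note V = V repr_V[OF Y]
    show "ip (x + y) z = ip x z + ip y z"
      using LIMSEQ_unique[OF ip_lim[OF repr_add[OF X Y] Z] ] tendsto_add[OF ip_lim[OF X Z] ip_lim[OF Y Z]] V
      by (simp add: s_linear)
    show "ip x (y + z) = ip x y + ip x z"
      using LIMSEQ_unique[OF ip_lim[OF X repr_add[OF Y Z]] ] tendsto_add[OF ip_lim[OF X Y] ip_lim[OF X Z]] V
      by (simp add: s_linear) }
  assume y: "y \<in> HC"
  then obtain Y where Y: "repr Y y" by (rule HC_obtain)
  show "x + y \<in> HC" using repr_add[OF X Y] by (rule HC_I)
qed

definition emb :: "('x \<Rightarrow> complex) \<Rightarrow> 'x \<Rightarrow> complex" where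
  "emb x = (\<lambda>g. s x (e g))"

lemma repr_emb: "x \<in> V \<Longrightarrow> repr (\<lambda>_. x) (emb x)"
  by (auto simp: repr_def emb_def cau_const)

lemma emb_HC: "x \<in> V \<Longrightarrow> emb x \<in> HC"
  by (rule HC_I[OF repr_emb])

lemma emb_linear: "\<lbrakk>x \<in> V; y \<in> V\<rbrakk> \<Longrightarrow> emb (x + y) = emb x + emb y"
  "x \<in> V \<Longrightarrow> emb (c *\<^sub>c x) = c *\<^sub>c emb x" "\<lbrakk>x \<in> V; y \<in> V\<rbrakk> \<Longrightarrow> emb (x - y) = emb x - emb y"
  by (auto simp: emb_def fun_eq_iff s_linear e_in sc_def[of c "\<lambda>g. s x (e g)"])

lemma ip_emb: "x \<in> V \<Longrightarrow> y \<in> V \<Longrightarrow> ip (emb x) (emb y) = s x y"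
  using ip_lim[OF repr_emb repr_emb, of x y] by (simp add: LIMSEQ_const_iff)

text \<open>The reproducing property. Definiteness, cyclicity of the GNS vector and vanishing
  outside the group all follow from it.\<close>

lemma ip_point: assumes "u \<in> HC" shows "ip u (emb (e g)) = u g"
proof -
  obtain X where X: "repr X u" using assms by (rule HC_obtain)
  then have "(\<lambda>n. s (X n) (e g)) \<longlonglongrightarrow> u g" by (simp add: repr_def)
  with ip_lim[OF X repr_emb[OF e_in]] show ?thesis by (rule LIMSEQ_unique)
qed

text \<open>For fixed n, the differences X n - X m represent \<open>emb (X n) - u\<close>, so the
  norm of this vector is the limit over m of the norms of these differences. In particular V is
  dense in the completion.\<close>

lemma repr_nrm: assumes "repr X u" shows "(\<lambda>n. H.nrm (emb (X n) - u)) \<longlonglongrightarrow> 0"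
proof (rule LIMSEQ_I)
  fix r :: real assume r: "r > 0"
  have cX: "cau X" using assms by (simp add: repr_def)
  note V = cau_V[OF cX]
  obtain N where N: "\<forall>m\<ge>N. \<forall>n\<ge>N. nrm (X m - X n) < r / 2" using cauD[OF cX, of "r / 2"] r by auto
  have "norm (H.nrm (emb (X n) - u) - 0) < r" if n: "n \<ge> N" for n
  proof -
    have rp: "repr (\<lambda>m. X n - X m) (emb (X n) - u)" by (rule repr_diff[OF repr_emb[OF V] assms])
    have "(\<lambda>m. sqrt (Re (s (X n - X m) (X n - X m)))) \<longlonglongrightarrow> H.nrm (emb (X n) - u)"
      unfolding H.nrm_def by (intro tendsto_intros ip_lim rp)
    moreover have "\<exists>M. \<forall>m\<ge>M. sqrt (Re (s (X n - X m) (X n - X m))) \<le> r / 2"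
      using N n by (intro exI[of _ N]) (auto simp: nrm_def[symmetric] intro: less_imp_le)
    ultimately have "H.nrm (emb (X n) - u) \<le> r / 2" by (rule LIMSEQ_le_const2)
    moreover have "0 \<le> H.nrm (emb (X n) - u)" using HC_I[OF rp] by (rule H.nrm_nonneg)
    ultimately show ?thesis using r by simp
  qed
  then show "\<exists>no. \<forall>n\<ge>no. norm (H.nrm (emb (X n) - u) - 0) < r" by blast
qed

lemma nrm_emb: "x \<in> V \<Longrightarrow> H.nrm (emb x) = nrm x"
  by (simp add: H.nrm_def nrm_def ip_emb)

lemma HC_definite: assumes "u \<in> HC" "ip u u = 0" shows "u = 0"
proof
  fix g
  have "cmod (ip u (emb (e g))) \<le> H.nrm u * H.nrm (emb (e g))"
    using assms(1) by (intro H.cauchy_schwarz emb_HC e_in)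
  then show "u g = 0 g" using assms by (simp add: ip_point H.nrm_def)
qed

text \<open>On embedded vectors the norm is that of V; a Cauchy sequence of them therefore comes
  from a Cauchy sequence in V, and the function represented by the latter is the limit. Density does
  the rest.\<close>

lemma HC_complete:
  assumes u: "\<And>n. u n \<in> HC" and cauchy: "\<And>r. r > 0 \<Longrightarrow> \<exists>N. \<forall>m\<ge>N. \<forall>n\<ge>N. H.nrm (u m - u n) < r"
  shows "\<exists>v\<in>HC. (\<lambda>n. H.nrm (u n - v)) \<longlonglongrightarrow> 0"
proof (rule cauchy_limit_of_dense[where D = "emb ` V" and d = "\<lambda>x y. H.nrm (x - y)", OF _ _ _ _ _ _ u cauchy])
  show "\<exists>y\<in>emb ` V. H.nrm (x - y) < r" if x: "x \<in> HC" and r: "r > 0" for x r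
  proof -
    obtain X where X: "repr X x" using x by (rule HC_obtain)
    obtain N where "\<forall>n\<ge>N. norm (H.nrm (emb (X n) - x) - 0) < r"
      using LIMSEQ_D[OF repr_nrm[OF X] r] by blast
    then have "H.nrm (emb (X N) - x) < r" by force
    then show ?thesis using repr_V[OF X, of N] x by (auto simp: H.nrm_diff_commute emb_HC)
  qed
  fix t :: "nat \<Rightarrow> 'x \<Rightarrow> complex" assume t: "\<And>n. t n \<in> emb ` V"
    and c: "\<And>r. r > 0 \<Longrightarrow> \<exists>N. \<forall>m\<ge>N. \<forall>n\<ge>N. H.nrm (t m - t n) < r"
  have "\<forall>n. \<exists>x\<in>V. t n = emb x" using t by blast
  then obtain X where X: "\<And>n. X n \<in> V" "\<And>n. t n = emb (X n)" by metis
  have "cau X" unfolding cau_def using X c by (simp add: emb_linear[symmetric] nrm_emb V_closed)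
  then obtain v where v: "repr X v" by (rule repr_ex)
  show "\<exists>v\<in>HC. (\<lambda>n. H.nrm (t n - v)) \<longlonglongrightarrow> 0"
    using repr_nrm[OF v] HC_I[OF v] X by auto
qed (auto intro: H.nrm_diff_triangle H.nrm_diff_commute H.nrm_nonneg H.V_closed emb_HC)

end

section \<open>The group algebra\<close>

text \<open>The axioms of \<open>unital_cstar_algebra\<close> that do not mention the norm, so that
  group algebras, algebras of Cauchy sequences and quotients can be treated before norms are
  examined.\<close>

locale star_algebra = A?: ring A + module?: Module.module complex_ring A
  for A :: "('a, 'm) cstar_scheme" (structure) +
  assumes smult_mult_left: "\<lbrakk>x \<in> carrier A; y \<in> carrier A\<rbrakk> \<Longrightarrow> (c \<odot> x) \<otimes> y = c \<odot> (x \<otimes> y)"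
    and smult_mult_right: "\<lbrakk>x \<in> carrier A; y \<in> carrier A\<rbrakk> \<Longrightarrow> x \<otimes> (c \<odot> y) = c \<odot> (x \<otimes> y)"
    and star_closed: "x \<in> carrier A \<Longrightarrow> star A x \<in> carrier A"
    and star_star: "x \<in> carrier A \<Longrightarrow> star A (star A x) = x"
    and star_add: "\<lbrakk>x \<in> carrier A; y \<in> carrier A\<rbrakk> \<Longrightarrow> star A (x \<oplus> y) = star A x \<oplus> star A y"
    and star_smult: "x \<in> carrier A \<Longrightarrow> star A (c \<odot> x) = cnj c \<odot> star A x"
    and star_mult: "\<lbrakk>x \<in> carrier A; y \<in> carrier A\<rbrakk> \<Longrightarrow> star A (x \<otimes> y) = star A y \<otimes> star A x"

lemma complex_ring_simps: "carrier complex_ring = UNIV" "a \<otimes>\<^bsub>complex_ring\<^esub> b = a * b"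
  "\<one>\<^bsub>complex_ring\<^esub> = 1" "\<zero>\<^bsub>complex_ring\<^esub> = 0" "a \<oplus>\<^bsub>complex_ring\<^esub> b = a + b"
  by (simp_all add: complex_ring_def)

lemma cring_complex_ring: "cring complex_ring"
proof (rule cringI)
  show "abelian_group complex_ring"
    by (rule abelian_groupI) (auto simp: complex_ring_simps algebra_simps intro: exI[of _ "- _"])
  show "Group.comm_monoid complex_ring"
    by (rule comm_monoidI) (auto simp: complex_ring_simps algebra_simps)
qed (auto simp: complex_ring_simps algebra_simps)

lemma sum_fun_at: "(\<Sum>i\<in>S. f i) x = (\<Sum>i\<in>S. (f i :: 'x \<Rightarrow> complex) x)"
  by (induction S rule: infinite_finite_induct) (auto simp: zero_fun_def plus_fun_def)

definition CG :: "('g, 'm) monoid_scheme \<Rightarrow> ('g \<Rightarrow> complex) set" where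
  "CG G = {x. finite {g. x g \<noteq> 0} \<and> {g. x g \<noteq> 0} \<subseteq> carrier G}"

definition cv :: "('g, 'm) monoid_scheme \<Rightarrow> ('g \<Rightarrow> complex) \<Rightarrow> ('g \<Rightarrow> complex) \<Rightarrow> 'g \<Rightarrow> complex" where
  "cv G x y = (\<lambda>g. if g \<in> carrier G
     then \<Sum>h\<in>{h \<in> carrier G. x h \<noteq> 0}. x h * y (inv\<^bsub>G\<^esub> h \<otimes>\<^bsub>G\<^esub> g) else 0)"

definition adj :: "('g, 'm) monoid_scheme \<Rightarrow> ('g \<Rightarrow> complex) \<Rightarrow> 'g \<Rightarrow> complex" where
  "adj G x = (\<lambda>g. if g \<in> carrier G then cnj (x (inv\<^bsub>G\<^esub> g)) else 0)"

definition dl :: "'g \<Rightarrow> 'g \<Rightarrow> complex" where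
  "dl g = (\<lambda>h. if h = g then 1 else 0)"

text \<open>The linear extension of \<phi> from the group to the group algebra.\<close>

definition Lf :: "('g \<Rightarrow> complex) \<Rightarrow> ('g \<Rightarrow> complex) \<Rightarrow> complex" where
  "Lf \<phi> x = (\<Sum>g\<in>{g. x g \<noteq> 0}. x g * \<phi> g)"

lemma CG_D: "x \<in> CG G \<Longrightarrow> finite {g. x g \<noteq> 0}" "x \<in> CG G \<Longrightarrow> g \<notin> carrier G \<Longrightarrow> x g = 0"
  by (auto simp: CG_def)

lemma CG_I: "finite S \<Longrightarrow> {g. x g \<noteq> 0} \<subseteq> S \<Longrightarrow> S \<subseteq> carrier G \<Longrightarrow> x \<in> CG G"
  unfolding CG_def by (auto intro: finite_subset[of _ S])

lemma CG_supp: assumes "x \<in> CG G" obtains S where "finite S" "S \<subseteq> carrier G" "{g. x g \<noteq> 0} \<subseteq> S"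
  by (rule that[of "{g. x g \<noteq> 0}"]) (use assms in \<open>simp_all add: CG_def\<close>)

lemma CG_space: "function_space (CG G)"
proof
  show "0 \<in> CG G" by (auto simp: CG_def)
  fix x y c assume x: "x \<in> CG G"
  show "c *\<^sub>c x \<in> CG G" using CG_D[OF x] by (intro CG_I[of "{g. x g \<noteq> 0}"]) (auto simp: sc_def)
  assume y: "y \<in> CG G"
  show "x + y \<in> CG G" using CG_D[OF x] CG_D[OF y]
    by (intro CG_I[of "{g. x g \<noteq> 0} \<union> {g. y g \<noteq> 0}"]) auto
qed

lemmas CG_closed = function_space.V_closed[OF CG_space]

lemma CG_sum: "(\<And>i. i \<in> S \<Longrightarrow> f i \<in> CG G) \<Longrightarrow> (\<Sum>i\<in>S. f i) \<in> CG G"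
  by (induction S rule: infinite_finite_induct) (auto intro: CG_closed)

lemma dl_CG: "g \<in> carrier G \<Longrightarrow> dl g \<in> CG G"
  by (rule CG_I[of "{g}"]) (auto simp: dl_def)

lemma CG_comb: "S \<subseteq> carrier G \<Longrightarrow> (\<Sum>h\<in>S. b h *\<^sub>c dl h) \<in> CG G"
  by (intro CG_sum CG_closed dl_CG) auto

lemma CG_expand_on:
  assumes "finite S" "{g. x g \<noteq> 0} \<subseteq> S"
  shows "x = (\<Sum>g\<in>S. x g *\<^sub>c dl g)"
proof
  fix h
  have "(\<Sum>g\<in>S. x g * dl g h) = (\<Sum>g\<in>S. if g = h then x g else 0)"
    by (intro sum.cong) (auto simp: dl_def)
  then show "x h = (\<Sum>g\<in>S. x g *\<^sub>c dl g) h"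
    using assms by (auto simp: sum_fun_at sc_def)
qed

text \<open>Reduces statements linear in x to point masses, where convolution and involution are the
  operations of the group.\<close>

lemma CG_induct [consumes 1, case_names zero add]:
  assumes x: "x \<in> CG G" and zero: "P 0"
    and add: "\<And>c g x. \<lbrakk>g \<in> carrier G; x \<in> CG G; P x\<rbrakk> \<Longrightarrow> P (c *\<^sub>c dl g + x)"
  shows "P x"
proof -
  obtain S where S: "finite S" "S \<subseteq> carrier G" "{g. x g \<noteq> 0} \<subseteq> S" using x by (rule CG_supp)
  have "P (\<Sum>g\<in>S. x g *\<^sub>c dl g)" using S(1,2)
  proof (induction S rule: finite_induct)
    case (insert h F)
    have "P (x h *\<^sub>c dl h + (\<Sum>g\<in>F. x g *\<^sub>c dl g))"
      by (rule add) (use insert in \<open>auto intro: CG_comb\<close>)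
    then show ?case by (simp only: sum.insert[OF insert.hyps(1,2)])
  qed (simp only: sum.empty zero)
  then show ?thesis by (subst CG_expand_on[OF S(1,3)])
qed

lemma Lf_on: "finite S \<Longrightarrow> {g. x g \<noteq> 0} \<subseteq> S \<Longrightarrow> Lf \<phi> x = (\<Sum>g\<in>S. x g * \<phi> g)"
  unfolding Lf_def by (rule sum.mono_neutral_left) auto

lemma Lf_add: assumes x: "x \<in> CG G" and y: "y \<in> CG G" shows "Lf \<phi> (x + y) = Lf \<phi> x + Lf \<phi> y"
proof -
  define S where "S = {g. x g \<noteq> 0} \<union> {g. y g \<noteq> 0}"
  have "finite S" using CG_D(1)[OF x] CG_D(1)[OF y] by (simp add: S_def)
  then show ?thesis
    by (subst (1 2 3) Lf_on[of S]) (auto simp: S_def sum.distrib algebra_simps)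
qed

lemma Lf_sc: "x \<in> CG G \<Longrightarrow> Lf \<phi> (c *\<^sub>c x) = c * Lf \<phi> x"
  using CG_D(1)[of x G]
  by (subst Lf_on[of "{g. x g \<noteq> 0}"]) (auto simp: Lf_def sum_distrib_left sc_def mult.assoc)

lemma Lf_dl: "Lf \<phi> (dl g) = \<phi> g"
  by (subst Lf_on[of "{g}"]) (auto simp: dl_def)

lemma Lf_zero: "Lf \<phi> 0 = 0"
  by (simp add: Lf_def)

lemma Lf_diff: "x \<in> CG G \<Longrightarrow> y \<in> CG G \<Longrightarrow> Lf \<phi> (x - y) = Lf \<phi> x - Lf \<phi> y"
  using Lf_add[of x G "(-1) *\<^sub>c y" \<phi>] Lf_sc[of y G \<phi> "-1"] CG_closed(3)[of y G "-1"]
  by (simp add: sc_simps)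

lemma Lf_fun_add: "Lf (\<lambda>g. a * \<phi> g + b * \<psi> g) x = a * Lf \<phi> x + b * Lf \<psi> x"
  unfolding Lf_def by (simp add: sum_distrib_left sum.distrib algebra_simps)

lemma Lf_fun_sc: "Lf (\<lambda>g. a * \<phi> g) x = a * Lf \<phi> x"
  unfolding Lf_def by (simp add: sum_distrib_left algebra_simps)

context group
begin

lemma cv_on:
  assumes "finite S" "{h. x h \<noteq> 0} \<subseteq> S" "S \<subseteq> carrier G"
  shows "cv G x y = (\<lambda>g. if g \<in> carrier G then \<Sum>h\<in>S. x h * y (inv h \<otimes> g) else 0)"
  unfolding cv_def using assms
  by (intro ext if_cong refl sum.mono_neutral_left) auto

lemma cv_dl_left: "g \<in> carrier G \<Longrightarrow> cv G (dl g) y = (\<lambda>k. if k \<in> carrier G then y (inv g \<otimes> k) else 0)"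
  by (subst cv_on[of "{g}"]) (auto simp: dl_def)

lemma cv_add_left:
  assumes x: "x \<in> CG G" and y: "y \<in> CG G" shows "cv G (x + y) z = cv G x z + cv G y z"
proof -
  define S where "S = {g. x g \<noteq> 0} \<union> {g. y g \<noteq> 0}"
  have S: "finite S" "S \<subseteq> carrier G" using CG_D[OF x] CG_D[OF y] by (auto simp: S_def)
  show ?thesis
    by (subst (1 2 3) cv_on[OF S(1) _ S(2)])
      (auto simp: S_def fun_eq_iff sum.distrib algebra_simps)
qed

lemma cv_sc_left: "x \<in> CG G \<Longrightarrow> cv G (c *\<^sub>c x) z = c *\<^sub>c cv G x z"
proof -
  assume x: "x \<in> CG G"
  show ?thesis
    by (subst (1 2) cv_on[of "{g. x g \<noteq> 0}"])
      (use CG_D[OF x] in \<open>auto simp: fun_eq_iff sum_distrib_left algebra_simps sc_def\<close>)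
qed

lemma cv_add_right: "cv G x (y + z) = cv G x y + cv G x z"
  by (auto simp: cv_def fun_eq_iff sum.distrib algebra_simps)

lemma cv_sc_right: "cv G x (c *\<^sub>c y) = c *\<^sub>c cv G x y"
  by (auto simp: cv_def fun_eq_iff sum_distrib_left algebra_simps sc_def)

lemma cv_zero: "cv G 0 y = 0" "cv G x 0 = 0"
  by (auto simp: cv_def)

lemma cv_dl: "g \<in> carrier G \<Longrightarrow> h \<in> carrier G \<Longrightarrow> cv G (dl g) (dl h) = dl (g \<otimes> h)"
proof -
  assume g: "g \<in> carrier G" and h: "h \<in> carrier G"
  have "inv g \<otimes> k = h \<longleftrightarrow> k = g \<otimes> h" if "k \<in> carrier G" for k
    using g h that by (metis inv_solve_left)
  then show ?thesis using g h unfolding cv_dl_left[OF g] by (auto simp: dl_def fun_eq_iff)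
qed

lemma cv_dl_closed: assumes g: "g \<in> carrier G" and y: "y \<in> CG G" shows "cv G (dl g) y \<in> CG G"
proof (rule CG_I[of "(\<lambda>h. g \<otimes> h) ` {h. y h \<noteq> 0}"])
  show "{k. cv G (dl g) y k \<noteq> 0} \<subseteq> (\<lambda>h. g \<otimes> h) ` {h. y h \<noteq> 0}"
  proof (rule subsetI, rule ccontr)
    fix k assume k: "k \<notin> (\<lambda>h. g \<otimes> h) ` {h. y h \<noteq> 0}" and "k \<in> {k. cv G (dl g) y k \<noteq> 0}"
    have "y (inv g \<otimes> k) = 0" if kc: "k \<in> carrier G"
    proof (rule ccontr)
      assume "y (inv g \<otimes> k) \<noteq> 0"
      moreover have "k = g \<otimes> (inv g \<otimes> k)" using g kc by (simp add: m_assoc[symmetric])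
      ultimately show False using k by blast
    qed
    then show False using g \<open>k \<in> {k. cv G (dl g) y k \<noteq> 0}\<close> by (simp add: cv_dl_left split: if_splits)
  qed
qed (use g CG_D[OF y] in auto)

lemma cv_closed: assumes x: "x \<in> CG G" and y: "y \<in> CG G" shows "cv G x y \<in> CG G"
  using x by (induction rule: CG_induct)
    (simp_all add: cv_zero cv_add_left cv_sc_left dl_CG CG_closed cv_dl_closed y del: plus_fun_apply zero_fun_apply)

lemmas cv_bilinear = cv_add_left cv_sc_left cv_add_right cv_sc_right cv_zero

lemma cv_dl_assoc: "\<lbrakk>g \<in> carrier G; h \<in> carrier G\<rbrakk> \<Longrightarrow> cv G (dl g) (cv G (dl h) z) = cv G (dl (g \<otimes> h)) z"
  by (auto simp: cv_dl_left fun_eq_iff inv_mult_group m_assoc)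

lemma cv_assoc:
  assumes x: "x \<in> CG G" and y: "y \<in> CG G" and z: "z \<in> CG G"
  shows "cv G (cv G x y) z = cv G x (cv G y z)"
  using x
proof (induction rule: CG_induct)
  case (add c g x)
  have "cv G (cv G (dl g) y) z = cv G (dl g) (cv G y z)" using y
  proof (induction rule: CG_induct)
    case (add d h y)
    then show ?case using \<open>g \<in> carrier G\<close>
      by (simp add: cv_bilinear dl_CG CG_closed cv_closed cv_dl cv_dl_assoc del: plus_fun_apply)
  qed (simp add: cv_zero del: zero_fun_apply)
  then show ?case using add y z by (simp add: cv_bilinear dl_CG CG_closed cv_closed del: plus_fun_apply)
qed (simp add: cv_zero del: zero_fun_apply)

lemma adj_add: "adj G (x + y) = adj G x + adj G y"
  by (auto simp: adj_def fun_eq_iff)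

lemma adj_sc: "adj G (c *\<^sub>c x) = cnj c *\<^sub>c adj G x"
  by (auto simp: adj_def fun_eq_iff sc_def)

lemma adj_zero: "adj G 0 = 0"
  by (auto simp: adj_def)

lemma adj_dl: "g \<in> carrier G \<Longrightarrow> adj G (dl g) = dl (inv g)"
  by (auto simp: adj_def dl_def fun_eq_iff)

lemma adj_closed: "x \<in> CG G \<Longrightarrow> adj G x \<in> CG G"
  by (induction rule: CG_induct) (simp_all add: adj_add adj_sc adj_zero adj_dl CG_closed dl_CG del: plus_fun_apply zero_fun_apply)

lemma adj_adj: "x \<in> CG G \<Longrightarrow> adj G (adj G x) = x"
  by (auto simp: adj_def fun_eq_iff CG_D)

lemma adj_cv:
  assumes x: "x \<in> CG G" and y: "y \<in> CG G" shows "adj G (cv G x y) = cv G (adj G y) (adj G x)"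
  using x
proof (induction rule: CG_induct)
  case (add c g x)
  have "adj G (cv G (dl g) y) = cv G (adj G y) (dl (inv g))" using y
  proof (induction rule: CG_induct)
    case (add d h y)
    then show ?case using \<open>g \<in> carrier G\<close>
      by (simp add: cv_bilinear dl_CG CG_closed cv_closed cv_dl adj_add adj_sc adj_dl adj_closed inv_mult_group del: plus_fun_apply)
  qed (simp add: cv_zero adj_zero del: zero_fun_apply)
  then show ?case using add y
    by (simp add: cv_bilinear dl_CG CG_closed cv_closed adj_add adj_sc adj_dl adj_closed del: plus_fun_apply)
qed (simp add: cv_zero adj_zero del: zero_fun_apply)

lemma cv_one: assumes x: "x \<in> CG G" shows "cv G (dl \<one>) x = x" "cv G x (dl \<one>) = x"
proof -
  show "cv G (dl \<one>) x = x" using CG_D[OF x] by (auto simp: cv_dl_left fun_eq_iff)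
  show "cv G x (dl \<one>) = x" using x
    by (induction rule: CG_induct) (simp_all add: cv_bilinear dl_CG CG_closed cv_dl del: plus_fun_apply zero_fun_apply)
qed

lemma group_algebra_simps: "carrier (group_algebra G) = CG G"
  "x \<otimes>\<^bsub>group_algebra G\<^esub> y = cv G x y" "\<one>\<^bsub>group_algebra G\<^esub> = dl \<one>"
  "\<zero>\<^bsub>group_algebra G\<^esub> = 0" "x \<oplus>\<^bsub>group_algebra G\<^esub> y = x + y"
  "c \<odot>\<^bsub>group_algebra G\<^esub> x = c *\<^sub>c x" "star (group_algebra G) x = adj G x"
  "cnorm (group_algebra G) = full_norm G"
  by (auto simp: group_algebra_def CG_def cv_def dl_def sc_def adj_def fun_eq_iff)

lemma star_algebra_group_algebra: "star_algebra (group_algebra G)"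
proof -
  have ab: "abelian_group (group_algebra G)"
  proof (rule abelian_groupI)
    show "\<exists>y\<in>carrier (group_algebra G). y \<oplus>\<^bsub>group_algebra G\<^esub> x = \<zero>\<^bsub>group_algebra G\<^esub>"
      if "x \<in> carrier (group_algebra G)" for x
      using that by (intro bexI[of _ "- x"]) (auto simp: group_algebra_simps intro: CG_closed)
  qed (auto simp: group_algebra_simps CG_closed algebra_simps)
  have r: "ring (group_algebra G)"
  proof (rule ringI[OF ab])
    show "monoid (group_algebra G)"
      by (rule monoidI) (auto simp: group_algebra_simps cv_closed dl_CG cv_assoc cv_one)
  qed (auto simp: group_algebra_simps cv_bilinear)
  have m: "Module.module complex_ring (group_algebra G)"
    by (rule moduleI[OF cring_complex_ring ab])
      (auto simp: group_algebra_simps complex_ring_simps CG_closed sc_simps sc_distrib)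
  show ?thesis
    by (intro star_algebra.intro r m star_algebra_axioms.intro)
      (auto simp: group_algebra_simps cv_bilinear adj_closed adj_adj adj_add adj_sc adj_cv)
qed

section \<open>Positive definite functions\<close>

text \<open>The form of the GNS construction: \<phi>, extended linearly, of the product of the
  adjoint of y with x.\<close>

definition fm :: "('a \<Rightarrow> complex) \<Rightarrow> ('a \<Rightarrow> complex) \<Rightarrow> ('a \<Rightarrow> complex) \<Rightarrow> complex" where
  "fm \<phi> x y = Lf \<phi> (cv G (adj G y) x)"

lemma fm_linear:
  "\<lbrakk>x \<in> CG G; y \<in> CG G; z \<in> CG G\<rbrakk> \<Longrightarrow> fm \<phi> (x + y) z = fm \<phi> x z + fm \<phi> y z"
  "\<lbrakk>x \<in> CG G; z \<in> CG G\<rbrakk> \<Longrightarrow> fm \<phi> (c *\<^sub>c x) z = c * fm \<phi> x z"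
  "\<lbrakk>x \<in> CG G; y \<in> CG G; z \<in> CG G\<rbrakk> \<Longrightarrow> fm \<phi> x (y + z) = fm \<phi> x y + fm \<phi> x z"
  "\<lbrakk>x \<in> CG G; z \<in> CG G\<rbrakk> \<Longrightarrow> fm \<phi> x (c *\<^sub>c z) = cnj c * fm \<phi> x z"
  unfolding fm_def
  by (auto simp: cv_bilinear adj_add adj_sc cv_closed adj_closed Lf_add[where G = G] Lf_sc[where G = G])

lemma fm_dl: "g \<in> carrier G \<Longrightarrow> h \<in> carrier G \<Longrightarrow> fm \<phi> (dl g) (dl h) = \<phi> (inv h \<otimes> g)"
  by (simp add: fm_def adj_dl cv_dl Lf_dl)

lemma fm_zero: "fm \<phi> 0 x = 0" "fm \<phi> x 0 = 0"
  by (simp_all add: fm_def cv_zero adj_zero Lf_zero)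

lemma fm_sum_right:
  assumes "finite S" "S \<subseteq> carrier G" "x \<in> CG G"
  shows "fm \<phi> x (\<Sum>h\<in>S. b h *\<^sub>c dl h) = (\<Sum>h\<in>S. cnj (b h) * fm \<phi> x (dl h))"
  using assms(1,2)
  by (induction S rule: finite_induct) (auto simp: fm_zero fm_linear assms(3) dl_CG CG_closed CG_comb)

lemma fm_sum_left:
  assumes "finite S" "S \<subseteq> carrier G" "x \<in> CG G"
  shows "fm \<phi> (\<Sum>h\<in>S. b h *\<^sub>c dl h) x = (\<Sum>h\<in>S. b h * fm \<phi> (dl h) x)"
  using assms(1,2)
  by (induction S rule: finite_induct) (auto simp: fm_zero fm_linear assms(3) dl_CG CG_closed CG_comb)

lemma fm_expand:
  assumes S: "finite S" "S \<subseteq> carrier G" and x: "{g. x g \<noteq> 0} \<subseteq> S"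
  shows "fm \<phi> x x = (\<Sum>h\<in>S. \<Sum>g\<in>S. cnj (x h) * x g * \<phi> (inv h \<otimes> g))"
proof -
  have xC: "x \<in> CG G" using S x by (auto intro!: CG_I[of S])
  have "fm \<phi> x x = (\<Sum>h\<in>S. cnj (x h) * fm \<phi> x (dl h))"
    using fm_sum_right[OF S xC] CG_expand_on[OF S(1) x] by metis
  also have "\<dots> = (\<Sum>h\<in>S. cnj (x h) * (\<Sum>g\<in>S. x g * fm \<phi> (dl g) (dl h)))"
  proof (intro sum.cong refl)
    fix h assume "h \<in> S"
    then have "dl h \<in> CG G" using S by (auto intro: dl_CG)
    then show "cnj (x h) * fm \<phi> x (dl h) = cnj (x h) * (\<Sum>g\<in>S. x g * fm \<phi> (dl g) (dl h))"
      using fm_sum_left[OF S] CG_expand_on[OF S(1) x] by metis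
  qed
  also have "\<dots> = (\<Sum>h\<in>S. \<Sum>g\<in>S. cnj (x h) * x g * \<phi> (inv h \<otimes> g))"
    using S by (auto simp: sum_distrib_left mult.assoc fm_dl subset_iff intro!: sum.cong)
  finally show ?thesis .
qed

text \<open>The value 0 outside the carrier makes such a function determined by its values on the
  group, so that equality of functions and the topology of pointwise convergence have their expected
  meaning.\<close>

definition posdef :: "('a \<Rightarrow> complex) \<Rightarrow> bool" where
  "posdef \<phi> \<longleftrightarrow> (\<forall>g. g \<notin> carrier G \<longrightarrow> \<phi> g = 0) \<and>
     (\<forall>x\<in>CG G. Im (fm \<phi> x x) = 0 \<and> 0 \<le> Re (fm \<phi> x x))"

definition P1 :: "('a \<Rightarrow> complex) set" where
  "P1 = {\<phi>. posdef \<phi> \<and> \<phi> \<one> = 1}"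

text \<open>The points must be indexed by the whole type. With the point 0 outside the carrier, the
  functions of the completion vanish there.\<close>

definition pt :: "'a \<Rightarrow> 'a \<Rightarrow> complex" where
  "pt g = (if g \<in> carrier G then dl g else 0)"

lemma posdef_off: "posdef \<phi> \<Longrightarrow> g \<notin> carrier G \<Longrightarrow> \<phi> g = 0"
  by (simp add: posdef_def)

lemma semi_inner_fm: assumes "posdef \<phi>" shows "semi_inner (CG G) (fm \<phi>)"
proof -
  interpret function_space "CG G" by (rule CG_space)
  show ?thesis by unfold_locales (use assms in \<open>auto simp: fm_linear posdef_def\<close>)
qed

lemma pt_CG: "pt g \<in> CG G"
  by (auto simp: pt_def dl_CG CG_closed)

lemma points_fm: assumes "posdef \<phi>" shows "semi_inner_points (CG G) (fm \<phi>) pt"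
proof -
  interpret semi_inner "CG G" "fm \<phi>" by (rule semi_inner_fm[OF assms])
  show ?thesis
  proof
    fix y assume y: "y \<in> CG G"
    obtain S where S: "finite S" "S \<subseteq> carrier G" "{g. y g \<noteq> 0} \<subseteq> S" using y by (rule CG_supp)
    have "fm \<phi> x y = (\<Sum>h\<in>S. cnj (y h) * fm \<phi> x (pt h))" if x: "x \<in> CG G" for x
    proof -
      have "fm \<phi> x y = (\<Sum>h\<in>S. cnj (y h) * fm \<phi> x (dl h))"
        using fm_sum_right[OF S(1,2) x, of \<phi> y] CG_expand_on[OF S(1,3)] by metis
      then show ?thesis using S(2) by (auto simp: pt_def subset_iff intro!: sum.cong)
    qed
    then show "\<exists>S c. finite S \<and> (\<forall>x\<in>CG G. fm \<phi> x y = (\<Sum>g\<in>S. c g * fm \<phi> x (pt g)))"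
      using S(1) by (intro exI[of _ S] exI[of _ "\<lambda>h. cnj (y h)"] conjI ballI)
  qed (rule pt_CG)
qed

end

section \<open>The C*-norm obtained from normalized positive definite functions\<close>

context group
begin

definition nrmf :: "('a \<Rightarrow> complex) \<Rightarrow> ('a \<Rightarrow> complex) \<Rightarrow> real" where
  "nrmf \<phi> x = sqrt (Re (fm \<phi> x x))"

text \<open>The supremum of the norms of x applied to the cyclic unit vectors of all GNS
  representations. It agrees with the full norm by \<open>full_norm_eq\<close>, but the
  C*-identities are easier to derive from this description.\<close>

definition pnorm :: "('a \<Rightarrow> complex) \<Rightarrow> real" where
  "pnorm x = (SUP \<phi>\<in>P1. nrmf \<phi> x)"

lemma P1_D: "\<phi> \<in> P1 \<Longrightarrow> posdef \<phi>" "\<phi> \<in> P1 \<Longrightarrow> \<phi> \<one> = 1"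
  by (simp_all add: P1_def)

lemma nrmf_facts:
  assumes "posdef \<phi>"
  shows nrmf_nonneg: "x \<in> CG G \<Longrightarrow> 0 \<le> nrmf \<phi> x"
    and nrmf_sq: "x \<in> CG G \<Longrightarrow> (nrmf \<phi> x)\<^sup>2 = Re (fm \<phi> x x)"
    and fm_self: "x \<in> CG G \<Longrightarrow> fm \<phi> x x = of_real ((nrmf \<phi> x)\<^sup>2)"
    and fm_cauchy_schwarz: "\<lbrakk>x \<in> CG G; y \<in> CG G\<rbrakk> \<Longrightarrow> cmod (fm \<phi> x y) \<le> nrmf \<phi> x * nrmf \<phi> y"
    and nrmf_triangle: "\<lbrakk>x \<in> CG G; y \<in> CG G\<rbrakk> \<Longrightarrow> nrmf \<phi> (x + y) \<le> nrmf \<phi> x + nrmf \<phi> y"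
    and nrmf_sc: "x \<in> CG G \<Longrightarrow> nrmf \<phi> (c *\<^sub>c x) = cmod c * nrmf \<phi> x"
proof -
  interpret semi_inner "CG G" "fm \<phi>" by (rule semi_inner_fm[OF assms])
  have eq: "nrmf \<phi> = nrm" by (simp add: fun_eq_iff nrmf_def nrm_def)
  show "x \<in> CG G \<Longrightarrow> 0 \<le> nrmf \<phi> x" "x \<in> CG G \<Longrightarrow> (nrmf \<phi> x)\<^sup>2 = Re (fm \<phi> x x)"
    "x \<in> CG G \<Longrightarrow> fm \<phi> x x = of_real ((nrmf \<phi> x)\<^sup>2)"
    "\<lbrakk>x \<in> CG G; y \<in> CG G\<rbrakk> \<Longrightarrow> cmod (fm \<phi> x y) \<le> nrmf \<phi> x * nrmf \<phi> y"
    "\<lbrakk>x \<in> CG G; y \<in> CG G\<rbrakk> \<Longrightarrow> nrmf \<phi> (x + y) \<le> nrmf \<phi> x + nrmf \<phi> y"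
    "x \<in> CG G \<Longrightarrow> nrmf \<phi> (c *\<^sub>c x) = cmod c * nrmf \<phi> x"
    unfolding eq by (fact nrm_nonneg nrm_sq s_self cauchy_schwarz nrm_triangle nrm_sc)+
qed

lemma one_CG: "dl \<one> \<in> CG G"
  by (simp add: dl_CG)

lemma nrmf_dl: "g \<in> carrier G \<Longrightarrow> nrmf \<phi> (dl g) = sqrt (Re (\<phi> \<one>))"
  by (simp add: nrmf_def fm_dl)

lemma posdef_one: assumes "posdef \<phi>" shows "Im (\<phi> \<one>) = 0" "0 \<le> Re (\<phi> \<one>)" "\<phi> \<one> = of_real (Re (\<phi> \<one>))"
proof -
  have "Im (fm \<phi> (dl \<one>) (dl \<one>)) = 0" "0 \<le> Re (fm \<phi> (dl \<one>) (dl \<one>))"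
    using assms one_CG by (auto simp: posdef_def)
  then show "Im (\<phi> \<one>) = 0" "0 \<le> Re (\<phi> \<one>)" by (simp_all add: fm_dl)
  then show "\<phi> \<one> = of_real (Re (\<phi> \<one>))" by (simp add: complex_eq_iff)
qed

lemma Lf_eq_fm: "x \<in> CG G \<Longrightarrow> Lf \<phi> x = fm \<phi> x (dl \<one>)"
  by (simp add: fm_def adj_dl cv_one)

lemma posdef_bound: assumes "posdef \<phi>" shows "cmod (\<phi> g) \<le> Re (\<phi> \<one>)"
proof (cases "g \<in> carrier G")
  case True
  have "cmod (fm \<phi> (dl g) (dl \<one>)) \<le> nrmf \<phi> (dl g) * nrmf \<phi> (dl \<one>)"
    using True by (intro fm_cauchy_schwarz assms dl_CG) auto
  then show ?thesis using True posdef_one[OF assms] by (simp add: fm_dl nrmf_dl)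
next
  case False
  then show ?thesis using posdef_one[OF assms] posdef_off[OF assms] by simp
qed

lemma P1_bound: "\<phi> \<in> P1 \<Longrightarrow> cmod (\<phi> g) \<le> 1"
  using posdef_bound[of \<phi> g] by (simp add: P1_def)

lemma Lf_bound: assumes "\<phi> \<in> P1" "x \<in> CG G" shows "cmod (Lf \<phi> x) \<le> nrmf \<phi> x"
proof -
  have "cmod (fm \<phi> x (dl \<one>)) \<le> nrmf \<phi> x * nrmf \<phi> (dl \<one>)"
    by (intro fm_cauchy_schwarz P1_D assms one_CG)
  then show ?thesis using assms by (simp add: Lf_eq_fm nrmf_dl P1_D)
qed

lemma fm_fun_add: "fm (\<lambda>g. a * \<phi> g + b * \<psi> g) x y = a * fm \<phi> x y + b * fm \<psi> x y"
  by (simp add: fm_def Lf_fun_add)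

lemma posdef_comb:
  assumes "posdef \<phi>" "posdef \<psi>" "0 \<le> a" "0 \<le> b"
  shows "posdef (\<lambda>g. of_real a * \<phi> g + of_real b * \<psi> g)"
  using assms unfolding posdef_def by (auto simp: fm_fun_add)

lemma posdef_scale: "posdef \<phi> \<Longrightarrow> 0 \<le> a \<Longrightarrow> posdef (\<lambda>g. of_real a * \<phi> g)"
  using posdef_comb[of \<phi> \<phi> a 0] by simp

text \<open>The vector functional of y: replacing the cyclic vector by its image under y turns the
  functional of \<phi> into z \<mapsto> \<phi>(y' z y), where y' is the adjoint of y.\<close>

definition tr :: "('a \<Rightarrow> complex) \<Rightarrow> ('a \<Rightarrow> complex) \<Rightarrow> 'a \<Rightarrow> complex" where
  "tr \<phi> y = (\<lambda>g. if g \<in> carrier G then fm \<phi> (cv G (dl g) y) y else 0)"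

lemma Lf_tr: assumes y: "y \<in> CG G" and z: "z \<in> CG G" shows "Lf (tr \<phi> y) z = fm \<phi> (cv G z y) y"
  using z
proof (induction rule: CG_induct)
  case (add c g x)
  then show ?case using y
    by (simp add: Lf_add[where G = G] Lf_sc[where G = G] dl_CG CG_closed cv_bilinear fm_linear cv_closed Lf_dl
        del: plus_fun_apply) (simp add: tr_def)
qed (simp add: Lf_zero cv_zero fm_zero del: zero_fun_apply)

lemma fm_adj: "\<lbrakk>x \<in> CG G; y \<in> CG G; z \<in> CG G\<rbrakk> \<Longrightarrow> fm \<phi> (cv G (adj G z) x) y = fm \<phi> x (cv G z y)"
  by (simp add: fm_def adj_cv cv_assoc adj_closed cv_closed)

lemma fm_tr: "\<lbrakk>y \<in> CG G; z \<in> CG G\<rbrakk> \<Longrightarrow> fm (tr \<phi> y) z z = fm \<phi> (cv G z y) (cv G z y)"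
  unfolding fm_def[of "tr \<phi> y"] by (simp add: Lf_tr cv_closed adj_closed cv_assoc fm_adj)

lemma posdef_tr: "posdef \<phi> \<Longrightarrow> y \<in> CG G \<Longrightarrow> posdef (tr \<phi> y)"
  unfolding posdef_def[of "tr \<phi> y"] by (auto simp: fm_tr) (auto simp: tr_def posdef_def cv_closed)

lemma tr_one: "y \<in> CG G \<Longrightarrow> tr \<phi> y \<one> = fm \<phi> y y"
  by (simp add: tr_def cv_one)

lemma normalize_P1: assumes "posdef \<phi>" "Re (\<phi> \<one>) \<noteq> 0" shows "(\<lambda>g. of_real (1 / Re (\<phi> \<one>)) * \<phi> g) \<in> P1"
proof -
  have "of_real (1 / Re (\<phi> \<one>)) * \<phi> \<one> = of_real (1 / Re (\<phi> \<one>)) * of_real (Re (\<phi> \<one>))"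
    using posdef_one(3)[OF assms(1)] by simp
  also have "\<dots> = 1" unfolding of_real_mult[symmetric] using assms(2) by simp
  finally show ?thesis
    unfolding P1_def using posdef_scale[OF assms(1), of "1 / Re (\<phi> \<one>)"] posdef_one[OF assms(1)] by simp
qed

text \<open>This is a coefficient of the representation on the left cosets of H. Collecting the
  values of x by cosets, where \<open>c g\<close> is the coset of g and \<open>a C\<close> the sum
  of x over C, the form becomes the sum of the squares of the moduli of the \<open>a C\<close>. The
  cases of interest are the whole group, the subgroup generated by a Kazhdan set, and the trivial
  subgroup, which gives the trace.\<close>

lemma P1_subgroup: assumes H: "subgroup H G" shows "(\<lambda>g. if g \<in> H then 1 else 0) \<in> P1"
proof -
  define \<phi> :: "'a \<Rightarrow> complex" where "\<phi> = (\<lambda>g. if g \<in> H then 1 else 0)"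
  interpret H: subgroup H G by (rule H)
  define c where "c g = {k \<in> carrier G. inv g \<otimes> k \<in> H}" for g
  have c: "inv h \<otimes> g \<in> H \<longleftrightarrow> c g = c h" if hg: "h \<in> carrier G" "g \<in> carrier G" for h g
  proof
    assume *: "inv h \<otimes> g \<in> H"
    have "inv h \<otimes> k \<in> H \<longleftrightarrow> inv g \<otimes> k \<in> H" if k: "k \<in> carrier G" for k
    proof -
      have "inv h \<otimes> k = (inv h \<otimes> g) \<otimes> (inv g \<otimes> k)"
        using hg k by (simp add: m_assoc inv_solve_left' flip: m_assoc[of g])
      moreover have "inv g \<otimes> k = inv (inv h \<otimes> g) \<otimes> (inv h \<otimes> k)"
        using hg k by (simp add: inv_mult_group m_assoc flip: m_assoc[of h])
      ultimately show ?thesis using * H.m_closed H.m_inv_closed by metis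
    qed
    then show "c g = c h" by (auto simp: c_def)
  next
    assume "c g = c h"
    moreover have "g \<in> c g" using hg by (simp add: c_def)
    ultimately have "g \<in> c h" by simp
    then show "inv h \<otimes> g \<in> H" by (simp add: c_def)
  qed
  have "Im (fm \<phi> x x) = 0 \<and> 0 \<le> Re (fm \<phi> x x)" if x: "x \<in> CG G" for x
  proof -
    obtain S where S: "finite S" "S \<subseteq> carrier G" "{g. x g \<noteq> 0} \<subseteq> S" using x by (rule CG_supp)
    define a where "a C = (\<Sum>g\<in>{g\<in>S. c g = C}. x g)" for C
    have "fm \<phi> x x = (\<Sum>h\<in>S. \<Sum>g\<in>S. if c g = c h then cnj (x h) * x g else 0)"
      unfolding fm_expand[OF S] using S(2) c by (intro sum.cong refl) (auto simp: \<phi>_def subset_iff)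
    also have "\<dots> = (\<Sum>h\<in>S. cnj (x h) * a (c h))"
      unfolding a_def sum_distrib_left by (simp only: sum.inter_filter[OF S(1)])
    also have "\<dots> = (\<Sum>C\<in>c ` S. \<Sum>h\<in>{h\<in>S. c h = C}. cnj (x h) * a (c h))"
      by (rule sum.image_gen[OF S(1)])
    also have "\<dots> = (\<Sum>C\<in>c ` S. \<Sum>h\<in>{h\<in>S. c h = C}. cnj (x h) * a C)"
      by (intro sum.cong refl) auto
    also have "\<dots> = (\<Sum>C\<in>c ` S. cnj (a C) * a C)"
      by (simp add: a_def sum_distrib_right)
    also have "\<dots> = of_real (\<Sum>C\<in>c ` S. (cmod (a C))\<^sup>2)"
      by (simp only: of_real_sum complex_norm_square mult.commute)
    finally show ?thesis by (simp add: sum_nonneg)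
  qed
  then show ?thesis unfolding P1_def posdef_def \<phi>_def[symmetric] by (auto simp: \<phi>_def)
qed

lemma P1_const: "(\<lambda>g. if g \<in> carrier G then 1 else 0) \<in> P1"
  by (rule P1_subgroup[OF subgroup_self])

lemma P1_nonempty: "P1 \<noteq> {}"
  using P1_const by blast

lemma nrmf_bounded: assumes "x \<in> CG G" shows "\<exists>B. \<forall>\<phi>\<in>P1. nrmf \<phi> x \<le> B"
  using assms
proof (induction rule: CG_induct)
  case zero
  show ?case by (intro exI[of _ 0]) (simp add: nrmf_def fm_zero del: zero_fun_apply)
next
  case (add c g x)
  then obtain B where B: "\<forall>\<phi>\<in>P1. nrmf \<phi> x \<le> B" by blast
  have "nrmf \<phi> (c *\<^sub>c dl g + x) \<le> cmod c + B" if \<phi>: "\<phi> \<in> P1" for \<phi>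
  proof -
    have "nrmf \<phi> (c *\<^sub>c dl g + x) \<le> nrmf \<phi> (c *\<^sub>c dl g) + nrmf \<phi> x"
      using add P1_D[OF \<phi>] by (intro nrmf_triangle CG_closed dl_CG)
    also have "nrmf \<phi> (c *\<^sub>c dl g) = cmod c"
      using add P1_D[OF \<phi>] by (simp add: nrmf_sc dl_CG nrmf_dl)
    finally show ?thesis using bspec[OF B \<phi>] by linarith
  qed
  then show ?case by blast
qed

lemma nrmf_bdd: "x \<in> CG G \<Longrightarrow> bdd_above ((\<lambda>\<phi>. nrmf \<phi> x) ` P1)"
  using nrmf_bounded[of x] by (auto simp: bdd_above_def)

lemma nrmf_le_pnorm: "x \<in> CG G \<Longrightarrow> \<phi> \<in> P1 \<Longrightarrow> nrmf \<phi> x \<le> pnorm x"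
  unfolding pnorm_def by (intro cSUP_upper nrmf_bdd)

lemma pnorm_least: "(\<And>\<phi>. \<phi> \<in> P1 \<Longrightarrow> nrmf \<phi> x \<le> B) \<Longrightarrow> pnorm x \<le> B"
  unfolding pnorm_def by (intro cSUP_least P1_nonempty)

lemma pnorm_nonneg: "x \<in> CG G \<Longrightarrow> 0 \<le> pnorm x"
  using nrmf_le_pnorm[OF _ P1_const, of x] nrmf_nonneg[OF P1_D(1)[OF P1_const], of x] by linarith

lemma pnorm_add: assumes "x \<in> CG G" "y \<in> CG G" shows "pnorm (x + y) \<le> pnorm x + pnorm y"
proof (rule pnorm_least)
  fix \<phi> assume \<phi>: "\<phi> \<in> P1"
  show "nrmf \<phi> (x + y) \<le> pnorm x + pnorm y"
    using nrmf_triangle[OF P1_D(1)[OF \<phi>] assms] nrmf_le_pnorm[OF assms(1) \<phi>] nrmf_le_pnorm[OF assms(2) \<phi>]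
    by linarith
qed

lemma pnorm_zero: "pnorm 0 = 0"
  using P1_nonempty by (simp add: pnorm_def nrmf_def fm_zero)

lemma pnorm_sc: assumes x: "x \<in> CG G" shows "pnorm (c *\<^sub>c x) = cmod c * pnorm x"
proof -
  have le: "pnorm (c *\<^sub>c x) \<le> cmod c * pnorm x" if x: "x \<in> CG G" for c x
  proof (rule pnorm_least)
    fix \<phi> assume \<phi>: "\<phi> \<in> P1"
    show "nrmf \<phi> (c *\<^sub>c x) \<le> cmod c * pnorm x"
      using nrmf_le_pnorm[OF x \<phi>] by (simp add: nrmf_sc[OF P1_D(1)[OF \<phi>] x] mult_left_mono)
  qed
  show ?thesis
  proof (cases "c = 0")
    case True
    then show ?thesis by (simp add: sc_simps pnorm_zero)
  next
    case False
    have "pnorm x = pnorm ((1 / c) *\<^sub>c c *\<^sub>c x)" using False by (simp add: sc_simps)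
    also have "\<dots> \<le> cmod (1 / c) * pnorm (c *\<^sub>c x)" by (intro le CG_closed x)
    finally have "cmod c * pnorm x \<le> pnorm (c *\<^sub>c x)" using False by (simp add: norm_divide field_simps)
    then show ?thesis using le[OF x, of c] by linarith
  qed
qed

lemma pnorm_dl: "g \<in> carrier G \<Longrightarrow> pnorm (dl g) \<le> 1"
  by (rule pnorm_least) (simp add: nrmf_dl P1_D)

text \<open>The vector functional \<open>tr \<phi> y\<close> is positive definite with value at the
  unit equal to the square of \<open>nrmf \<phi> y\<close>; after normalization it is one of the
  functions over which \<open>pnorm x\<close> is a supremum.\<close>

lemma nrmf_cv:
  assumes \<phi>: "posdef \<phi>" and x: "x \<in> CG G" and y: "y \<in> CG G"
  shows "nrmf \<phi> (cv G x y) \<le> pnorm x * nrmf \<phi> y"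
proof -
  have pd: "posdef (tr \<phi> y)" by (rule posdef_tr[OF \<phi> y])
  have t1: "Re (tr \<phi> y \<one>) = (nrmf \<phi> y)\<^sup>2" using nrmf_sq[OF \<phi> y] tr_one[OF y] by simp
  have eq: "nrmf \<phi> (cv G x y) = nrmf (tr \<phi> y) x" by (simp add: nrmf_def fm_tr x y)
  show ?thesis
  proof (cases "nrmf \<phi> y = 0")
    case True
    \<comment> \<open>Normalization is impossible here, but a positive definite function is bounded
      by its value at the unit, which is 0.\<close>
    have "tr \<phi> y g = 0" for g using posdef_bound[OF pd, of g] t1 True by simp
    then have "tr \<phi> y = (\<lambda>_. 0)" by blast
    then show ?thesis unfolding eq True by (simp add: nrmf_def fm_def Lf_def)
  next
    case False
    define t where "t = 1 / Re (tr \<phi> y \<one>)"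
    have t: "t > 0" using False t1 by (simp add: t_def)
    have "(\<lambda>g. of_real t * tr \<phi> y g) \<in> P1"
      unfolding t_def using t1 False by (intro normalize_P1 pd) simp
    then have "nrmf (\<lambda>g. of_real t * tr \<phi> y g) x \<le> pnorm x" by (rule nrmf_le_pnorm[OF x])
    also have "nrmf (\<lambda>g. of_real t * tr \<phi> y g) x = sqrt t * nrmf (tr \<phi> y) x"
      by (simp add: nrmf_def fm_def Lf_fun_sc real_sqrt_mult)
    also have "sqrt t = 1 / nrmf \<phi> y"
      unfolding t_def t1 using nrmf_nonneg[OF \<phi> y] by (simp add: real_sqrt_divide)
    finally show ?thesis unfolding eq using False nrmf_nonneg[OF \<phi> y] by (simp add: field_simps)
  qed
qed

lemma pnorm_mult: assumes x: "x \<in> CG G" and y: "y \<in> CG G" shows "pnorm (cv G x y) \<le> pnorm x * pnorm y"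
proof (rule pnorm_least)
  fix \<phi> assume \<phi>: "\<phi> \<in> P1"
  have "nrmf \<phi> (cv G x y) \<le> pnorm x * nrmf \<phi> y" by (rule nrmf_cv[OF P1_D(1)[OF \<phi>] x y])
  also have "\<dots> \<le> pnorm x * pnorm y" by (intro mult_left_mono nrmf_le_pnorm y \<phi> pnorm_nonneg x)
  finally show "nrmf \<phi> (cv G x y) \<le> pnorm x * pnorm y" .
qed

text \<open>The substantial half of the C*-identity: the square of the GNS norm is itself a value of
  the functional, and a normalized functional is dominated by its GNS norm. The other half is
  submultiplicativity, once the norm is known to be invariant under the involution.\<close>

lemma nrmf_sq_le: assumes \<phi>: "\<phi> \<in> P1" and x: "x \<in> CG G"
  shows "(nrmf \<phi> x)\<^sup>2 \<le> pnorm (cv G (adj G x) x)"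
proof -
  have "(nrmf \<phi> x)\<^sup>2 = Re (Lf \<phi> (cv G (adj G x) x))"
    using nrmf_sq[OF P1_D(1)[OF \<phi>] x] by (simp add: fm_def)
  also have "\<dots> \<le> cmod (Lf \<phi> (cv G (adj G x) x))" by (rule complex_Re_le_cmod)
  also have "\<dots> \<le> nrmf \<phi> (cv G (adj G x) x)" by (intro Lf_bound \<phi> cv_closed adj_closed x)
  also have "\<dots> \<le> pnorm (cv G (adj G x) x)" by (intro nrmf_le_pnorm \<phi> cv_closed adj_closed x)
  finally show ?thesis .
qed

lemma pnorm_sq_le: assumes x: "x \<in> CG G" shows "(pnorm x)\<^sup>2 \<le> pnorm (cv G (adj G x) x)"
proof -
  have "pnorm x \<le> sqrt (pnorm (cv G (adj G x) x))"
    using nrmf_sq_le[OF _ x] by (intro pnorm_least) (simp add: real_le_rsqrt)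
  then have "(pnorm x)\<^sup>2 \<le> (sqrt (pnorm (cv G (adj G x) x)))\<^sup>2"
    using pnorm_nonneg[OF x] by (intro power_mono)
  then show ?thesis by (simp add: pnorm_nonneg cv_closed adj_closed x)
qed

lemma pnorm_le_adj: assumes x: "x \<in> CG G" shows "pnorm x \<le> pnorm (adj G x)"
proof (cases "pnorm x = 0")
  case True
  then show ?thesis by (simp add: pnorm_nonneg adj_closed x)
next
  case False
  have "(pnorm x)\<^sup>2 \<le> pnorm (adj G x) * pnorm x"
    using pnorm_sq_le[OF x] pnorm_mult[OF adj_closed[OF x] x] by linarith
  then show ?thesis using False pnorm_nonneg[OF x] by (simp add: power2_eq_square)
qed

lemma pnorm_adj: "x \<in> CG G \<Longrightarrow> pnorm (adj G x) = pnorm x"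
  using pnorm_le_adj[of x] pnorm_le_adj[of "adj G x"] by (simp add: adj_adj adj_closed)

lemma pnorm_cstar: "x \<in> CG G \<Longrightarrow> pnorm (cv G (adj G x) x) = (pnorm x)\<^sup>2"
  using pnorm_sq_le[of x] pnorm_mult[OF adj_closed, of x x] by (simp add: pnorm_adj power2_eq_square)

end

section \<open>The GNS construction\<close>

context semi_inner_points
begin

definition HS :: "('x \<Rightarrow> complex) hilbert" where
  "HS = \<lparr>carrier = HC, mult = (\<lambda>u v. u), one = 0, zero = 0, add = (\<lambda>u v. u + v),
     smult = (\<lambda>c u. c *\<^sub>c u), inner_prod = ip\<rparr>"

lemma HS_simps: "carrier HS = HC" "\<zero>\<^bsub>HS\<^esub> = 0" "u \<oplus>\<^bsub>HS\<^esub> v = u + v" "c \<odot>\<^bsub>HS\<^esub> u = c *\<^sub>c u"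
  "inner_prod HS = ip" "hnorm HS = H.nrm"
  by (simp_all add: HS_def hnorm_def H.nrm_def fun_eq_iff)

lemma abelian_group_HS: "abelian_group HS"
proof (rule abelian_groupI)
  show "\<exists>y\<in>carrier HS. y \<oplus>\<^bsub>HS\<^esub> x = \<zero>\<^bsub>HS\<^esub>" if "x \<in> carrier HS" for x
    using that by (intro bexI[of _ "- x"]) (auto simp: HS_simps intro: H.V_closed)
qed (auto simp: HS_simps H.V_closed algebra_simps)

lemma HS_minus: assumes "u \<in> HC" "v \<in> HC" shows "u \<ominus>\<^bsub>HS\<^esub> v = u - v"
proof -
  interpret abelian_group HS by (rule abelian_group_HS)
  have "\<ominus>\<^bsub>HS\<^esub> v = - v" using assms by (intro minus_equality) (auto simp: HS_simps H.V_closed)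
  then show ?thesis by (simp add: a_minus_def HS_simps)
qed

lemma HS_finsum: "finite S \<Longrightarrow> (\<And>i. i \<in> S \<Longrightarrow> f i \<in> HC) \<Longrightarrow> finsum HS f S = (\<Sum>i\<in>S. f i) \<and> (\<Sum>i\<in>S. f i) \<in> HC"
proof (induction S rule: finite_induct)
  interpret abelian_group HS by (rule abelian_group_HS)
  case empty
  show ?case using finsum_empty by (simp add: HS_simps H.V_zero del: zero_fun_apply)
next
  interpret abelian_group HS by (rule abelian_group_HS)
  case (insert x F)
  then have "finsum HS f (insert x F) = f x \<oplus>\<^bsub>HS\<^esub> finsum HS f F"
    by (intro finsum_insert) (auto simp: HS_simps)
  then show ?case using insert by (simp add: HS_simps H.V_closed del: plus_fun_apply)
qed

lemma hilbert_HS: "hilbert_space HS"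
proof -
  have m: "Module.module complex_ring HS"
    by (rule moduleI[OF cring_complex_ring abelian_group_HS])
      (auto simp: HS_simps complex_ring_simps H.V_closed sc_simps sc_distrib)
  show ?thesis
  proof (intro hilbert_space.intro m hilbert_space_axioms.intro)
    fix u v assume u: "u \<in> carrier HS" "v \<in> carrier HS"
    then show "inner_prod HS u v = cnj (inner_prod HS v u)"
      using H.s_cnj[of v u] by (simp add: HS_simps)
  next
    fix t :: "nat \<Rightarrow> 'x \<Rightarrow> complex"
    assume t: "\<And>n. t n \<in> carrier HS"
      and c: "\<And>r. r > 0 \<Longrightarrow> \<exists>N. \<forall>m\<ge>N. \<forall>n\<ge>N. hnorm HS (t m \<ominus>\<^bsub>HS\<^esub> t n) < r"
    have t': "\<And>n. t n \<in> HC" using t by (simp add: HS_simps)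
    obtain v where "v \<in> HC" "(\<lambda>n. H.nrm (t n - v)) \<longlonglongrightarrow> 0"
      using HC_complete[of t] t' c by (auto simp: HS_simps HS_minus)
    then show "\<exists>v\<in>carrier HS. (\<lambda>n. hnorm HS (t n \<ominus>\<^bsub>HS\<^esub> v)) \<longlonglongrightarrow> 0"
      using t' by (auto simp: HS_simps HS_minus)
  qed (auto simp: HS_simps H.s_linear H.s_nonneg HC_definite)
qed

text \<open>Existence of the orthogonal projection onto a closed subspace, by a minimizing sequence
  and the parallelogram law. It will be applied to the cyclic vector and an invariant
  subspace.\<close>

lemma projection:
  assumes W: "W \<subseteq> HC" "0 \<in> W" "\<And>u v. u \<in> W \<Longrightarrow> v \<in> W \<Longrightarrow> u + v \<in> W" "\<And>c u. u \<in> W \<Longrightarrow> c *\<^sub>c u \<in> W"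
    and closed: "\<And>t v. (\<And>n :: nat. t n \<in> W) \<Longrightarrow> v \<in> HC \<Longrightarrow> (\<lambda>n. H.nrm (t n - v)) \<longlonglongrightarrow> 0 \<Longrightarrow> v \<in> W"
    and x: "x \<in> HC"
  obtains w where "w \<in> W" "\<And>v. v \<in> W \<Longrightarrow> ip (x - w) v = 0"
proof -
  define q where "q v = (H.nrm (x - v))\<^sup>2" for v
  define D where "D = Inf (q ` W)"
  have bdd: "bdd_below (q ` W)" by (intro bdd_belowI[of _ 0]) (auto simp: q_def)
  have D_le: "D \<le> q v" if "v \<in> W" for v unfolding D_def using that by (intro cINF_lower bdd)
  have "\<exists>v\<in>W. q v < D + inverse (real (Suc n))" for n
  proof (rule ccontr)
    assume "\<not> ?thesis"
    then have "D + inverse (real (Suc n)) \<le> D"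
      unfolding D_def using W(2) by (intro cINF_greatest) (auto simp: not_less)
    then show False by simp
  qed
  then obtain t where t: "\<And>n. t n \<in> W" "\<And>n. q (t n) < D + inverse (real (Suc n))" by metis
  have tH: "t n \<in> HC" for n using t(1) W(1) by blast
  have gap: "(H.nrm (t m - t n))\<^sup>2 \<le> 2 * inverse (real (Suc m)) + 2 * inverse (real (Suc n))" for m n
  proof -
    \<comment> \<open>The midpoint lies in W, so its distance to x is no smaller than the infimum;
      this forces t m and t n together.\<close>
    define mid where "mid = (1/2) *\<^sub>c (t m + t n)"
    have mid: "mid \<in> W" using t W unfolding mid_def by blast
    have "(H.nrm ((x - t m) + (x - t n)))\<^sup>2 + (H.nrm ((x - t m) - (x - t n)))\<^sup>2
        = 2 * q (t m) + 2 * q (t n)"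
      unfolding q_def by (rule H.parallelogram) (auto intro: H.V_closed x tH)
    moreover have "(x - t m) + (x - t n) = 2 *\<^sub>c (x - mid)"
      by (auto simp: mid_def sc_def fun_eq_iff algebra_simps)
    moreover have "H.nrm (2 *\<^sub>c (x - mid)) = 2 * H.nrm (x - mid)"
      using mid W(1) x by (subst H.nrm_sc) (auto intro: H.V_closed)
    moreover have "H.nrm ((x - t m) - (x - t n)) = H.nrm (t m - t n)"
      using H.nrm_diff_commute[OF tH tH, of m n] by simp
    ultimately have "4 * q mid + (H.nrm (t m - t n))\<^sup>2 = 2 * q (t m) + 2 * q (t n)"
      by (simp add: q_def power_mult_distrib)
    then show ?thesis using D_le[OF mid] t(2)[of m] t(2)[of n] by linarith
  qed
  have cau: "\<exists>N. \<forall>m\<ge>N. \<forall>n\<ge>N. H.nrm (t m - t n) < r" if r: "r > 0" for r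
  proof -
    obtain N where N: "inverse (real (Suc N)) < r\<^sup>2 / 4" using reals_Archimedean[of "r\<^sup>2 / 4"] r by auto
    have "H.nrm (t m - t n) < r" if mn: "m \<ge> N" "n \<ge> N" for m n
    proof -
      have "inverse (real (Suc m)) \<le> inverse (real (Suc N))" "inverse (real (Suc n)) \<le> inverse (real (Suc N))"
        using mn by simp_all
      then have "(H.nrm (t m - t n))\<^sup>2 < r\<^sup>2" using gap[of m n] N by linarith
      then show ?thesis using r by (simp add: power2_less_imp_less)
    qed
    then show ?thesis by blast
  qed
  obtain w where w: "w \<in> HC" "(\<lambda>n. H.nrm (t n - w)) \<longlonglongrightarrow> 0"
    using HC_complete[of t, OF tH cau] by blast
  have wW: "w \<in> W" by (rule closed[OF t(1) w])
  have "H.nrm (x - w) \<le> sqrt D"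
  proof (rule LIMSEQ_le_const)
    show "(\<lambda>n. sqrt (D + inverse (real (Suc n))) + H.nrm (t n - w)) \<longlonglongrightarrow> sqrt D"
      using tendsto_add[OF tendsto_real_sqrt[OF tendsto_add[OF tendsto_const LIMSEQ_inverse_real_of_nat]] w(2), of D]
      by simp
    have "H.nrm (x - w) \<le> sqrt (D + inverse (real (Suc n))) + H.nrm (t n - w)" for n
      using H.nrm_diff_triangle[OF x tH w(1), of n] t(2)[of n] unfolding q_def
      by (smt (verit) real_le_rsqrt)
    then show "\<exists>N. \<forall>n\<ge>N. H.nrm (x - w) \<le> sqrt (D + inverse (real (Suc n))) + H.nrm (t n - w)" by blast
  qed
  moreover have "D \<ge> 0" unfolding D_def using W(2) by (intro cINF_greatest) (auto simp: q_def)
  ultimately have qw: "q w \<le> D"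
    using H.nrm_nonneg[OF H.V_diff[OF x w(1)]] power_mono[of "H.nrm (x - w)" "sqrt D" 2] by (simp add: q_def)
  have "ip (x - w) v = 0" if v: "v \<in> W" for v
  proof -
    define a where "a = ip (x - w) v"
    have vH: "v \<in> HC" using v W(1) by blast
    have xw: "x - w \<in> HC" by (intro H.V_closed x w)
    have expand: "ip (y - c *\<^sub>c v) (y - c *\<^sub>c v)
        = ip y y - cnj c * ip y v - c * cnj (ip y v) + c * cnj c * ip v v" if "y \<in> HC" for y c
      using that vH H.s_cnj[OF that vH] by (simp add: H.s_linear H.V_closed algebra_simps)
    have ineq: "2 * t * (cmod a)\<^sup>2 \<le> t\<^sup>2 * (cmod a)\<^sup>2 * (H.nrm v)\<^sup>2" for t :: real
    proof -
      \<comment> \<open>A perturbation of w in the direction v, with phase chosen so that the first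
        order term is real.\<close>
      define c where "c = of_real t * a"
      have "w + c *\<^sub>c v \<in> W" using wW v W by blast
      then have "q w \<le> q (w + c *\<^sub>c v)" using D_le qw by fastforce
      also have "q (w + c *\<^sub>c v) = Re (ip ((x - w) - c *\<^sub>c v) ((x - w) - c *\<^sub>c v))"
        unfolding q_def by (subst H.nrm_sq) (auto intro!: H.V_closed x w vH simp: diff_diff_add)
      also have "ip ((x - w) - c *\<^sub>c v) ((x - w) - c *\<^sub>c v)
          = ip (x - w) (x - w) - cnj c * a - c * cnj a + c * cnj c * ip v v"
        using expand[OF xw, of c] by (simp only: a_def)
      also have "\<dots> = ip (x - w) (x - w) - of_real (2 * t * (cmod a)\<^sup>2) + of_real (t\<^sup>2 * (cmod a)\<^sup>2) * ip v v"
        unfolding c_def using complex_norm_square[of a] by (simp add: power2_eq_square algebra_simps)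
      also have "Re \<dots> = q w - 2 * t * (cmod a)\<^sup>2 + t\<^sup>2 * (cmod a)\<^sup>2 * (H.nrm v)\<^sup>2"
        using H.nrm_sq[OF vH] H.nrm_sq[OF xw] by (simp add: q_def)
      finally show ?thesis by simp
    qed
    have "a = 0"
    proof (rule ccontr)
      assume "a \<noteq> 0"
      then have pos: "(cmod a)\<^sup>2 > 0" by simp
      \<comment> \<open>With this t, the quantity that the inequality forces to be at least 2 is at
        most 1; the summand 1 covers the case that v has norm 0.\<close>
      define t where "t = 1 / ((H.nrm v)\<^sup>2 + 1)"
      have n1: "(H.nrm v)\<^sup>2 + 1 > 0" by (simp add: add_nonneg_pos)
      then have tp: "t > 0" by (simp add: t_def)
      have "(cmod a)\<^sup>2 * (t * 2) \<le> (cmod a)\<^sup>2 * (t * (t * (H.nrm v)\<^sup>2))"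
        using ineq[of t] by (simp add: power2_eq_square algebra_simps)
      then have "2 \<le> t * (H.nrm v)\<^sup>2" using pos tp by (simp add: mult_le_cancel_left)
      moreover have "t * (H.nrm v)\<^sup>2 \<le> 1" unfolding t_def using n1 by (simp add: field_simps)
      ultimately show False by simp
    qed
    then show ?thesis by (simp add: a_def)
  qed
  then show thesis using that wW by blast
qed

end

locale gns_rep = group +
  fixes \<phi> :: "'a \<Rightarrow> complex"
  assumes pd: "posdef \<phi>"
begin

sublocale P: semi_inner_points "CG G" "fm \<phi>" pt
  by (rule points_fm[OF pd])

lemma fm_translate: "\<lbrakk>g \<in> carrier G; x \<in> CG G; y \<in> CG G\<rbrakk> \<Longrightarrow> fm \<phi> (cv G (dl g) x) (cv G (dl g) y) = fm \<phi> x y"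
  using fm_adj[of "cv G (dl g) x" y "dl g" \<phi>]
  by (simp add: adj_dl dl_CG cv_closed cv_assoc[symmetric] cv_dl cv_one)

lemma repr_off: assumes "u \<in> P.HC" "h \<notin> carrier G" shows "u h = 0"
  using P.ip_point[OF assms(1), of h] assms P.H.s_zero(2)[of u] by (simp add: pt_def P.emb_def fm_zero zero_fun_def[symmetric])

text \<open>The product of g X with the point h equals that of X with the point at the inverse of g
  times h. So left translation of functions and of Cauchy sequences correspond, and the
  representation has one formula on the whole completion.\<close>

lemma repr_translate:
  assumes g: "g \<in> carrier G" and X: "P.repr X u"
  shows "P.repr (\<lambda>n. cv G (dl g) (X n)) (cv G (dl g) u)"
  unfolding P.repr_def
proof (intro conjI allI)
  have V: "X n \<in> CG G" for n using P.repr_V[OF X] .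
  have "cv G (dl g) (X m) - cv G (dl g) (X n) = cv G (dl g) (X m - X n)" for m n
    using cv_add_right[of "dl g" "X m" "(-1) *\<^sub>c X n"] cv_sc_right[of "dl g" "-1" "X n"] by (simp add: sc_simps)
  then have "P.nrm (cv G (dl g) (X m) - cv G (dl g) (X n)) = P.nrm (X m - X n)" for m n
    using V g by (simp add: P.nrm_def fm_translate CG_closed)
  then show "P.cau (\<lambda>n. cv G (dl g) (X n))"
    using X V g by (simp add: P.cau_def P.repr_def cv_closed dl_CG)
  fix h
  show "(\<lambda>n. fm \<phi> (cv G (dl g) (X n)) (pt h)) \<longlonglongrightarrow> cv G (dl g) u h"
  proof (cases "h \<in> carrier G")
    case True
    have "fm \<phi> (cv G (dl g) (X n)) (pt h) = fm \<phi> (X n) (pt (inv g \<otimes> h))" for n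
    proof -
      have "pt h = cv G (dl g) (pt (inv g \<otimes> h))"
        using True g by (simp add: pt_def cv_dl m_assoc[symmetric])
      then show ?thesis using g V by (simp add: fm_translate pt_CG)
    qed
    then show ?thesis using True g X by (simp add: cv_dl_left P.repr_def)
  next
    case False
    then show ?thesis using g by (simp add: pt_def fm_zero cv_dl_left del: zero_fun_apply)
  qed
qed

lemma HC_translate: "g \<in> carrier G \<Longrightarrow> u \<in> P.HC \<Longrightarrow> cv G (dl g) u \<in> P.HC"
  by (metis P.HC_I P.HC_obtain repr_translate)

lemma ip_translate:
  assumes g: "g \<in> carrier G" and u: "u \<in> P.HC" and v: "v \<in> P.HC"
  shows "P.ip (cv G (dl g) u) (cv G (dl g) v) = P.ip u v"
proof -
  obtain X where X: "P.repr X u" using u by (rule P.HC_obtain)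
  obtain Y where Y: "P.repr Y v" using v by (rule P.HC_obtain)
  have "(\<lambda>n. fm \<phi> (X n) (Y n)) \<longlonglongrightarrow> P.ip (cv G (dl g) u) (cv G (dl g) v)"
    using P.ip_lim[OF repr_translate[OF g X] repr_translate[OF g Y]] P.repr_V[OF X] P.repr_V[OF Y] g
    by (simp add: fm_translate)
  then show ?thesis using P.ip_lim[OF X Y] by (rule LIMSEQ_unique)
qed

lemma HC_one: "u \<in> P.HC \<Longrightarrow> cv G (dl \<one>) u = u"
  by (auto simp: cv_dl_left fun_eq_iff repr_off)

definition rep :: "'a \<Rightarrow> ('a \<Rightarrow> complex) \<Rightarrow> 'a \<Rightarrow> complex" where
  "rep g u = cv G (dl g) u"

lemma unitary_rep_gns: "unitary_rep G P.HS rep"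
  unfolding unitary_rep_def
proof (intro conjI ballI P.hilbert_HS)
  fix g h v assume "g \<in> carrier G" "h \<in> carrier G" "v \<in> carrier P.HS"
  then show "rep (g \<otimes> h) v = rep g (rep h v)" by (simp add: rep_def cv_dl_assoc)
next
  fix g assume g: "g \<in> carrier G"
  have inv: "cv G (dl (inv h)) (cv G (dl h) u) = u" if "h \<in> carrier G" "u \<in> P.HC" for h u
    using that by (simp add: cv_dl_assoc HC_one)
  have "bij_betw (rep g) P.HC P.HC"
    by (rule bij_betwI[where g = "rep (inv g)"]) (use g inv[OF g] inv[of "inv g"] in \<open>auto simp: rep_def HC_translate\<close>)
  then show "unitary_map P.HS P.HS (rep g)"
    unfolding unitary_map_def complex_linear_def
    using g by (auto simp: P.HS_simps HC_translate rep_def cv_add_right cv_sc_right ip_translate)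
qed

text \<open>As a function on the group, the cyclic vector sends g to
  \<open>\<phi> (inv g)\<close>.\<close>

definition cyc :: "'a \<Rightarrow> complex" where "cyc = P.emb (dl \<one>)"

lemma cyc_HC: "cyc \<in> P.HC"
  by (simp add: cyc_def P.emb_HC one_CG)

lemma rep_cyc: assumes g: "g \<in> carrier G" shows "rep g cyc = P.emb (dl g)"
proof
  fix h
  show "rep g cyc h = P.emb (dl g) h"
    using g by (auto simp: rep_def cyc_def P.emb_def cv_dl_left pt_def fm_dl fm_zero inv_mult_group m_assoc)
qed

lemma coeff_cyc: "g \<in> carrier G \<Longrightarrow> P.ip (rep g cyc) cyc = \<phi> g"
  by (simp add: rep_cyc) (simp add: cyc_def P.ip_emb dl_CG fm_dl)

lemma cyclic: assumes u: "u \<in> P.HC" and 0: "\<And>g. g \<in> carrier G \<Longrightarrow> P.ip u (rep g cyc) = 0" shows "u = 0"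
proof
  fix g
  show "u g = 0 g"
    using P.ip_point[OF u, of g] 0[of g] repr_off[OF u, of g]
    by (cases "g \<in> carrier G") (simp_all add: rep_cyc pt_def)
qed

lemma gns_norm:
  assumes x: "x \<in> CG G"
  shows "hnorm P.HS (\<Oplus>\<^bsub>P.HS\<^esub>g\<in>{g \<in> carrier G. x g \<noteq> 0}. x g \<odot>\<^bsub>P.HS\<^esub> rep g cyc) = nrmf \<phi> x"
proof -
  define S where "S = {g \<in> carrier G. x g \<noteq> 0}"
  have S: "finite S" "S \<subseteq> carrier G" "{g. x g \<noteq> 0} \<subseteq> S" using CG_D[OF x] by (auto simp: S_def)
  have inS: "x g *\<^sub>c P.emb (dl g) \<in> P.HC" if "g \<in> S" for g
    using that S by (intro P.H.V_closed P.emb_HC dl_CG) auto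
  have "(\<Oplus>\<^bsub>P.HS\<^esub>g\<in>S. x g \<odot>\<^bsub>P.HS\<^esub> rep g cyc) = (\<Oplus>\<^bsub>P.HS\<^esub>g\<in>S. x g *\<^sub>c P.emb (dl g))"
  proof (rule abelian_monoid.finsum_cong')
    show "abelian_monoid P.HS" using P.abelian_group_HS by (rule abelian_group.axioms)
  qed (use S inS in \<open>auto simp: P.HS_simps rep_cyc\<close>)
  also have "\<dots> = (\<Sum>g\<in>S. x g *\<^sub>c P.emb (dl g))" using P.HS_finsum[OF S(1), of "\<lambda>g. x g *\<^sub>c P.emb (dl g)"] inS by blast
  also have "\<dots> = P.emb (\<Sum>g\<in>S. x g *\<^sub>c dl g)" using S(1,2)
  proof (induction S rule: finite_induct)
    case empty
    show ?case by (simp add: P.emb_def fun_eq_iff fm_zero zero_fun_def[symmetric])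
  next
    case (insert h F)
    then show ?case by (simp add: P.emb_linear CG_comb CG_closed dl_CG del: plus_fun_apply)
  qed
  also have "(\<Sum>g\<in>S. x g *\<^sub>c dl g) = x" using CG_expand_on[OF S(1,3)] by (rule sym)
  finally show ?thesis by (simp add: S_def P.HS_simps P.nrm_emb[OF x]) (simp add: P.nrm_def nrmf_def)
qed

lemma hnorm_cyc: "\<phi> \<one> = 1 \<Longrightarrow> hnorm P.HS cyc = 1"
  by (simp add: P.HS_simps cyc_def P.nrm_emb one_CG) (simp add: P.nrm_def fm_dl)

end

section \<open>Coefficients of unitary representations and the full norm\<close>

context group
begin

text \<open>The Gram matrix of the orbit of v has the entries
  \<open>\<phi> (inv h \<otimes> g)\<close>. Hence the norm of the group algebra element x acting on
  v is a GNS norm, and every unitary representation is controlled by positive definite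
  functions.\<close>

lemma rep_coeff:
  assumes rep: "unitary_rep G H \<pi>" and v: "v \<in> carrier H"
  defines "\<phi> \<equiv> \<lambda>g. if g \<in> carrier G then inner_prod H (\<pi> g v) v else 0"
  shows "posdef \<phi>" "x \<in> CG G \<Longrightarrow> hnorm H (\<Oplus>\<^bsub>H\<^esub>g\<in>{g \<in> carrier G. x g \<noteq> 0}. x g \<odot>\<^bsub>H\<^esub> \<pi> g v) = nrmf \<phi> x"
    "\<phi> \<one> = inner_prod H v v"
proof -
  interpret hilbert_space H using rep by (simp add: unitary_rep_def)
  have U: "unitary_map H H (\<pi> g)" if "g \<in> carrier G" for g using rep that by (simp add: unitary_rep_def)
  have cl: "\<pi> g w \<in> carrier H" if "g \<in> carrier G" "w \<in> carrier H" for g w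
    using U[OF that(1)] that(2) by (auto simp: unitary_map_def complex_linear_def)
  have ml: "\<pi> (g \<otimes> h) w = \<pi> g (\<pi> h w)" if "g \<in> carrier G" "h \<in> carrier G" "w \<in> carrier H" for g h w
    using rep that by (simp add: unitary_rep_def)
  have isom: "inner_prod H (\<pi> g u) (\<pi> g w) = inner_prod H u w"
    if "g \<in> carrier G" "u \<in> carrier H" "w \<in> carrier H" for g u w
    using U[OF that(1)] that by (auto simp: unitary_map_def)
  \<comment> \<open>That the unit acts as the identity is not part of \<open>unitary_rep\<close>; it
    follows because \<pi> at the unit is idempotent and injective.\<close>
  have one: "\<pi> \<one> w = w" if w: "w \<in> carrier H" for w
  proof -
    have "inj_on (\<pi> \<one>) (carrier H)" using U[of \<one>] by (simp add: unitary_map_def bij_betw_def)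
    moreover have "\<pi> \<one> (\<pi> \<one> w) = \<pi> \<one> w" using ml[of \<one> \<one> w] w by simp
    ultimately show ?thesis using cl[of \<one> w] w by (auto dest: inj_onD)
  qed
  have mixed: "inner_prod H (\<pi> g v) (\<pi> h v) = \<phi> (inv h \<otimes> g)" if gh: "g \<in> carrier G" "h \<in> carrier G" for g h
    using isom[of "inv h" "\<pi> g v" "\<pi> h v"] ml[of "inv h" g v] ml[of "inv h" h v] gh v cl
    by (simp add: \<phi>_def one)
  have z: "inner_prod H \<zero>\<^bsub>H\<^esub> w = 0" if "w \<in> carrier H" for w
    using inner_add[of "\<zero>\<^bsub>H\<^esub>" "\<zero>\<^bsub>H\<^esub>" w] that by simp
  have suml: "finsum H f S \<in> carrier H \<and> inner_prod H (finsum H f S) w = (\<Sum>i\<in>S. inner_prod H (f i) w)"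
    if "finite S" "\<And>i. i \<in> S \<Longrightarrow> f i \<in> carrier H" "w \<in> carrier H" for S f w
    using that by (induction S rule: finite_induct) (auto simp: z inner_add Pi_def)
    have *: "inner_prod H (\<Oplus>\<^bsub>H\<^esub>g\<in>{g \<in> carrier G. x g \<noteq> 0}. x g \<odot>\<^bsub>H\<^esub> \<pi> g v)
       (\<Oplus>\<^bsub>H\<^esub>g\<in>{g \<in> carrier G. x g \<noteq> 0}. x g \<odot>\<^bsub>H\<^esub> \<pi> g v) = fm \<phi> x x
      \<and> (\<Oplus>\<^bsub>H\<^esub>g\<in>{g \<in> carrier G. x g \<noteq> 0}. x g \<odot>\<^bsub>H\<^esub> \<pi> g v) \<in> carrier H" if x: "x \<in> CG G" for x
    proof -
      define S where "S = {g \<in> carrier G. x g \<noteq> 0}"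
      have S: "finite S" "S \<subseteq> carrier G" "{g. x g \<noteq> 0} \<subseteq> S" using CG_D[OF x] by (auto simp: S_def)
      define f where "f g = x g \<odot>\<^bsub>H\<^esub> \<pi> g v" for g
      have fc: "f g \<in> carrier H" if "g \<in> S" for g
        using that S cl v smult_closed by (auto simp: f_def complex_ring_simps)
      define F where "F = finsum H f S"
      have F: "F \<in> carrier H" using suml[OF S(1) fc v] by (simp add: F_def)
      have fin: "inner_prod H (f g) w = x g * inner_prod H (\<pi> g v) w" if "g \<in> S" "w \<in> carrier H" for g w
        using that S cl v by (auto simp: f_def inner_smult)
      have "inner_prod H F F = (\<Sum>g\<in>S. x g * inner_prod H (\<pi> g v) F)"
        using suml[OF S(1) fc F] fin F by (simp add: F_def)
      also have "\<dots> = (\<Sum>g\<in>S. x g * (\<Sum>h\<in>S. cnj (x h) * \<phi> (inv h \<otimes> g)))"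
      proof (intro sum.cong refl)
        fix g assume g: "g \<in> S"
        have gv: "\<pi> g v \<in> carrier H" using g S cl v by auto
        have "inner_prod H (\<pi> g v) F = cnj (\<Sum>h\<in>S. x h * inner_prod H (\<pi> h v) (\<pi> g v))"
          using suml[OF S(1) fc gv] fin gv inner_cnj[OF gv F] by (simp add: F_def)
        also have "\<dots> = (\<Sum>h\<in>S. cnj (x h) * inner_prod H (\<pi> g v) (\<pi> h v))"
          unfolding cnj_sum complex_cnj_mult
        proof (intro sum.cong refl)
          fix h assume "h \<in> S"
          then have hv: "\<pi> h v \<in> carrier H" using S cl v by auto
          show "cnj (x h) * cnj (inner_prod H (\<pi> h v) (\<pi> g v)) = cnj (x h) * inner_prod H (\<pi> g v) (\<pi> h v)"
            by (simp only: inner_cnj[OF gv hv])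
        qed
        also have "\<dots> = (\<Sum>h\<in>S. cnj (x h) * \<phi> (inv h \<otimes> g))"
          using S g by (intro sum.cong refl arg_cong2[where f = "(*)"] mixed) auto
        finally show "x g * inner_prod H (\<pi> g v) F = x g * (\<Sum>h\<in>S. cnj (x h) * \<phi> (inv h \<otimes> g))" by simp
      qed
      also have "\<dots> = (\<Sum>g\<in>S. \<Sum>h\<in>S. cnj (x h) * x g * \<phi> (inv h \<otimes> g))"
        unfolding sum_distrib_left by (simp add: mult_ac)
      also have "\<dots> = fm \<phi> x x" unfolding fm_expand[OF S] by (rule sum.swap)
      moreover have "f = (\<lambda>g. x g \<odot>\<^bsub>H\<^esub> \<pi> g v)" by (simp add: f_def fun_eq_iff)
      ultimately show ?thesis using F by (simp add: F_def S_def)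
    qed
    show "x \<in> CG G \<Longrightarrow> hnorm H (\<Oplus>\<^bsub>H\<^esub>g\<in>{g \<in> carrier G. x g \<noteq> 0}. x g \<odot>\<^bsub>H\<^esub> \<pi> g v) = nrmf \<phi> x"
      using * by (simp add: hnorm_def nrmf_def)
    have "Im (fm \<phi> x x) = 0 \<and> 0 \<le> Re (fm \<phi> x x)" if "x \<in> CG G" for x
    proof -
      define F where "F = (\<Oplus>\<^bsub>H\<^esub>g\<in>{g \<in> carrier G. x g \<noteq> 0}. x g \<odot>\<^bsub>H\<^esub> \<pi> g v)"
      have F: "inner_prod H F F = fm \<phi> x x" "F \<in> carrier H" using *[OF that] by (simp_all add: F_def)
      have "Im (inner_prod H F F) = 0" using inner_cnj[OF F(2) F(2)] by (simp add: complex_eq_iff)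
      then show ?thesis using inner_nonneg[OF F(2)] by (simp add: F)
    qed
    then show "posdef \<phi>" by (auto simp: posdef_def \<phi>_def)
  show "\<phi> \<one> = inner_prod H v v" using one[OF v] by (simp add: \<phi>_def)
qed

text \<open>Every vector of the unit ball of a representation gives a positive definite function,
  which bounds the full norm by \<open>pnorm\<close>. Conversely, the GNS representation of each
  normalized function lives on functions on the group, so it occurs in \<open>unitary_reps\<close>,
  and its cyclic vector attains the corresponding value.\<close>

lemma full_norm_eq: assumes x: "x \<in> CG G" shows "full_norm G x = pnorm x"
proof -
  define op where "op H \<pi> v = hnorm H (\<Oplus>\<^bsub>H\<^esub>g\<in>{g \<in> carrier G. x g \<noteq> 0}. x g \<odot>\<^bsub>H\<^esub> \<pi> g v)"
    for H :: "('a \<Rightarrow> complex) hilbert" and \<pi> :: "'a \<Rightarrow> ('a \<Rightarrow> complex) \<Rightarrow> 'a \<Rightarrow> complex" and v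
  define B where "B H = {v \<in> carrier H. hnorm H v \<le> 1}" for H :: "('a \<Rightarrow> complex) hilbert"
  have le: "op H \<pi> v \<le> pnorm x" if r: "unitary_rep G H \<pi>" and v: "v \<in> B H" for H \<pi> v
  proof -
    have vH: "v \<in> carrier H" using v by (simp add: B_def)
    note c = rep_coeff[OF r vH]
    define \<phi> where "\<phi> = (\<lambda>g. if g \<in> carrier G then inner_prod H (\<pi> g v) v else 0)"
    have pd: "posdef \<phi>" unfolding \<phi>_def by (rule c(1))
    have "op H \<pi> v = nrmf \<phi> x" unfolding op_def \<phi>_def by (rule c(2)[OF x])
    \<comment> \<open>The vector v need not have norm 1, so \<phi> need not be normalized; the
      estimate of a product with the unit element takes care of this.\<close>
    also have "\<dots> \<le> pnorm x * nrmf \<phi> (dl \<one>)" using nrmf_cv[OF pd x one_CG] by (simp add: cv_one x)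
    also have "\<dots> \<le> pnorm x * 1"
      using v c(3) by (intro mult_left_mono pnorm_nonneg x) (simp add: nrmf_dl B_def hnorm_def \<phi>_def)
    finally show ?thesis by simp
  qed
  have zero_B: "\<zero>\<^bsub>H\<^esub> \<in> B H" if "unitary_rep G H \<pi>" for H \<pi>
  proof -
    interpret hilbert_space H using that by (simp add: unitary_rep_def)
    have "inner_prod H \<zero>\<^bsub>H\<^esub> \<zero>\<^bsub>H\<^esub> = 0" using inner_add[of "\<zero>\<^bsub>H\<^esub>" "\<zero>\<^bsub>H\<^esub>" "\<zero>\<^bsub>H\<^esub>"] by simp
    then show ?thesis by (simp add: B_def hnorm_def)
  qed
  \<comment> \<open>A supremum of reals is informative only for a nonempty bounded set, hence the
    zero vector and the bound are supplied explicitly.\<close>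
  have inner: "bdd_above (op H \<pi> ` B H)" "(SUP v\<in>B H. op H \<pi> v) \<le> pnorm x" if "unitary_rep G H \<pi>" for H \<pi>
    using le[OF that] zero_B[OF that] by (auto simp: bdd_above_def intro!: cSUP_least)
  have gns: "nrmf \<phi> x \<le> (SUP (H, \<pi>) \<in> unitary_reps G. SUP v\<in>B H. op H \<pi> v)" if \<phi>: "\<phi> \<in> P1" for \<phi>
  proof -
    interpret gns_rep G \<phi> by unfold_locales (rule P1_D(1)[OF \<phi>])
    have "nrmf \<phi> x = op P.HS rep cyc" using gns_norm[OF x] by (simp add: op_def)
    also have "\<dots> \<le> (SUP v\<in>B P.HS. op P.HS rep v)"
      using hnorm_cyc P1_D(2)[OF \<phi>] cyc_HC
      by (intro cSUP_upper inner unitary_rep_gns) (simp add: B_def P.HS_simps(1))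
    also have "\<dots> \<le> (SUP (H, \<pi>) \<in> unitary_reps G. SUP v\<in>B H. op H \<pi> v)"
    proof (rule cSUP_upper2[where x = "(P.HS, rep)"])
      show "bdd_above ((\<lambda>(H, \<pi>). SUP v\<in>B H. op H \<pi> v) ` unitary_reps G)"
        using inner(2) by (auto simp: bdd_above_def unitary_reps_def)
    qed (use unitary_rep_gns in \<open>auto simp: unitary_reps_def\<close>)
    finally show ?thesis .
  qed
  have "(SUP (H, \<pi>) \<in> unitary_reps G. SUP v\<in>B H. op H \<pi> v) \<le> pnorm x"
  proof (rule cSUP_least)
    interpret gns_rep G "\<lambda>g. if g \<in> carrier G then 1 else 0" by unfold_locales (rule P1_D(1)[OF P1_const])
    show "unitary_reps G \<noteq> {}" using unitary_rep_gns by (auto simp: unitary_reps_def)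
  qed (use inner(2) in \<open>auto simp: unitary_reps_def\<close>)
  moreover have "pnorm x \<le> (SUP (H, \<pi>) \<in> unitary_reps G. SUP v\<in>B H. op H \<pi> v)"
    by (rule pnorm_least) (rule gns)
  ultimately show ?thesis unfolding full_norm_def op_def B_def by simp
qed

end

section \<open>Extreme positive definite functions and property (T)\<close>

context gns_rep
begin

lemma coeff_posdef: assumes "w \<in> P.HC"
  shows "posdef (\<lambda>g. if g \<in> carrier G then P.ip (rep g w) w else 0)"
  using rep_coeff(1)[OF unitary_rep_gns, of w] assms by (simp add: P.HS_simps cong: if_cong)

lemma rep_HC: "g \<in> carrier G \<Longrightarrow> u \<in> P.HC \<Longrightarrow> rep g u \<in> P.HC"
  by (simp add: rep_def HC_translate)

lemma rep_linear: "rep g (u + v) = rep g u + rep g v" "rep g (c *\<^sub>c u) = c *\<^sub>c rep g u" "rep g (u - v) = rep g u - rep g v"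
  using cv_add_right[of "dl g" u "(-1) *\<^sub>c v"] cv_sc_right[of "dl g" "-1" v]
  by (simp_all add: rep_def cv_add_right cv_sc_right sc_simps)

lemma rep_inv: "g \<in> carrier G \<Longrightarrow> u \<in> P.HC \<Longrightarrow> rep g (rep (inv g) u) = u"
  by (simp add: rep_def cv_dl_assoc HC_one)

lemma ip_rep_swap: assumes g: "g \<in> carrier G" and u: "u \<in> P.HC" and v: "v \<in> P.HC"
  shows "P.ip (rep g u) v = P.ip u (rep (inv g) v)"
  using ip_translate[OF g u rep_HC[OF inv_closed[OF g] v]] rep_inv[OF g v] by (simp add: rep_def)

text \<open>Project the cyclic vector to w in an invariant subspace W and let z be the rest. The
  coefficients of w and z add up to \<phi>, which is thus a convex combination with the squared
  norms of w and z as weights. Extremality makes the coefficient of w proportional to \<phi>, whence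
  w is a multiple of the cyclic vector, and W is everything unless w or z vanishes.\<close>

lemma extreme_irreducible:
  assumes \<phi>1: "\<phi> \<one> = 1"
    and extreme: "\<And>\<psi> \<eta> t. \<lbrakk>\<psi> \<in> P1; \<eta> \<in> P1; 0 < t; t < 1;
      \<phi> = (\<lambda>g. of_real t * \<psi> g + of_real (1 - t) * \<eta> g)\<rbrakk> \<Longrightarrow> \<psi> = \<phi>"
  shows "irreducible_rep G P.HS rep"
  unfolding irreducible_rep_def
proof (intro conjI allI impI unitary_rep_gns)
  have nc: "P.H.nrm cyc = 1" using hnorm_cyc[OF \<phi>1] by (simp add: P.HS_simps)
  then have "cyc \<noteq> 0" using P.H.nrm_zero by auto
  then show "carrier P.HS \<noteq> {\<zero>\<^bsub>P.HS\<^esub>}" using cyc_HC by (auto simp: P.HS_simps)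
  fix W assume inv: "closed_invariant_subspace G P.HS rep W"
  then have sub: "submodule W complex_ring P.HS" and rW: "\<And>g v. g \<in> carrier G \<Longrightarrow> v \<in> W \<Longrightarrow> rep g v \<in> W"
    unfolding closed_invariant_subspace_def by blast+
  have gW: "subgroup W (add_monoid P.HS)" using sub by (rule submodule.axioms)
  have W: "W \<subseteq> P.HC" "0 \<in> W" "u \<in> W \<Longrightarrow> v \<in> W \<Longrightarrow> u + v \<in> W" "u \<in> W \<Longrightarrow> c *\<^sub>c u \<in> W" for u v c
    using subgroup.subset[OF gW] subgroup.one_closed[OF gW] subgroup.m_closed[OF gW, of u v]
      submodule.smult_closed[OF sub, of c u] by (auto simp: P.HS_simps complex_ring_simps)
  have closed: "v \<in> W" if "\<And>n :: nat. t n \<in> W" "v \<in> P.HC" "(\<lambda>n. P.H.nrm (t n - v)) \<longlonglongrightarrow> 0" for t v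
  proof -
    have "(\<lambda>n. hnorm P.HS (t n \<ominus>\<^bsub>P.HS\<^esub> v)) = (\<lambda>n. P.H.nrm (t n - v))"
      using that(1,2) W(1) by (auto simp: fun_eq_iff P.HS_minus P.HS_simps subset_iff)
    then have "(\<lambda>n. hnorm P.HS (t n \<ominus>\<^bsub>P.HS\<^esub> v)) \<longlonglongrightarrow> 0" "v \<in> carrier P.HS"
      using that by (simp_all add: P.HS_simps)
    then show ?thesis using inv that(1) unfolding closed_invariant_subspace_def by blast
  qed
  have full: "W = carrier P.HS" if cW: "cyc \<in> W"
  proof
    have "P.emb x \<in> W" if "x \<in> CG G" for x using that
    proof (induction rule: CG_induct)
      case zero
      have "P.emb 0 = 0" by (simp add: P.emb_def fun_eq_iff fm_zero zero_fun_def[symmetric])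
      then show ?case using W(2) by (simp del: zero_fun_apply)
    next
      case (add c g x)
      have "P.emb (dl g) \<in> W" using rW[OF add.hyps(1) cW] add.hyps(1) by (simp add: rep_cyc)
      then show ?case using add W(3,4) by (simp add: P.emb_linear dl_CG CG_closed del: plus_fun_apply)
    qed
    then show "carrier P.HS \<subseteq> W"
    proof (intro subsetI)
      fix u assume emb: "\<And>x. x \<in> CG G \<Longrightarrow> P.emb x \<in> W" and "u \<in> carrier P.HS"
      then have u: "u \<in> P.HC" by (simp add: P.HS_simps)
      then obtain X where X: "P.repr X u" by (rule P.HC_obtain)
      show "u \<in> W" by (rule closed[OF _ u P.repr_nrm[OF X]]) (intro emb P.repr_V[OF X])
    qed
  qed (use W(1) in \<open>simp add: P.HS_simps\<close>)
  have "\<exists>w\<in>W. \<forall>v\<in>W. P.ip (cyc - w) v = 0"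
    by (rule P.projection[of W cyc]) (assumption | rule W closed cyc_HC | blast)+
  then obtain w where w: "w \<in> W" "\<And>v. v \<in> W \<Longrightarrow> P.ip (cyc - w) v = 0" by blast
  define z where "z = cyc - w"
  have wH: "w \<in> P.HC" using w(1) W(1) by blast
  have zH: "z \<in> P.HC" unfolding z_def by (intro P.H.V_closed cyc_HC wH)
  have zW: "P.ip z v = 0" "P.ip v z = 0" if "v \<in> W" for v
    using w(2)[OF that] P.H.s_cnj[OF zH, of v] that W(1) by (auto simp: z_def)
  have cyc_eq: "cyc = w + z" by (simp add: z_def)
  \<comment> \<open>For the second product g is moved to the other side: W is invariant under
    inverses, so its orthogonal complement is invariant too.\<close>
  have cross: "P.ip (rep g w) z = 0" "P.ip (rep g z) w = 0" if g: "g \<in> carrier G" for g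
    using zW[OF rW[OF g w(1)]] zW[OF rW[OF inv_closed[OF g] w(1)]] ip_rep_swap[OF g zH wH] by auto
  have split: "\<phi> g = P.ip (rep g w) w + P.ip (rep g z) z" if g: "g \<in> carrier G" for g
    using coeff_cyc[OF g] cross[OF g] unfolding cyc_eq
    by (simp add: rep_linear P.H.s_linear P.H.V_closed rep_HC g wH zH del: plus_fun_apply)
  define t where "t = (P.H.nrm w)\<^sup>2"
  have t1: "1 - t = (P.H.nrm z)\<^sup>2"
    using split[OF one_closed] \<phi>1 P.H.s_self[OF wH] P.H.s_self[OF zH] HC_one[OF wH] HC_one[OF zH]
    by (simp add: rep_def t_def complex_eq_iff flip: of_real_add)
  show "W = {\<zero>\<^bsub>P.HS\<^esub>} \<or> W = carrier P.HS"
  proof (cases "w = 0 \<or> z = 0")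
    case True
    then show ?thesis
    proof
      assume "z = 0"
      then show ?thesis using full w(1) cyc_eq by simp
    next
      assume w0: "w = 0"
      \<comment> \<open>Here the cyclic vector is orthogonal to W; by invariance each v in W is
        orthogonal to its whole orbit.\<close>
      have "v = 0" if v: "v \<in> W" for v
      proof (rule cyclic)
        show vH: "v \<in> P.HC" using v W(1) by blast
        fix g assume g: "g \<in> carrier G"
        have "P.ip v (rep g cyc) = P.ip (rep (inv g) v) cyc"
          using ip_rep_swap[of "inv g" v cyc] g vH cyc_HC by simp
        also have "\<dots> = 0" using zW(2)[OF rW[of "inv g" v]] g v w0 by (simp add: z_def)
        finally show "P.ip v (rep g cyc) = 0" .
      qed
      then show ?thesis using W(2) by (auto simp: P.HS_simps)
    qed
  next
    case False
    have nz: "P.H.nrm u \<noteq> 0" if "u \<in> P.HC" "u \<noteq> 0" for u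
      using P.HC_definite[of u] P.H.s_self[of u] that by auto
    have "(P.H.nrm w)\<^sup>2 > 0" "(P.H.nrm z)\<^sup>2 > 0" using nz[OF wH] nz[OF zH] False by auto
    then have "0 < t" "0 < 1 - t" unfolding t1 by (simp_all only: t_def)
    then have t: "0 < t" "t < 1" by simp_all
    define \<psi> where "\<psi> u r = (\<lambda>g. of_real (1 / r) * (if g \<in> carrier G then P.ip (rep g u) u else 0))" for u and r :: real
    have P1I: "\<psi> u r \<in> P1" if u: "u \<in> P.HC" and r: "r > 0" "r = (P.H.nrm u)\<^sup>2" for u r
      unfolding P1_def using posdef_scale[OF coeff_posdef[OF u], of "1 / r"] r(1) P.H.s_self[OF u] HC_one[OF u]
      by (simp add: \<psi>_def rep_def r(2)[symmetric])
    have "\<psi> w t = \<phi>"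
    proof (rule extreme)
      show "\<psi> w t \<in> P1" by (rule P1I[OF wH t(1) t_def])
      show "\<psi> z (1 - t) \<in> P1" by (rule P1I[OF zH _ t1]) (use t in simp)
      show "\<phi> = (\<lambda>g. of_real t * \<psi> w t g + of_real (1 - t) * \<psi> z (1 - t) g)"
      proof
        fix g
        have "1 - complex_of_real t \<noteq> 0" using t by (simp add: complex_eq_iff)
        then show "\<phi> g = of_real t * \<psi> w t g + of_real (1 - t) * \<psi> z (1 - t) g"
          using t split[of g] posdef_off[OF pd, of g] by (simp add: \<psi>_def)
      qed
    qed fact+
    then have ww: "P.ip (rep g w) w = of_real t * \<phi> g" if "g \<in> carrier G" for g
      using t that by (drule_tac fun_cong[where x = g]) (simp add: \<psi>_def field_simps)
    have tH: "of_real t *\<^sub>c cyc \<in> P.HC" by (intro P.H.V_closed cyc_HC)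
    \<comment> \<open>The coefficient between the cyclic vector and w equals that of w with itself,
      as z and its translates are orthogonal to w. So this difference is orthogonal to the orbit of
      the cyclic vector.\<close>
    have "w - of_real t *\<^sub>c cyc = 0"
    proof (rule cyclic)
      fix g assume g: "g \<in> carrier G"
      have "P.ip (rep g cyc) (w - of_real t *\<^sub>c cyc) = P.ip (rep g w) w - of_real t * \<phi> g"
        using coeff_cyc[OF g] cross(2)[OF g] P.H.s_add_left[of "rep g w" "rep g z" w]
        by (simp add: P.H.s_diff_right P.H.s_sc_right rep_HC g cyc_HC wH tH)
          (simp add: cyc_eq rep_linear rep_HC g wH zH)
      then have "P.ip (rep g cyc) (w - of_real t *\<^sub>c cyc) = 0" using ww[OF g] by simp
      then show "P.ip (w - of_real t *\<^sub>c cyc) (rep g cyc) = 0"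
        using P.H.s_cnj[of "rep g cyc" "w - of_real t *\<^sub>c cyc"] g by (simp add: rep_HC cyc_HC P.H.V_diff wH tH)
    qed (intro P.H.V_closed wH tH)
    then have "cyc = of_real (1 / t) *\<^sub>c w" using t by (simp add: sc_simps)
    then show ?thesis using full W(4)[OF w(1)] by metis
  qed
qed

end

section \<open>Compactness and faces of the set of normalized positive definite functions\<close>

lemma continuous_on_coordinate: "continuous_on UNIV (\<lambda>\<phi> :: 'x \<Rightarrow> complex. \<phi> g)"
  by (rule continuous_on_product_coordinates)

lemma continuous_on_Lf: "continuous_on UNIV (\<lambda>\<phi>. Lf \<phi> x)"
  unfolding Lf_def by (intro continuous_intros continuous_on_coordinate)

context group
begin

lemma closed_P1: "closed P1"
proof -
  have "P1 = {\<phi>. \<phi> \<one> = 1} \<inter> (\<Inter>g\<in>- carrier G. {\<phi>. \<phi> g = 0})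
      \<inter> (\<Inter>x\<in>CG G. {\<phi>. Im (fm \<phi> x x) = 0} \<inter> {\<phi>. 0 \<le> Re (fm \<phi> x x)})"
    by (auto simp: P1_def posdef_def)
  also have "closed \<dots>" unfolding fm_def
    by (intro closed_Int closed_INT ballI closed_Collect_eq closed_Collect_le continuous_intros
        continuous_on_coordinate continuous_on_Lf)
  finally show ?thesis .
qed

text \<open>The theorem of Tychonoff: values lie in the unit disc, and each defining condition is
  closed because it involves only finitely many coordinates.\<close>

lemma compact_P1: "compact P1"
proof -
  have "compactin (product_topology (\<lambda>_. euclidean) UNIV) (PiE UNIV (\<lambda>_ :: 'a. cball (0 :: complex) 1))"
    by (simp add: compactin_PiE)
  then have "compact (PiE UNIV (\<lambda>_ :: 'a. cball (0 :: complex) 1))"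
    by (simp add: euclidean_product_topology)
  moreover have "P1 \<subseteq> PiE UNIV (\<lambda>_. cball 0 1)"
    using P1_bound by (auto simp: dist_norm)
  ultimately show ?thesis using closed_P1 by (metis compact_Int_closed inf.absorb2)
qed

definition affine_cont :: "(('a \<Rightarrow> complex) \<Rightarrow> real) \<Rightarrow> bool" where
  "affine_cont f \<longleftrightarrow> continuous_on UNIV f \<and>
     (\<forall>\<psi> \<eta> t. f (\<lambda>g. of_real t * \<psi> g + of_real (1 - t) * \<eta> g) = t * f \<psi> + (1 - t) * f \<eta>)"

definition face :: "('a \<Rightarrow> complex) set \<Rightarrow> bool" where
  "face F \<longleftrightarrow> closed F \<and> F \<noteq> {} \<and> F \<subseteq> P1 \<and> (\<forall>\<psi>\<in>P1. \<forall>\<eta>\<in>P1. \<forall>t. 0 < t \<longrightarrow> t < 1 \<longrightarrow>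
     (\<lambda>g. of_real t * \<psi> g + of_real (1 - t) * \<eta> g) \<in> F \<longrightarrow> \<psi> \<in> F \<and> \<eta> \<in> F)"

text \<open>A proper average of two values that are both at least the minimum equals the minimum
  only if both values do.\<close>

lemma face_argmin:
  assumes F: "face F" and f: "affine_cont f" and m: "m \<in> F" "\<And>\<psi>. \<psi> \<in> F \<Longrightarrow> f m \<le> f \<psi>"
  shows "face {\<psi>\<in>F. f \<psi> \<le> f m}"
  unfolding face_def
proof (intro conjI ballI allI impI)
  have cont: "continuous_on UNIV f" using f by (simp add: affine_cont_def)
  have "{\<psi>\<in>F. f \<psi> \<le> f m} = F \<inter> {\<psi>. f \<psi> \<le> f m}" by auto
  then show "closed {\<psi>\<in>F. f \<psi> \<le> f m}"
    using F cont by (auto simp: face_def intro!: closed_Int closed_Collect_le continuous_intros)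
  fix \<psi> \<eta> and t :: real
  assume *: "\<psi> \<in> P1" "\<eta> \<in> P1" "0 < t" "t < 1"
    and in_F: "(\<lambda>g. of_real t * \<psi> g + of_real (1 - t) * \<eta> g) \<in> {\<psi>\<in>F. f \<psi> \<le> f m}"
  have FF: "\<psi> \<in> F" "\<eta> \<in> F" using F * in_F by (auto simp: face_def)
  have "t * f \<psi> + (1 - t) * f \<eta> \<le> f m" using in_F f by (auto simp: affine_cont_def)
  then have "t * (f \<psi> - f m) + (1 - t) * (f \<eta> - f m) \<le> 0" by (simp add: algebra_simps)
  moreover have nn: "0 \<le> t * (f \<psi> - f m)" "0 \<le> (1 - t) * (f \<eta> - f m)"
    using m(2)[OF FF(1)] m(2)[OF FF(2)] * by (auto intro: mult_nonneg_nonneg)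
  ultimately have "t * (f \<psi> - f m) = 0" "(1 - t) * (f \<eta> - f m) = 0" by linarith+
  then show "\<psi> \<in> {\<psi>\<in>F. f \<psi> \<le> f m}" "\<eta> \<in> {\<psi>\<in>F. f \<psi> \<le> f m}" using * FF by auto
qed (use F m in \<open>auto simp: face_def\<close>)

lemma face_min:
  assumes F: "face F" and f: "affine_cont f" obtains m where "m \<in> F" "\<And>\<psi>. \<psi> \<in> F \<Longrightarrow> f m \<le> f \<psi>"
proof -
  have "compact F" using compact_P1 F by (metis compact_Int_closed face_def inf.absorb2)
  moreover have "continuous_on F f" using f continuous_on_subset by (auto simp: affine_cont_def)
  ultimately obtain m where "m \<in> F" "\<forall>\<psi>\<in>F. f m \<le> f \<psi>"
    using continuous_attains_inf[of F f] F by (auto simp: face_def)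
  then show thesis using that by blast
qed

text \<open>Zorn's lemma for reverse inclusion. Finite subfamilies of a chain contain a member below
  all the others, so compactness makes the intersection of the chain nonempty, and it is again a
  face.\<close>

lemma minimal_face:
  assumes F: "face F" obtains M where "face M" "M \<subseteq> F" "\<And>N. face N \<Longrightarrow> N \<subseteq> M \<Longrightarrow> N = M"
proof -
  define A where "A = {N. face N \<and> N \<subseteq> F}"
  have "\<exists>M\<in>A. \<forall>N\<in>A. M \<supseteq> N \<longrightarrow> N = M"
  proof (rule predicate_Zorn)
    show "partial_order_on A (relation_of (\<supseteq>) A)"
      by (rule partial_order_on_relation_ofI) auto
    fix C assume C: "C \<in> Chains (relation_of (\<supseteq>) A)"
    have CA: "C \<subseteq> A" using C by (auto simp: Chains_def relation_of_def)
    have chain: "N \<subseteq> N' \<or> N' \<subseteq> N" if "N \<in> C" "N' \<in> C" for N N'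
      using C that by (auto simp: Chains_def relation_of_def)
    show "\<exists>U\<in>A. \<forall>N\<in>C. N \<supseteq> U"
    proof (cases "C = {}")
      case True
      then show ?thesis using F by (auto simp: A_def)
    next
      case False
      have fc: "face N" "N \<subseteq> F" if "N \<in> C" for N using that CA by (auto simp: A_def)
      have fin: "\<exists>N\<in>C. N \<subseteq> \<Inter>D" if "finite D" "D \<subseteq> C" "D \<noteq> {}" for D
        using that(1,3,2)
      proof (induction D rule: finite_ne_induct)
        case (insert N D)
        then obtain N' where "N' \<in> C" "N' \<subseteq> \<Inter>D" by auto
        then show ?case using chain[of N N'] insert.prems by (intro bexI[of _ "if N \<subseteq> N' then N else N'"]) auto
      qed auto
      have "P1 \<inter> \<Inter>C \<noteq> {}"
      proof (rule compact_imp_fip[OF compact_P1])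
        fix D assume D: "finite D" "D \<subseteq> C"
        show "P1 \<inter> \<Inter>D \<noteq> {}"
        proof (cases "D = {}")
          case True
          then show ?thesis using P1_nonempty by simp
        next
          case False
          then obtain N where "N \<in> C" "N \<subseteq> \<Inter>D" using fin D by blast
          moreover then have "N \<noteq> {}" "N \<subseteq> P1" using fc[of N] by (simp_all add: face_def)
          ultimately show ?thesis by blast
        qed
      qed (use fc in \<open>auto simp: face_def\<close>)
      then have "face (\<Inter>C)"
        using fc False unfolding face_def by (intro conjI closed_Inter ballI) blast+
      moreover have "\<Inter>C \<subseteq> F" using fc False by blast
      ultimately show ?thesis by (intro bexI[of _ "\<Inter>C"]) (auto simp: A_def)
    qed
  qed
  then obtain M where M: "M \<in> A" "\<forall>N\<in>A. M \<supseteq> N \<longrightarrow> N = M" by blast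
  show thesis
  proof (rule that)
    fix N assume "face N" "N \<subseteq> M"
    then show "N = M" using M by (auto simp: A_def)
  qed (use M in \<open>auto simp: A_def\<close>)
qed

text \<open>The argument of Krein and Milman, carried out inside the face where f is minimal. On a
  minimal subface every continuous affine function is constant, since its set of minima is again a
  face; applied to real and imaginary parts of the coordinates, this leaves a single point, which is
  extreme.\<close>

lemma extreme_minimum:
  assumes f: "affine_cont f"
  obtains \<phi> where "\<phi> \<in> P1" "\<And>\<psi>. \<psi> \<in> P1 \<Longrightarrow> f \<phi> \<le> f \<psi>"
    "\<And>\<psi> \<eta> t. \<lbrakk>\<psi> \<in> P1; \<eta> \<in> P1; 0 < t; t < 1;
      \<phi> = (\<lambda>g. of_real t * \<psi> g + of_real (1 - t) * \<eta> g)\<rbrakk> \<Longrightarrow> \<psi> = \<phi>"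
proof -
  have fP: "face P1" by (auto simp: face_def closed_P1 P1_nonempty)
  obtain m where m: "m \<in> P1" "\<And>\<psi>. \<psi> \<in> P1 \<Longrightarrow> f m \<le> f \<psi>" using face_min[OF fP f] by blast
  obtain M where M: "face M" "M \<subseteq> {\<psi>\<in>P1. f \<psi> \<le> f m}" "\<And>N. face N \<Longrightarrow> N \<subseteq> M \<Longrightarrow> N = M"
    using minimal_face[OF face_argmin[OF fP f m]] by blast
  have const: "h \<psi> = h \<eta>" if h: "affine_cont h" and "\<psi> \<in> M" "\<eta> \<in> M" for h \<psi> \<eta>
  proof -
    obtain k where k: "k \<in> M" "\<And>\<psi>. \<psi> \<in> M \<Longrightarrow> h k \<le> h \<psi>" using face_min[OF M(1) h] by blast
    have "{\<psi>\<in>M. h \<psi> \<le> h k} = M" by (rule M(3)[OF face_argmin[OF M(1) h k]]) auto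
    then show ?thesis using that k by (metis (mono_tags, lifting) mem_Collect_eq order_antisym)
  qed
  obtain \<phi> where \<phi>: "\<phi> \<in> M" using M(1) by (auto simp: face_def)
  have single: "\<psi> = \<phi>" if "\<psi> \<in> M" for \<psi>
  proof
    fix g
    have "affine_cont (\<lambda>\<psi>. Re (\<psi> g))" "affine_cont (\<lambda>\<psi>. Im (\<psi> g))"
      unfolding affine_cont_def by (auto intro!: continuous_intros continuous_on_coordinate)
    then show "\<psi> g = \<phi> g" using const[of "\<lambda>\<psi>. Re (\<psi> g)", OF _ that \<phi>] const[of "\<lambda>\<psi>. Im (\<psi> g)", OF _ that \<phi>]
      by (simp add: complex_eq_iff)
  qed
  show thesis
  proof (rule that)
    show "\<phi> \<in> P1" using \<phi> M(2) by blast
    show "f \<phi> \<le> f \<psi>" if "\<psi> \<in> P1" for \<psi> using \<phi> M(2) m(2)[OF that] by force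
    fix \<psi> \<eta> and t :: real
    assume "\<psi> \<in> P1" "\<eta> \<in> P1" "0 < t" "t < 1" "\<phi> = (\<lambda>g. of_real t * \<psi> g + of_real (1 - t) * \<eta> g)"
    then have "\<psi> \<in> M" using M(1) \<phi> unfolding face_def by blast
    then show "\<psi> = \<phi>" by (rule single)
  qed
qed

end

section \<open>Fell neighbourhoods of the trivial representation and almost invariant
  vectors\<close>

lemma trivial_class:
  assumes "(K, \<rho>) \<in> unitary_equivalence G `` {trivial_rep G}" "g \<in> carrier G" "v \<in> carrier K"
  shows "\<rho> g v = v"
proof -
  define H where "H = fst (trivial_rep G)"
  have "(trivial_rep G, (K, \<rho>)) \<in> unitary_equivalence G" using assms(1) by simp
  moreover have "trivial_rep G = (H, \<lambda>g v. v)" by (simp add: H_def trivial_rep_def)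
  ultimately obtain U where U: "unitary_map H K U" "\<forall>g\<in>carrier G. \<forall>v\<in>carrier H. U v = \<rho> g (U v)"
    by (auto simp: unitary_equivalence_def)
  have "v \<in> U ` carrier H" using U(1) assms(3) by (simp add: unitary_map_def bij_betw_def)
  then obtain u where "u \<in> carrier H" "v = U u" by blast
  then show ?thesis using U(2) assms(2) by metis
qed

lemma equivalence_refl: assumes "(K, \<rho>) \<in> irreps G" shows "((K, \<rho>), (K, \<rho>)) \<in> unitary_equivalence G"
proof -
  have "unitary_map K K (\<lambda>v. v)"
    by (auto simp: unitary_map_def complex_linear_def bij_betw_def)
  then show ?thesis using assms by (auto simp: unitary_equivalence_def)
qed

definition almost_invariant :: "('g, 'm) monoid_scheme \<Rightarrow> 'g set \<Rightarrow> real \<Rightarrow> 'g rep \<Rightarrow> ('g \<Rightarrow> complex) \<Rightarrow> bool" where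
  "almost_invariant G Q \<delta> = (\<lambda>(K, \<rho>) \<zeta>. \<zeta> \<in> carrier K \<and> inner_prod K \<zeta> \<zeta> = 1 \<and>
     (\<forall>g\<in>Q. cmod (inner_prod K (\<rho> g \<zeta>) \<zeta> - 1) < \<delta>))"

lemma fell_nbhd_iff: "C \<in> fell_nbhd G (H, \<pi>) F Q \<epsilon> \<longleftrightarrow> C \<in> unitary_dual G \<and> (\<exists>K \<rho>. (K, \<rho>) \<in> C \<and>
   (\<forall>\<xi>\<in>F. \<exists>\<eta>s. set \<eta>s \<subseteq> carrier K \<and>
     (\<forall>g\<in>Q. cmod (inner_prod H (\<pi> g \<xi>) \<xi> - (\<Sum>\<eta>\<leftarrow>\<eta>s. inner_prod K (\<rho> g \<eta>) \<eta>)) < \<epsilon>)))"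
  unfolding fell_nbhd_def by (simp add: Bex_def split_paired_Ex)

text \<open>Induction over the generation of the topology. The case with content is a basic set
  around some (H, \<pi>) that contains the trivial class without being centred there: membership of
  the trivial class says that the given coefficients of \<pi> are close to nonnegative constants on
  Q, and suitable multiples of an almost invariant unit vector reproduce these constants well
  enough.\<close>

lemma fell_open_trivial:
  assumes "openin (fell_topology G) U" "unitary_equivalence G `` {trivial_rep G} \<in> U"
  shows "\<exists>Q \<delta>. finite Q \<and> Q \<subseteq> carrier G \<and> \<delta> > 0 \<and>
    (\<forall>\<kappa>\<in>irreps G. \<forall>\<zeta>. almost_invariant G Q \<delta> \<kappa> \<zeta> \<longrightarrow> unitary_equivalence G `` {\<kappa>} \<in> U)"
  using assms unfolding fell_topology_def openin_topology_generated_by_iff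
proof (induction rule: generate_topology_on.induct)
  case Empty
  then show ?case by simp
next
  case (Int a b)
  then obtain Q1 \<delta>1 Q2 \<delta>2 where 1: "finite Q1" "Q1 \<subseteq> carrier G" "\<delta>1 > 0"
      "\<forall>\<kappa>\<in>irreps G. \<forall>\<zeta>. almost_invariant G Q1 \<delta>1 \<kappa> \<zeta> \<longrightarrow> unitary_equivalence G `` {\<kappa>} \<in> a"
    and 2: "finite Q2" "Q2 \<subseteq> carrier G" "\<delta>2 > 0"
      "\<forall>\<kappa>\<in>irreps G. \<forall>\<zeta>. almost_invariant G Q2 \<delta>2 \<kappa> \<zeta> \<longrightarrow> unitary_equivalence G `` {\<kappa>} \<in> b"
    by (auto simp del: Image_singleton_iff)
  have "almost_invariant G Q1 \<delta>1 \<kappa> \<zeta> \<and> almost_invariant G Q2 \<delta>2 \<kappa> \<zeta>"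
    if "almost_invariant G (Q1 \<union> Q2) (min \<delta>1 \<delta>2) \<kappa> \<zeta>" for \<kappa> \<zeta>
    using that by (auto simp: almost_invariant_def)
  then have "\<forall>\<kappa>\<in>irreps G. \<forall>\<zeta>. almost_invariant G (Q1 \<union> Q2) (min \<delta>1 \<delta>2) \<kappa> \<zeta> \<longrightarrow>
      unitary_equivalence G `` {\<kappa>} \<in> a \<inter> b" using 1(4) 2(4) by blast
  moreover have "finite (Q1 \<union> Q2)" "Q1 \<union> Q2 \<subseteq> carrier G" "min \<delta>1 \<delta>2 > 0" using 1 2 by auto
  ultimately show ?case by blast
next
  case (UN \<U>)
  then obtain k where k: "k \<in> \<U>" "unitary_equivalence G `` {trivial_rep G} \<in> k" by blast
  obtain Q \<delta> where "finite Q" "Q \<subseteq> carrier G" "\<delta> > 0"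
      "\<forall>\<kappa>\<in>irreps G. \<forall>\<zeta>. almost_invariant G Q \<delta> \<kappa> \<zeta> \<longrightarrow> unitary_equivalence G `` {\<kappa>} \<in> k"
    using UN.IH[OF k] by blast
  then show ?case using k(1) by (intro exI[of _ Q] exI[of _ \<delta>]) blast
next
  case (Basis U)
  then obtain H \<pi> F Q \<epsilon> where U: "U = fell_nbhd G (H, \<pi>) F Q \<epsilon>" and fin: "finite F" "finite Q"
    and Q: "Q \<subseteq> carrier G" and \<epsilon>: "\<epsilon> > 0" by blast
  obtain K0 \<rho>0 where K0: "(K0, \<rho>0) \<in> unitary_equivalence G `` {trivial_rep G}"
    and app: "\<forall>\<xi>\<in>F. \<exists>\<eta>s. set \<eta>s \<subseteq> carrier K0 \<and>
      (\<forall>g\<in>Q. cmod (inner_prod H (\<pi> g \<xi>) \<xi> - (\<Sum>\<eta>\<leftarrow>\<eta>s. inner_prod K0 (\<rho>0 g \<eta>) \<eta>)) < \<epsilon>)"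
    using Basis.prems unfolding U fell_nbhd_iff by blast
  have "(K0, \<rho>0) \<in> irreps G" using K0 by (auto simp: unitary_equivalence_def)
  then interpret K0: hilbert_space K0 by (simp add: irreps_def irreducible_rep_def unitary_rep_def)
  have "\<exists>r\<ge>0. \<forall>g\<in>Q. cmod (inner_prod H (\<pi> g \<xi>) \<xi> - of_real r) < \<epsilon>" if \<xi>: "\<xi> \<in> F" for \<xi>
  proof -
    obtain \<eta>s where \<eta>s: "set \<eta>s \<subseteq> carrier K0"
      "\<forall>g\<in>Q. cmod (inner_prod H (\<pi> g \<xi>) \<xi> - (\<Sum>\<eta>\<leftarrow>\<eta>s. inner_prod K0 (\<rho>0 g \<eta>) \<eta>)) < \<epsilon>" using app \<xi> by blast
    define r where "r = (\<Sum>\<eta>\<leftarrow>\<eta>s. Re (inner_prod K0 \<eta> \<eta>))"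
    have "(\<Sum>\<eta>\<leftarrow>\<eta>s. inner_prod K0 (\<rho>0 g \<eta>) \<eta>) = of_real r" if "g \<in> Q" for g
      using \<eta>s(1) unfolding r_def
    proof (induction \<eta>s)
      case (Cons \<eta> \<eta>s)
      have "inner_prod K0 \<eta> \<eta> = of_real (Re (inner_prod K0 \<eta> \<eta>))"
        using K0.inner_cnj[of \<eta> \<eta>] Cons.prems by (simp add: complex_eq_iff)
      moreover have "\<rho>0 g \<eta> = \<eta>" using trivial_class[OF K0] that Q Cons.prems by auto
      ultimately show ?case using Cons by simp
    qed simp
    moreover have "r \<ge> 0" unfolding r_def using \<eta>s(1) K0.inner_nonneg by (intro sum_list_nonneg) auto
    ultimately show ?thesis using \<eta>s(2) by auto
  qed
  then obtain r where r: "\<And>\<xi>. \<xi> \<in> F \<Longrightarrow> r \<xi> \<ge> 0"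
    "\<And>\<xi> g. \<xi> \<in> F \<Longrightarrow> g \<in> Q \<Longrightarrow> cmod (inner_prod H (\<pi> g \<xi>) \<xi> - of_real (r \<xi>)) < \<epsilon>" by metis
  \<comment> \<open>The remaining room below \<epsilon>, divided by the factor by which a deviation
    of the unit vector's coefficient gets multiplied; the added 1 avoids division by 0.\<close>
  define m where "m = (\<lambda>(\<xi>, g). (\<epsilon> - cmod (inner_prod H (\<pi> g \<xi>) \<xi> - of_real (r \<xi>))) / (r \<xi> + 1))"
  define \<delta> where "\<delta> = Min (insert 1 (m ` (F \<times> Q)))"
  have mpos: "m (\<xi>, g) > 0" if "\<xi> \<in> F" "g \<in> Q" for \<xi> g
    using r(1)[OF that(1)] r(2)[OF that] by (simp add: m_def)
  have \<delta>: "\<delta> > 0" unfolding \<delta>_def using fin mpos by (subst Min_gr_iff) auto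
  have \<delta>_le: "\<delta> \<le> m (\<xi>, g)" if "\<xi> \<in> F" "g \<in> Q" for \<xi> g
    unfolding \<delta>_def using fin that by (intro Min_le) auto
  have "unitary_equivalence G `` {\<kappa>} \<in> U" if \<kappa>: "\<kappa> \<in> irreps G" and ai: "almost_invariant G Q \<delta> \<kappa> \<zeta>" for \<kappa> \<zeta>
  proof -
    obtain K \<rho> where \<kappa>_eq: "\<kappa> = (K, \<rho>)" by (cases \<kappa>)
    have K: "unitary_rep G K \<rho>" using \<kappa> by (simp add: \<kappa>_eq irreps_def irreducible_rep_def)
    interpret K: hilbert_space K using K by (simp add: unitary_rep_def)
    have \<zeta>: "\<zeta> \<in> carrier K" "\<And>g. g \<in> Q \<Longrightarrow> cmod (inner_prod K (\<rho> g \<zeta>) \<zeta> - 1) < \<delta>"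
      using ai by (auto simp: almost_invariant_def \<kappa>_eq)
    have "\<exists>\<eta>s. set \<eta>s \<subseteq> carrier K \<and>
        (\<forall>g\<in>Q. cmod (inner_prod H (\<pi> g \<xi>) \<xi> - (\<Sum>\<eta>\<leftarrow>\<eta>s. inner_prod K (\<rho> g \<eta>) \<eta>)) < \<epsilon>)" if \<xi>: "\<xi> \<in> F" for \<xi>
    proof -
      \<comment> \<open>Scaling by the square root multiplies the coefficient of \<zeta> by
        \<open>r \<xi>\<close>, so one vector approximates the constant.\<close>
      define c where "c = complex_of_real (sqrt (r \<xi>))"
      define \<eta> where "\<eta> = c \<odot>\<^bsub>K\<^esub> \<zeta>"
      have \<eta>: "\<eta> \<in> carrier K" using \<zeta>(1) by (simp add: \<eta>_def complex_ring_simps)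
      have cc: "c * cnj c = of_real (r \<xi>)" using r(1)[OF \<xi>] by (simp add: c_def flip: of_real_mult)
      have "cmod (inner_prod H (\<pi> g \<xi>) \<xi> - inner_prod K (\<rho> g \<eta>) \<eta>) < \<epsilon>" if g: "g \<in> Q" for g
      proof -
        have um: "complex_linear K K (\<rho> g)" using K g Q by (auto simp: unitary_rep_def unitary_map_def)
        then have gz: "\<rho> g \<zeta> \<in> carrier K" "\<rho> g \<eta> = c \<odot>\<^bsub>K\<^esub> \<rho> g \<zeta>"
          using \<zeta>(1) by (auto simp: complex_linear_def \<eta>_def)
        have "inner_prod K (\<rho> g \<zeta>) \<eta> = cnj c * inner_prod K (\<rho> g \<zeta>) \<zeta>"
          using K.inner_cnj[OF gz(1) \<eta>] K.inner_cnj[OF \<zeta>(1) gz(1)] K.inner_smult[OF \<zeta>(1) gz(1), of c]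
          by (simp add: \<eta>_def)
        then have eq: "inner_prod K (\<rho> g \<eta>) \<eta> = of_real (r \<xi>) * inner_prod K (\<rho> g \<zeta>) \<zeta>"
          using gz \<eta> by (simp add: K.inner_smult cc[symmetric])
        have "cmod (inner_prod H (\<pi> g \<xi>) \<xi> - inner_prod K (\<rho> g \<eta>) \<eta>)
            = cmod ((inner_prod H (\<pi> g \<xi>) \<xi> - of_real (r \<xi>)) - of_real (r \<xi>) * (inner_prod K (\<rho> g \<zeta>) \<zeta> - 1))"
          by (simp add: eq algebra_simps)
        also have "\<dots> \<le> cmod (inner_prod H (\<pi> g \<xi>) \<xi> - of_real (r \<xi>)) + cmod (of_real (r \<xi>) * (inner_prod K (\<rho> g \<zeta>) \<zeta> - 1))"
          by (rule norm_triangle_ineq4)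
        also have "cmod (of_real (r \<xi>) * (inner_prod K (\<rho> g \<zeta>) \<zeta> - 1)) \<le> r \<xi> * \<delta>"
          using r(1)[OF \<xi>] \<zeta>(2)[OF g] by (simp add: norm_mult mult_left_mono)
        also have "r \<xi> * \<delta> < (r \<xi> + 1) * \<delta>" using \<delta> by (simp add: algebra_simps)
        also have "(r \<xi> + 1) * \<delta> \<le> (r \<xi> + 1) * m (\<xi>, g)"
          using \<delta>_le[OF \<xi> g] r(1)[OF \<xi>] by (intro mult_left_mono) auto
        also have "\<dots> = \<epsilon> - cmod (inner_prod H (\<pi> g \<xi>) \<xi> - of_real (r \<xi>))"
          using r(1)[OF \<xi>] by (simp add: m_def)
        finally show ?thesis by simp
      qed
      then show ?thesis using \<eta> by (intro exI[of _ "[\<eta>]"]) auto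
    qed
    moreover have "(K, \<rho>) \<in> unitary_equivalence G `` {\<kappa>}" using equivalence_refl[of K \<rho> G] \<kappa> \<kappa>_eq by auto
    moreover have "unitary_equivalence G `` {\<kappa>} \<in> unitary_dual G"
      unfolding unitary_dual_def using \<kappa> by (rule quotientI)
    ultimately show ?thesis unfolding U fell_nbhd_iff by blast
  qed
  then show ?case using fin(2) Q \<delta> by (intro exI[of _ Q] exI[of _ \<delta>]) blast
qed

section \<open>The Kazhdan inequality and countability of the group\<close>

context group
begin

text \<open>For fixed g the difference of the two sides is affine and continuous in the function, so
  an extreme function has to be examined only. There, either some q in Q has \<phi> q at distance at
  least \<delta> from 1, and the right-hand side is large; or the cyclic vector is almost invariant,
  the irreducible GNS representation is trivial, and the left-hand side is 0.\<close>

lemma kazhdan_inequality: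
  assumes T: "kazhdan_property_T G"
  obtains Q \<kappa> where "finite Q" "Q \<subseteq> carrier G" "\<kappa> > 0"
    "\<And>\<phi> g. \<phi> \<in> P1 \<Longrightarrow> g \<in> carrier G \<Longrightarrow> \<kappa> * Re (1 - \<phi> g) \<le> (\<Sum>q\<in>Q. Re (1 - \<phi> q))"
proof -
  obtain Q \<delta> where Q: "finite Q" "Q \<subseteq> carrier G" and \<delta>: "\<delta> > 0"
    and "\<forall>\<kappa>\<in>irreps G. \<forall>\<zeta>. almost_invariant G Q \<delta> \<kappa> \<zeta> \<longrightarrow>
      unitary_equivalence G `` {\<kappa>} \<in> {unitary_equivalence G `` {trivial_rep G}}"
    using fell_open_trivial[OF T[unfolded kazhdan_property_T_def] singletonI] by blast
  then have triv: "\<And>\<kappa> \<zeta>. \<kappa> \<in> irreps G \<Longrightarrow> almost_invariant G Q \<delta> \<kappa> \<zeta> \<Longrightarrow>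
      unitary_equivalence G `` {\<kappa>} = unitary_equivalence G `` {trivial_rep G}" by blast
  \<comment> \<open>In the first case the sum is at least half of the square of \<delta>, while the
    real part of 1 - \<phi> g is at most 2; the quotient of these bounds is \<kappa>.\<close>
  define \<kappa> where "\<kappa> = \<delta>\<^sup>2 / 4"
  have \<kappa>: "\<kappa> > 0" using \<delta> by (simp add: \<kappa>_def)
  have nn: "0 \<le> Re (1 - \<phi> g)" if "\<phi> \<in> P1" for \<phi> g
    using P1_bound[OF that, of g] complex_Re_le_cmod[of "\<phi> g"] by simp
  have "\<kappa> * Re (1 - \<psi> g) \<le> (\<Sum>q\<in>Q. Re (1 - \<psi> q))" if \<psi>: "\<psi> \<in> P1" and g: "g \<in> carrier G" for \<psi> g
  proof -
    define f where "f \<phi> = (\<Sum>q\<in>Q. Re (1 - \<phi> q)) - \<kappa> * Re (1 - \<phi> g)" for \<phi>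
    have ac: "affine_cont f" unfolding affine_cont_def
    proof (intro conjI allI)
      show "continuous_on UNIV f" unfolding f_def
        by (intro continuous_intros continuous_on_coordinate)
      fix \<phi> \<eta> :: "'a \<Rightarrow> complex" and t :: real
      have "Re (1 - (of_real t * \<phi> q + of_real (1 - t) * \<eta> q)) = t * Re (1 - \<phi> q) + (1 - t) * Re (1 - \<eta> q)" for q
        by (simp add: algebra_simps)
      then show "f (\<lambda>g. of_real t * \<phi> g + of_real (1 - t) * \<eta> g) = t * f \<phi> + (1 - t) * f \<eta>"
        unfolding f_def by (simp only: sum.distrib sum_distrib_left[symmetric]) (simp only: algebra_simps)
    qed
    obtain \<phi> where \<phi>: "\<phi> \<in> P1" and min: "f \<phi> \<le> f \<psi>"
      and extreme: "\<And>\<psi> \<eta> t. \<lbrakk>\<psi> \<in> P1; \<eta> \<in> P1; 0 < t; t < 1;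
        \<phi> = (\<lambda>g. of_real t * \<psi> g + of_real (1 - t) * \<eta> g)\<rbrakk> \<Longrightarrow> \<psi> = \<phi>"
    proof (rule extreme_minimum[OF ac])
      fix \<phi>
      assume a: "\<phi> \<in> P1" "\<And>\<psi>. \<psi> \<in> P1 \<Longrightarrow> f \<phi> \<le> f \<psi>"
        "\<And>\<psi> \<eta> t. \<lbrakk>\<psi> \<in> P1; \<eta> \<in> P1; 0 < t; t < 1;
          \<phi> = (\<lambda>g. of_real t * \<psi> g + of_real (1 - t) * \<eta> g)\<rbrakk> \<Longrightarrow> \<psi> = \<phi>"
      show thesis
      proof (rule that)
        show "\<psi>' = \<phi>" if "\<psi>' \<in> P1" "\<eta> \<in> P1" "0 < t" "t < 1"
          "\<phi> = (\<lambda>g. of_real t * \<psi>' g + of_real (1 - t) * \<eta> g)" for \<psi>' \<eta> and t :: real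
          using that by (rule a(3))
      qed (rule a(1), rule a(2)[OF \<psi>])
    qed
    interpret gns_rep G \<phi> by unfold_locales (rule P1_D(1)[OF \<phi>])
    have irr: "(P.HS, rep) \<in> irreps G"
    proof -
      have "irreducible_rep G P.HS rep"
        by (rule extreme_irreducible[OF P1_D(2)[OF \<phi>]]) (rule extreme, assumption+)
      then show ?thesis by (simp add: irreps_def)
    qed
    have "0 \<le> f \<phi>"
    proof (cases "\<forall>q\<in>Q. cmod (\<phi> q - 1) < \<delta>")
      case True
      have cc: "P.ip cyc cyc = 1" using P.H.s_self[OF cyc_HC] hnorm_cyc[OF P1_D(2)[OF \<phi>]] by (simp add: P.HS_simps)
      have "almost_invariant G Q \<delta> (P.HS, rep) cyc"
        unfolding almost_invariant_def using True Q(2) cc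
        by (auto simp: P.HS_simps cyc_HC coeff_cyc subset_iff)
      then have "(P.HS, rep) \<in> unitary_equivalence G `` {trivial_rep G}"
        using triv[OF irr] equivalence_refl[OF irr] by blast
      then have "rep g cyc = cyc" by (rule trivial_class) (use g cyc_HC in \<open>auto simp: P.HS_simps\<close>)
      then have "\<phi> g = 1" using coeff_cyc[OF g] cc by simp
      then show ?thesis unfolding f_def using nn[OF \<phi>] by (simp add: sum_nonneg)
    next
      case False
      then obtain q where q: "q \<in> Q" "\<delta> \<le> cmod (\<phi> q - 1)" by force
      \<comment> \<open>For values in the unit disc, the squared distance to 1 is at most twice the
        real part of the difference.\<close>
      have "\<delta>\<^sup>2 \<le> (cmod (\<phi> q - 1))\<^sup>2" using q(2) \<delta> by (intro power_mono) auto
      also have "\<dots> = 1 - 2 * Re (\<phi> q) + (cmod (\<phi> q))\<^sup>2"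
        unfolding cmod_power2 by (simp add: power2_eq_square algebra_simps)
      also have "(cmod (\<phi> q))\<^sup>2 \<le> 1" using P1_bound[OF \<phi>, of q] by (simp add: power_le_one)
      finally have "\<delta>\<^sup>2 / 2 \<le> Re (1 - \<phi> q)" by simp
      also have "\<dots> \<le> (\<Sum>q\<in>Q. Re (1 - \<phi> q))" using nn[OF \<phi>] q(1) Q(1) by (intro member_le_sum) auto
      finally have 1: "\<delta>\<^sup>2 / 2 \<le> (\<Sum>q\<in>Q. Re (1 - \<phi> q))" .
      have "Re (1 - \<phi> g) \<le> 2" using P1_bound[OF \<phi>, of g] abs_Re_le_cmod[of "\<phi> g"] by simp
      then have "\<kappa> * Re (1 - \<phi> g) \<le> \<kappa> * 2" using \<kappa> by (intro mult_left_mono) auto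
      then show ?thesis using 1 unfolding f_def \<kappa>_def by linarith
    qed
    then show ?thesis using min unfolding f_def by linarith
  qed
  then show thesis using that Q \<kappa> by blast
qed

text \<open>The subgroup is exhausted by iterating products, starting from Q, its inverses and the
  unit; every stage is countable.\<close>

lemma countable_generate: assumes "countable Q" shows "countable (generate G Q)"
proof -
  define S where "S = Q \<union> (\<lambda>g. inv g) ` Q \<union> {\<one>}"
  define step where "step A = A \<union> (\<lambda>(x, y). x \<otimes> y) ` (A \<times> A)" for A
  define T where "T n = (step ^^ n) S" for n
  have T0: "T 0 = S" and TS: "T (Suc n) = step (T n)" for n by (simp_all add: T_def)
  have cT: "countable (T n)" for n
    by (induction n) (auto simp: T0 TS S_def step_def assms)
  have S_sub: "S \<subseteq> (\<Union>n. T n)" using T0 by blast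
  have "x \<in> (\<Union>n. T n)" if "x \<in> generate G Q" for x
    using that
  proof (induction rule: generate.induct)
    case (eng x y)
    then obtain m n where mn: "x \<in> T m" "y \<in> T n" by auto
    have "T i \<subseteq> T j" if "i \<le> j" for i j
      using that by (rule lift_Suc_mono_le[rotated]) (auto simp: TS step_def)
    then have "x \<in> T (max m n)" "y \<in> T (max m n)" using mn by (meson max.cobounded1 max.cobounded2 subsetD)+
    then have "x \<otimes> y \<in> T (Suc (max m n))" unfolding TS step_def by force
    then show ?case by blast
  qed (use S_sub in \<open>auto simp: S_def\<close>)
  then have "generate G Q \<subseteq> (\<Union>n. T n)" by blast
  moreover have "countable (\<Union>n. T n)" using cT by auto
  ultimately show ?thesis by (rule countable_subset)
qed

text \<open>A Kazhdan set generates the group: the characteristic function of the generated subgroup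
  is 1 on Q, so the right-hand side of the inequality vanishes and the function is 1
  everywhere.\<close>

lemma kazhdan_countable: assumes T: "kazhdan_property_T G" shows "countable (carrier G)"
proof -
  obtain Q \<kappa> where Q: "finite Q" "Q \<subseteq> carrier G" and \<kappa>: "\<kappa> > 0"
    and le: "\<And>\<phi> g. \<phi> \<in> P1 \<Longrightarrow> g \<in> carrier G \<Longrightarrow> \<kappa> * Re (1 - \<phi> g) \<le> (\<Sum>q\<in>Q. Re (1 - \<phi> q))"
    using kazhdan_inequality[OF T] by metis
  define \<phi> where "\<phi> = (\<lambda>g. if g \<in> generate G Q then 1 else 0 :: complex)"
  have \<phi>: "\<phi> \<in> P1" unfolding \<phi>_def by (intro P1_subgroup generate_is_subgroup Q)
  have "(\<Sum>q\<in>Q. Re (1 - \<phi> q)) = 0" by (intro sum.neutral) (auto simp: \<phi>_def generate.incl)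
  then have "\<kappa> * Re (1 - \<phi> g) \<le> 0" if "g \<in> carrier G" for g
    using le[OF \<phi> that] by simp
  then have "g \<in> generate G Q" if "g \<in> carrier G" for g
    using \<kappa> that by (force simp: \<phi>_def split: if_splits)
  then have "carrier G \<subseteq> generate G Q" by blast
  then show ?thesis using countable_generate[OF countable_finite[OF Q(1)]] by (rule countable_subset)
qed

end

section \<open>Quotients and completions of *-algebras\<close>

text \<open>Stability of J under scalars and involution is what makes the unions in
  \<open>cstar_quot\<close> run over constant families, so that the quotient operations act on
  representatives.\<close>

locale star_ideal = B?: star_algebra B + J?: ideal J B for B :: "('a, 'm) cstar_scheme" (structure) and J +
  assumes J_smult: "x \<in> J \<Longrightarrow> c \<odot> x \<in> J"
    and J_star: "x \<in> J \<Longrightarrow> star B x \<in> J"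
begin

abbreviation Q where "Q \<equiv> cstar_quot B J"

lemma B_smult_closed: "x \<in> carrier B \<Longrightarrow> c \<odot> x \<in> carrier B"
  by (rule smult_closed) (simp_all add: complex_ring_simps)

lemma B_smult_rules: "x \<in> carrier B \<Longrightarrow> y \<in> carrier B \<Longrightarrow> c \<odot> (x \<oplus> y) = c \<odot> x \<oplus> c \<odot> y"
  "x \<in> carrier B \<Longrightarrow> (c + d) \<odot> x = c \<odot> x \<oplus> d \<odot> x" "x \<in> carrier B \<Longrightarrow> (c * d) \<odot> x = c \<odot> (d \<odot> x)"
  "x \<in> carrier B \<Longrightarrow> 1 \<odot> x = x"
  using smult_r_distr[of c x y] smult_l_distr[of c d x] smult_assoc1[of c d x] smult_one[of x]
  by (simp_all add: complex_ring_simps)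

lemma mem_coset: "y \<in> J +> x \<longleftrightarrow> (\<exists>h\<in>J. y = h \<oplus> x)"
  by (auto simp: a_r_coset_def r_coset_def)

lemma coset_eq_iff: "\<lbrakk>x \<in> carrier B; y \<in> carrier B\<rbrakk> \<Longrightarrow> J +> x = J +> y \<longleftrightarrow> x \<ominus> y \<in> J"
  using A.quotient_eq_iff_same_a_r_cos[OF is_ideal] by simp

lemma coset_shift: "h \<in> J \<Longrightarrow> x \<in> carrier B \<Longrightarrow> J +> (h \<oplus> x) = J +> x"
  using J.a_Hcarr[of h] by (subst coset_eq_iff) (auto simp: A.minus_eq A.a_assoc A.r_neg)

lemma Q_carrier: "carrier Q = (\<lambda>x. J +> x) ` carrier B"
  by (auto simp: cstar_quot_def FactRing_def A_RCOSETS_def RCOSETS_def a_r_coset_def)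

lemma Q_ops: assumes "x \<in> carrier B" "y \<in> carrier B"
  shows "(J +> x) \<oplus>\<^bsub>Q\<^esub> (J +> y) = J +> (x \<oplus> y)" "(J +> x) \<otimes>\<^bsub>Q\<^esub> (J +> y) = J +> (x \<otimes> y)"
    "c \<odot>\<^bsub>Q\<^esub> (J +> x) = J +> (c \<odot> x)" "star Q (J +> x) = J +> (star B x)"
proof -
  show "(J +> x) \<oplus>\<^bsub>Q\<^esub> (J +> y) = J +> (x \<oplus> y)"
    using J.a_rcos_sum[OF assms] by (simp add: cstar_quot_def FactRing_def)
  show "(J +> x) \<otimes>\<^bsub>Q\<^esub> (J +> y) = J +> (x \<otimes> y)"
    using rcoset_mult_add[OF assms] by (simp add: cstar_quot_def FactRing_def)
  have "J +> (c \<odot> z) = J +> (c \<odot> x)" "J +> (star B z) = J +> (star B x)" if z: "z \<in> J +> x" for z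
  proof -
    obtain h where h: "h \<in> J" "z = h \<oplus> x" using z by (auto simp: mem_coset)
    have hB: "h \<in> carrier B" using h(1) by (rule J.a_Hcarr)
    show "J +> (c \<odot> z) = J +> (c \<odot> x)"
      using coset_shift[OF J_smult[OF h(1)] B_smult_closed[OF assms(1)]] hB assms h by (simp add: B_smult_rules)
    show "J +> (star B z) = J +> (star B x)"
      using coset_shift[OF J_star[OF h(1)] star_closed[OF assms(1)]] hB assms h by (simp add: star_add)
  qed
  note const = this
  have x: "x \<in> J +> x" using assms(1) by (auto simp: mem_coset intro!: bexI[of _ \<zero>])
  have "(\<Union>z\<in>J +> x. J +> (c \<odot> z)) = J +> (c \<odot> x)" "(\<Union>z\<in>J +> x. J +> (star B z)) = J +> (star B x)"
    by (rule UN_constant_eq[OF x], intro ballI, erule const)+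
  then show "c \<odot>\<^bsub>Q\<^esub> (J +> x) = J +> (c \<odot> x)" "star Q (J +> x) = J +> (star B x)"
    by (simp_all add: cstar_quot_def)
qed

lemma Q_consts: "\<zero>\<^bsub>Q\<^esub> = J +> \<zero>" "\<one>\<^bsub>Q\<^esub> = J +> \<one>"
  using A.a_coset_add_zero[OF J.a_subset] by (auto simp: cstar_quot_def FactRing_def)

lemma abelian_group_Q: "abelian_group Q"
proof (rule abelian_groupI)
  fix X assume "X \<in> carrier Q"
  then obtain x where "x \<in> carrier B" "X = J +> x" by (auto simp: Q_carrier)
  then show "\<exists>Y\<in>carrier Q. Y \<oplus>\<^bsub>Q\<^esub> X = \<zero>\<^bsub>Q\<^esub>"
    by (intro bexI[of _ "J +> (\<ominus> x)"]) (auto simp: Q_carrier Q_ops Q_consts A.l_neg)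
qed (auto simp: Q_carrier Q_ops Q_consts A.a_ac)

lemma star_algebra_Q: "star_algebra Q"
proof -
  have r: "ring Q"
  proof (rule ringI[OF abelian_group_Q])
    show "monoid Q" by (rule monoidI) (auto simp: Q_carrier Q_ops Q_consts A.m_assoc)
  qed (auto simp: Q_carrier Q_ops A.l_distr A.r_distr)
  have m: "Module.module complex_ring Q"
    by (rule moduleI[OF cring_complex_ring abelian_group_Q])
      (auto simp: Q_carrier Q_ops complex_ring_simps B_smult_closed B_smult_rules)
  show ?thesis
    by (intro star_algebra.intro r m star_algebra_axioms.intro)
      (auto simp: Q_carrier Q_ops B_smult_closed smult_mult_left smult_mult_right star_closed star_star star_add
        star_smult star_mult)
qed

lemma Q_minus: assumes "x \<in> carrier B" "y \<in> carrier B" shows "(J +> x) \<ominus>\<^bsub>Q\<^esub> (J +> y) = J +> (x \<ominus> y)"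
proof -
  interpret Q: abelian_group Q by (rule abelian_group_Q)
  have "\<ominus>\<^bsub>Q\<^esub> (J +> y) = J +> (\<ominus> y)"
    using assms by (intro Q.minus_equality) (auto simp: Q_carrier Q_ops Q_consts A.l_neg)
  then show ?thesis using assms by (simp add: a_minus_def Q_ops)
qed

end

text \<open>The C*-axioms without definiteness and completeness, both of which are supplied by the
  completion. In particular, faithfulness of the full norm on the group algebra has not to be
  proved.\<close>

locale cstar_seminorm = A?: star_algebra A for A :: "('a, 'm) cstar_scheme" (structure) +
  assumes sn_nonneg: "x \<in> carrier A \<Longrightarrow> 0 \<le> cnorm A x"
    and sn_add: "\<lbrakk>x \<in> carrier A; y \<in> carrier A\<rbrakk> \<Longrightarrow> cnorm A (x \<oplus> y) \<le> cnorm A x + cnorm A y"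
    and sn_smult: "x \<in> carrier A \<Longrightarrow> cnorm A (c \<odot> x) = cmod c * cnorm A x"
    and sn_mult: "\<lbrakk>x \<in> carrier A; y \<in> carrier A\<rbrakk> \<Longrightarrow> cnorm A (x \<otimes> y) \<le> cnorm A x * cnorm A y"
    and sn_star: "x \<in> carrier A \<Longrightarrow> cnorm A (star A x \<otimes> x) = (cnorm A x)\<^sup>2"
begin

lemma A_smult_closed: "x \<in> carrier A \<Longrightarrow> c \<odot> x \<in> carrier A"
  by (rule smult_closed) (simp_all add: complex_ring_simps)

lemma A_smult_rules: "x \<in> carrier A \<Longrightarrow> y \<in> carrier A \<Longrightarrow> c \<odot> (x \<oplus> y) = c \<odot> x \<oplus> c \<odot> y"
  "x \<in> carrier A \<Longrightarrow> (c + d) \<odot> x = c \<odot> x \<oplus> d \<odot> x" "x \<in> carrier A \<Longrightarrow> (c * d) \<odot> x = c \<odot> (d \<odot> x)"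
  "x \<in> carrier A \<Longrightarrow> 1 \<odot> x = x"
  using smult_r_distr[of c x y] smult_l_distr[of c d x] smult_assoc1[of c d x] smult_one[of x]
  by (simp_all add: complex_ring_simps)

lemma smult_zero_left: "x \<in> carrier A \<Longrightarrow> 0 \<odot> x = \<zero>"
  using A_smult_rules(2)[of x 0 0] A_smult_closed[of x 0] by (metis A.add.right_cancel add_0 A.l_zero A.zero_closed)

lemma smult_minus_one: "x \<in> carrier A \<Longrightarrow> (-1) \<odot> x = \<ominus> x"
  using A_smult_rules(2)[of x "-1" 1] smult_zero_left[of x] A_smult_closed[of x "-1"]
  by (intro A.minus_equality[symmetric]) (simp_all add: A_smult_rules)

lemma sn_uminus: "x \<in> carrier A \<Longrightarrow> cnorm A (\<ominus> x) = cnorm A x"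
  using sn_smult[of x "-1"] by (simp add: smult_minus_one)

lemma sn_zero: "cnorm A \<zero> = 0"
  using sn_smult[of \<zero> 0] smult_zero_left[of \<zero>] by simp

lemma sn_minus_commute: "\<lbrakk>x \<in> carrier A; y \<in> carrier A\<rbrakk> \<Longrightarrow> cnorm A (x \<ominus> y) = cnorm A (y \<ominus> x)"
  using sn_uminus[of "y \<ominus> x"] by (simp add: A.minus_eq A.minus_add A.a_comm)

lemma minus_split: "\<lbrakk>x \<in> carrier A; y \<in> carrier A; z \<in> carrier A\<rbrakk> \<Longrightarrow> x \<ominus> z = (x \<ominus> y) \<oplus> (y \<ominus> z)"
  by (simp add: A.minus_eq A.a_assoc A.r_neg1)

lemma sn_triangle: "\<lbrakk>x \<in> carrier A; y \<in> carrier A; z \<in> carrier A\<rbrakk> \<Longrightarrow>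
    cnorm A (x \<ominus> z) \<le> cnorm A (x \<ominus> y) + cnorm A (y \<ominus> z)"
  using sn_add[of "x \<ominus> y" "y \<ominus> z"] minus_split[of x y z] by simp

lemma minus_plus_cancel: "\<lbrakk>x \<in> carrier A; y \<in> carrier A\<rbrakk> \<Longrightarrow> (x \<ominus> y) \<oplus> y = x"
  by (simp add: A.minus_eq A.a_assoc A.l_neg)

lemma sn_diff_abs: "\<lbrakk>x \<in> carrier A; y \<in> carrier A\<rbrakk> \<Longrightarrow> \<bar>cnorm A x - cnorm A y\<bar> \<le> cnorm A (x \<ominus> y)"
  using sn_add[of "x \<ominus> y" y] sn_add[of "y \<ominus> x" x] sn_minus_commute[of x y]
  by (simp add: minus_plus_cancel abs_le_iff)

lemma sn_star_eq: assumes x: "x \<in> carrier A" shows "cnorm A (star A x) = cnorm A x"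
proof -
  have le: "cnorm A x \<le> cnorm A (star A x)" if x: "x \<in> carrier A" for x
  proof (cases "cnorm A x = 0")
    case False
    have "(cnorm A x)\<^sup>2 \<le> cnorm A (star A x) * cnorm A x"
      using sn_mult[OF star_closed[OF x] x] sn_star[OF x] by simp
    then show ?thesis using False sn_nonneg[OF x] by (simp add: power2_eq_square)
  qed (simp add: sn_nonneg star_closed x)
  show ?thesis using le[OF x] le[OF star_closed[OF x]] x by (simp add: star_star)
qed

abbreviation C where "C \<equiv> cauchy_algebra A"
abbreviation N where "N \<equiv> null_sequences A"

definition cs :: "(nat \<Rightarrow> 'a) \<Rightarrow> bool" where
  "cs s \<longleftrightarrow> (\<forall>n. s n \<in> carrier A) \<and> (\<forall>e>0. \<exists>N. \<forall>m\<ge>N. \<forall>n\<ge>N. cnorm A (s m \<ominus> s n) < e)"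

lemma C_simps: "s \<in> carrier C \<longleftrightarrow> cs s" "s \<otimes>\<^bsub>C\<^esub> t = (\<lambda>n. s n \<otimes> t n)" "\<one>\<^bsub>C\<^esub> = (\<lambda>n. \<one>)"
  "\<zero>\<^bsub>C\<^esub> = (\<lambda>n. \<zero>)" "s \<oplus>\<^bsub>C\<^esub> t = (\<lambda>n. s n \<oplus> t n)" "c \<odot>\<^bsub>C\<^esub> s = (\<lambda>n. c \<odot> s n)"
  "star C s = (\<lambda>n. star A (s n))"
  by (simp_all add: cauchy_algebra_def cs_def)

lemma cs_in: "cs s \<Longrightarrow> s n \<in> carrier A"
  by (simp add: cs_def)

lemma csD: "cs s \<Longrightarrow> e > 0 \<Longrightarrow> \<exists>N. \<forall>m\<ge>N. \<forall>n\<ge>N. cnorm A (s m \<ominus> s n) < e"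
  by (simp add: cs_def)

lemma csI: "(\<And>n. s n \<in> carrier A) \<Longrightarrow> (\<And>e. e > 0 \<Longrightarrow> \<exists>N. \<forall>m\<ge>N. \<forall>n\<ge>N. cnorm A (s m \<ominus> s n) < e) \<Longrightarrow> cs s"
  by (simp add: cs_def)

lemma cs_lipschitz:
  assumes s: "cs s" and t: "\<And>n. t n \<in> carrier A"
    and le: "\<And>m n. cnorm A (t m \<ominus> t n) \<le> K * cnorm A (s m \<ominus> s n)"
  shows "cs t"
proof (rule csI[OF t])
  fix e :: real assume e: "e > 0"
  define K' where "K' = \<bar>K\<bar> + 1"
  have K': "K' > 0" by (simp add: K'_def)
  obtain N where N: "\<forall>m\<ge>N. \<forall>n\<ge>N. cnorm A (s m \<ominus> s n) < e / K'" using csD[OF s, of "e / K'"] e K' by auto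
  have "cnorm A (t m \<ominus> t n) < e" if "m \<ge> N" "n \<ge> N" for m n
  proof -
    have nn: "0 \<le> cnorm A (s m \<ominus> s n)" using cs_in[OF s] by (intro sn_nonneg) simp
    have "cnorm A (t m \<ominus> t n) \<le> K' * cnorm A (s m \<ominus> s n)"
      using le[of m n] mult_right_mono[OF _ nn, of K K'] unfolding K'_def by linarith
    also have "\<dots> < K' * (e / K')" using N that K' by (intro mult_strict_left_mono) auto
    finally show ?thesis using K' by simp
  qed
  then show "\<exists>N. \<forall>m\<ge>N. \<forall>n\<ge>N. cnorm A (t m \<ominus> t n) < e" by blast
qed

lemma cs_const: "x \<in> carrier A \<Longrightarrow> cs (\<lambda>_. x)"
  by (rule csI) (simp_all add: A.minus_eq A.r_neg sn_zero)

lemma cs_bounded: assumes "cs s" obtains K where "K > 0" "\<And>n. cnorm A (s n) \<le> K"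
proof -
  obtain N where N: "\<forall>m\<ge>N. \<forall>n\<ge>N. cnorm A (s m \<ominus> s n) < 1" using csD[OF assms, of 1] by auto
  define K where "K = Max ((\<lambda>n. cnorm A (s n)) ` {..N}) + 1"
  have le: "cnorm A (s n) \<le> K - 1" if "n \<le> N" for n unfolding K_def using that by (simp add: Max_ge)
  have "cnorm A (s n) \<le> K" for n
  proof (cases "n \<le> N")
    case False
    then have "cnorm A (s n \<ominus> s N) < 1" using N by simp
    then show ?thesis using sn_diff_abs[OF cs_in cs_in, OF assms assms, of n N] le[of N] by simp
  qed (use le[of n] in auto)
  moreover have "K > 0" using le[of 0] sn_nonneg[OF cs_in[OF assms, of 0]] by simp
  ultimately show thesis using that by blast
qed

lemma cs_add: assumes "cs s" "cs t" shows "cs (\<lambda>n. s n \<oplus> t n)"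
proof (rule csI)
  fix e :: real assume e: "e > 0"
  obtain N M where N: "\<forall>m\<ge>N. \<forall>n\<ge>N. cnorm A (s m \<ominus> s n) < e / 2" and M: "\<forall>m\<ge>M. \<forall>n\<ge>M. cnorm A (t m \<ominus> t n) < e / 2"
    using csD[OF assms(1), of "e / 2"] csD[OF assms(2), of "e / 2"] e by auto
  note c = cs_in[OF assms(1)] cs_in[OF assms(2)]
  have "cnorm A ((s m \<oplus> t m) \<ominus> (s n \<oplus> t n)) < e" if "m \<ge> max N M" "n \<ge> max N M" for m n
  proof -
    have "(s m \<oplus> t m) \<ominus> (s n \<oplus> t n) = (s m \<ominus> s n) \<oplus> (t m \<ominus> t n)"
      using c by (simp add: A.minus_eq A.minus_add A.a_ac)
    moreover have "cnorm A (s m \<ominus> s n) < e / 2" "cnorm A (t m \<ominus> t n) < e / 2" using N M that by auto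
    ultimately show ?thesis using sn_add[of "s m \<ominus> s n" "t m \<ominus> t n"] c by simp
  qed
  then show "\<exists>N. \<forall>m\<ge>N. \<forall>n\<ge>N. cnorm A ((s m \<oplus> t m) \<ominus> (s n \<oplus> t n)) < e" by blast
qed (use assms in \<open>simp add: cs_in\<close>)

lemma cs_smult: "cs s \<Longrightarrow> cs (\<lambda>n. c \<odot> s n)"
proof (rule cs_lipschitz[where K = "cmod c"])
  assume s: "cs s"
  show "c \<odot> s n \<in> carrier A" for n by (simp add: A_smult_closed cs_in s)
  have "(c \<odot> s m) \<ominus> (c \<odot> s n) = c \<odot> (s m \<ominus> s n)" for m n
  proof -
    have "c \<odot> (\<ominus> s n) = \<ominus> (c \<odot> s n)"
      using cs_in[OF s, of n] by (simp add: A_smult_closed flip: smult_minus_one A_smult_rules(3))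
    then show ?thesis using cs_in[OF s] by (simp add: A.minus_eq A_smult_rules)
  qed
  then show "cnorm A ((c \<odot> s m) \<ominus> (c \<odot> s n)) \<le> cmod c * cnorm A (s m \<ominus> s n)" for m n
    using cs_in[OF s] by (simp add: sn_smult)
qed

lemma star_minus: assumes "x \<in> carrier A" "y \<in> carrier A" shows "star A (x \<ominus> y) = star A x \<ominus> star A y"
proof -
  have "star A (\<ominus> y) = \<ominus> star A y"
    using star_smult[OF assms(2), of "-1"] assms by (simp add: smult_minus_one star_closed)
  then show ?thesis using assms by (simp add: A.minus_eq star_add)
qed

lemma cs_star: "cs s \<Longrightarrow> cs (\<lambda>n. star A (s n))"
proof (rule cs_lipschitz[where K = 1])
  assume s: "cs s"
  show "star A (s n) \<in> carrier A" for n by (simp add: cs_in[OF s] star_closed)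
  show "cnorm A (star A (s m) \<ominus> star A (s n)) \<le> 1 * cnorm A (s m \<ominus> s n)" for m n
    using star_minus[OF cs_in cs_in, OF s s, of m n] sn_star_eq[of "s m \<ominus> s n"] cs_in[OF s] by simp
qed

lemma mult_minus_split: "\<lbrakk>a \<in> carrier A; b \<in> carrier A; c \<in> carrier A; d \<in> carrier A\<rbrakk> \<Longrightarrow>
    (a \<otimes> b) \<ominus> (c \<otimes> d) = (a \<ominus> c) \<otimes> b \<oplus> c \<otimes> (b \<ominus> d)"
  by (simp add: A.minus_eq A.l_distr A.r_distr A.l_minus A.r_minus A.a_assoc A.r_neg1)

lemma cs_mult: assumes "cs s" "cs t" shows "cs (\<lambda>n. s n \<otimes> t n)"
proof (rule csI)
  fix e :: real assume e: "e > 0"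
  note c = cs_in[OF assms(1)] cs_in[OF assms(2)]
  obtain K where K: "K > 0" "\<And>n. cnorm A (s n) \<le> K" using cs_bounded[OF assms(1)] by metis
  obtain L where L: "L > 0" "\<And>n. cnorm A (t n) \<le> L" using cs_bounded[OF assms(2)] by metis
  obtain N M where N: "\<forall>m\<ge>N. \<forall>n\<ge>N. cnorm A (s m \<ominus> s n) < e / (2 * L)"
    and M: "\<forall>m\<ge>M. \<forall>n\<ge>M. cnorm A (t m \<ominus> t n) < e / (2 * K)"
    using csD[OF assms(1), of "e / (2 * L)"] csD[OF assms(2), of "e / (2 * K)"] e K L by auto
  have "cnorm A ((s m \<otimes> t m) \<ominus> (s n \<otimes> t n)) < e" if mn: "m \<ge> max N M" "n \<ge> max N M" for m n
  proof -
    have "cnorm A ((s m \<otimes> t m) \<ominus> (s n \<otimes> t n))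
        \<le> cnorm A ((s m \<ominus> s n) \<otimes> t m) + cnorm A (s n \<otimes> (t m \<ominus> t n))"
      using c by (simp add: mult_minus_split sn_add)
    also have "\<dots> \<le> cnorm A (s m \<ominus> s n) * cnorm A (t m) + cnorm A (s n) * cnorm A (t m \<ominus> t n)"
      using c by (intro add_mono sn_mult) auto
    also have "\<dots> \<le> cnorm A (s m \<ominus> s n) * L + K * cnorm A (t m \<ominus> t n)"
      using c K L by (intro add_mono mult_left_mono mult_right_mono sn_nonneg) auto
    also have "cnorm A (s m \<ominus> s n) * L < e / 2" using N mn L(1) by (simp add: field_simps)
    also have "K * cnorm A (t m \<ominus> t n) < e / 2" using M mn K(1) by (simp add: field_simps)
    finally show ?thesis by simp
  qed
  then show "\<exists>N. \<forall>m\<ge>N. \<forall>n\<ge>N. cnorm A ((s m \<otimes> t m) \<ominus> (s n \<otimes> t n)) < e" by blast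
qed (use assms in \<open>simp add: cs_in\<close>)

lemma cs_uminus: "cs s \<Longrightarrow> cs (\<lambda>n. \<ominus> s n)"
  using cs_smult[of s "-1"] by (simp add: smult_minus_one cs_in)

lemma abelian_group_C: "abelian_group C"
proof (rule abelian_groupI)
  show "\<exists>t\<in>carrier C. t \<oplus>\<^bsub>C\<^esub> s = \<zero>\<^bsub>C\<^esub>" if "s \<in> carrier C" for s
    using that by (intro bexI[of _ "\<lambda>n. \<ominus> s n"]) (auto simp: C_simps cs_in A.l_neg intro: cs_uminus)
qed (auto simp: C_simps cs_in cs_add cs_const A.a_ac)

lemma star_algebra_C: "star_algebra C"
proof -
  have r: "ring C"
  proof (rule ringI[OF abelian_group_C])
    show "monoid C" by (rule monoidI) (auto simp: C_simps cs_in cs_const cs_mult A.m_assoc)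
  qed (auto simp: C_simps cs_in A.l_distr A.r_distr)
  have m: "Module.module complex_ring C"
    by (rule moduleI[OF cring_complex_ring abelian_group_C])
      (auto simp: C_simps cs_in cs_smult complex_ring_simps A_smult_rules)
  show ?thesis
    by (intro star_algebra.intro r m star_algebra_axioms.intro)
      (auto simp: C_simps cs_in cs_star smult_mult_left smult_mult_right star_closed star_star star_add
        star_smult star_mult)
qed

lemma C_minus: assumes "cs s" "cs t" shows "s \<ominus>\<^bsub>C\<^esub> t = (\<lambda>n. s n \<ominus> t n)"
proof -
  interpret C: abelian_group C by (rule abelian_group_C)
  have "\<ominus>\<^bsub>C\<^esub> t = (\<lambda>n. \<ominus> t n)"
    using assms by (intro C.minus_equality) (auto simp: C_simps cs_in A.l_neg cs_uminus)
  then show ?thesis by (simp add: a_minus_def C_simps)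
qed

lemma N_iff: "s \<in> N \<longleftrightarrow> (\<forall>n. s n \<in> carrier A) \<and> (\<lambda>n. cnorm A (s n)) \<longlonglongrightarrow> 0"
  by (simp add: null_sequences_def)

lemma N_cs: assumes "s \<in> N" shows "cs s"
proof (rule csI)
  fix e :: real assume e: "e > 0"
  have c: "s n \<in> carrier A" for n using assms by (simp add: N_iff)
  have "(\<lambda>n. cnorm A (s n)) \<longlonglongrightarrow> 0" using assms by (simp add: N_iff)
  from LIMSEQ_D[OF this, of "e / 2"] obtain M where M: "\<forall>n\<ge>M. norm (cnorm A (s n) - 0) < e / 2"
    using e by auto
  have "cnorm A (s m \<ominus> s n) < e" if "m \<ge> M" "n \<ge> M" for m n
  proof -
    have "cnorm A (s m) < e / 2" "cnorm A (s n) < e / 2" using M that by force+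
    then show ?thesis using sn_add[of "s m" "\<ominus> s n"] c by (simp add: A.minus_eq sn_uminus)
  qed
  then show "\<exists>N. \<forall>m\<ge>N. \<forall>n\<ge>N. cnorm A (s m \<ominus> s n) < e" by blast
qed (use assms in \<open>simp add: N_iff\<close>)

lemma N_dominated:
  assumes "s \<in> N" "\<And>n. t n \<in> carrier A" "\<And>n. cnorm A (t n) \<le> K * cnorm A (s n)" shows "t \<in> N"
proof -
  have "(\<lambda>n. K * cnorm A (s n)) \<longlonglongrightarrow> 0" using tendsto_mult_left[of "\<lambda>n. cnorm A (s n)" 0 sequentially K] assms(1) by (simp add: N_iff)
  then have "(\<lambda>n. cnorm A (t n)) \<longlonglongrightarrow> 0"
    by (rule Lim_null_comparison[rotated]) (use assms sn_nonneg in auto)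
  then show ?thesis using assms(2) by (simp add: N_iff)
qed

lemma N_add: assumes "s \<in> N" "t \<in> N" shows "(\<lambda>n. s n \<oplus> t n) \<in> N"
proof -
  have "(\<lambda>n. cnorm A (s n) + cnorm A (t n)) \<longlonglongrightarrow> 0" using assms tendsto_add[of "\<lambda>n. cnorm A (s n)" 0 sequentially "\<lambda>n. cnorm A (t n)" 0] by (simp add: N_iff)
  then have "(\<lambda>n. cnorm A (s n \<oplus> t n)) \<longlonglongrightarrow> 0"
    by (rule Lim_null_comparison[rotated]) (use assms sn_add sn_nonneg in \<open>auto simp: N_iff\<close>)
  then show ?thesis using assms by (simp add: N_iff)
qed

lemma N_mult: assumes s: "s \<in> N" and t: "cs t" shows "(\<lambda>n. s n \<otimes> t n) \<in> N" "(\<lambda>n. t n \<otimes> s n) \<in> N"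
proof -
  obtain K where K: "K > 0" "\<And>n. cnorm A (t n) \<le> K" using cs_bounded[OF t] by metis
  have c: "s n \<in> carrier A" "t n \<in> carrier A" for n using s t by (auto simp: N_iff cs_in)
  have "cnorm A (s n) * cnorm A (t n) \<le> K * cnorm A (s n)" for n
    using mult_right_mono[OF K(2)[of n] sn_nonneg[OF c(1)[of n]]] by (simp add: mult.commute)
  then have "cnorm A (s n \<otimes> t n) \<le> K * cnorm A (s n)" "cnorm A (t n \<otimes> s n) \<le> K * cnorm A (s n)" for n
    using sn_mult[OF c(1) c(2), of n n] sn_mult[OF c(2) c(1), of n n] by (simp_all add: mult.commute order_trans)
  then show "(\<lambda>n. s n \<otimes> t n) \<in> N" "(\<lambda>n. t n \<otimes> s n) \<in> N"
    using c by (auto intro!: N_dominated[OF s, where K = K])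
qed

lemma star_ideal_N: "star_ideal C N"
proof -
  interpret C: star_algebra C by (rule star_algebra_C)
  have id: "ideal N C"
  proof (rule idealI)
    show "ring C" by (rule C.A.ring_axioms)
    show "subgroup N (add_monoid C)"
    proof (rule C.A.add.subgroupI)
      fix s assume s: "s \<in> N"
      have "\<ominus>\<^bsub>C\<^esub> s = (\<lambda>n. \<ominus> s n)"
        using N_cs[OF s] by (intro C.A.minus_equality) (auto simp: C_simps cs_in A.l_neg cs_uminus)
      then show "\<ominus>\<^bsub>C\<^esub> s \<in> N" using s by (simp add: N_iff sn_uminus)
      fix t assume "t \<in> N"
      then show "s \<oplus>\<^bsub>C\<^esub> t \<in> N" using s by (simp add: C_simps N_add)
    next
      have "(\<lambda>_. \<zero>) \<in> N" by (simp add: N_iff sn_zero)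
      then show "N \<noteq> {}" by blast
    qed (auto simp: C_simps N_cs)
  qed (auto simp: C_simps N_mult)
  show ?thesis
  proof (intro star_ideal.intro star_algebra_C id star_ideal_axioms.intro)
    show "c \<odot>\<^bsub>C\<^esub> s \<in> N" if "s \<in> N" for s c
      unfolding C_simps using that by (intro N_dominated[OF that, where K = "cmod c"]) (auto simp: N_iff A_smult_closed sn_smult)
    show "star C s \<in> N" if "s \<in> N" for s
      unfolding C_simps using that by (intro N_dominated[OF that, where K = 1]) (auto simp: N_iff star_closed sn_star_eq)
  qed
qed

sublocale CN: star_ideal C N
  by (rule star_ideal_N)

end

section \<open>The completion: norm, density of constant sequences, completeness\<close>

context cstar_seminorm
begin

abbreviation Cp where "Cp \<equiv> cstar_completion A"

definition cl :: "(nat \<Rightarrow> 'a) \<Rightarrow> (nat \<Rightarrow> 'a) set" where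
  "cl s = N +>\<^bsub>C\<^esub> s"

lemma Cp_eq: "cstar_quot C N = Cp"
  by (simp add: cstar_completion_def)

lemma cl_closed: "cs s \<Longrightarrow> cl s \<in> carrier Cp"
  by (auto simp: Cp_eq[symmetric] CN.Q_carrier cl_def C_simps)

lemma Cp_obtain: assumes "X \<in> carrier Cp" obtains s where "cs s" "X = cl s"
  using assms by (auto simp: Cp_eq[symmetric] CN.Q_carrier cl_def C_simps)

lemma cl_eq_iff: "\<lbrakk>cs s; cs t\<rbrakk> \<Longrightarrow> cl s = cl t \<longleftrightarrow> (\<lambda>n. s n \<ominus> t n) \<in> N"
  by (simp add: cl_def CN.coset_eq_iff C_simps C_minus)

lemma cl_ops: "\<lbrakk>cs s; cs t\<rbrakk> \<Longrightarrow> cl s \<oplus>\<^bsub>Cp\<^esub> cl t = cl (\<lambda>n. s n \<oplus> t n)"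
  "\<lbrakk>cs s; cs t\<rbrakk> \<Longrightarrow> cl s \<otimes>\<^bsub>Cp\<^esub> cl t = cl (\<lambda>n. s n \<otimes> t n)"
  "\<lbrakk>cs s; cs t\<rbrakk> \<Longrightarrow> cl s \<ominus>\<^bsub>Cp\<^esub> cl t = cl (\<lambda>n. s n \<ominus> t n)"
  "cs s \<Longrightarrow> c \<odot>\<^bsub>Cp\<^esub> cl s = cl (\<lambda>n. c \<odot> s n)"
  "cs s \<Longrightarrow> star Cp (cl s) = cl (\<lambda>n. star A (s n))"
  "\<zero>\<^bsub>Cp\<^esub> = cl (\<lambda>_. \<zero>)" "\<one>\<^bsub>Cp\<^esub> = cl (\<lambda>_. \<one>)"
  by (simp_all add: cl_def Cp_eq[symmetric] CN.Q_ops CN.Q_minus CN.Q_consts C_simps C_minus)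

lemma norm_convergent: assumes "cs s" shows "convergent (\<lambda>n. cnorm A (s n))"
proof (rule Cauchy_convergent, rule metric_CauchyI)
  fix e :: real assume "e > 0"
  then obtain N where N: "\<forall>m\<ge>N. \<forall>n\<ge>N. cnorm A (s m \<ominus> s n) < e" using csD[OF assms] by blast
  have "dist (cnorm A (s m)) (cnorm A (s n)) < e" if "m \<ge> N" "n \<ge> N" for m n
    using sn_diff_abs[OF cs_in cs_in, OF assms assms, of m n] N that by (force simp: dist_real_def)
  then show "\<exists>M. \<forall>m\<ge>M. \<forall>n\<ge>M. dist (cnorm A (s m)) (cnorm A (s n)) < e" by blast
qed

text \<open>Adding a null sequence does not change the limit of the norms, so the infimum over the
  coset that defines the quotient norm is taken over a single value.\<close>

lemma norm_lim: assumes s: "cs s" shows "(\<lambda>n. cnorm A (s n)) \<longlonglongrightarrow> cnorm Cp (cl s)"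
proof -
  define L where "L = lim (\<lambda>n. cnorm A (s n))"
  have L: "(\<lambda>n. cnorm A (s n)) \<longlonglongrightarrow> L"
    using norm_convergent[OF s] by (simp add: L_def convergent_LIMSEQ_iff)
  have "cnorm C t = L" if t: "t \<in> cl s" for t
  proof -
    obtain h where h: "h \<in> N" "t = h \<oplus>\<^bsub>C\<^esub> s" using t by (auto simp: cl_def CN.mem_coset)
    have c: "h n \<in> carrier A" "s n \<in> carrier A" for n using h s by (auto simp: N_iff cs_in)
    have hl: "(\<lambda>n. cnorm A (h n)) \<longlonglongrightarrow> 0" using h(1) by (simp add: N_iff)
    have "\<bar>cnorm A (t n) - cnorm A (s n)\<bar> \<le> cnorm A (h n)" for n
    proof -
      have "(h n \<oplus> s n) \<ominus> s n = h n" using c by (simp add: A.minus_eq A.a_assoc A.r_neg)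
      then show ?thesis using sn_diff_abs[of "h n \<oplus> s n" "s n"] c by (simp add: h(2) C_simps)
    qed
    then have "(\<lambda>n. cnorm A (t n) - cnorm A (s n)) \<longlonglongrightarrow> 0"
      by (intro Lim_null_comparison[OF _ hl] always_eventually) auto
    from tendsto_add[OF this L] have "(\<lambda>n. cnorm A (t n)) \<longlonglongrightarrow> L" by simp
    then show ?thesis by (simp add: cauchy_algebra_def limI)
  qed
  moreover have "s \<in> cl s" using s sn_zero
    by (auto simp: cl_def CN.mem_coset C_simps N_iff cs_in intro!: bexI[of _ "\<lambda>_. \<zero>"])
  ultimately have "cnorm C ` cl s = {L}" by auto
  then have "cnorm Cp (cl s) = L" by (simp add: Cp_eq[symmetric] cstar_quot_def)
  then show ?thesis using L by simp
qed

lemma norm_cl_const: "x \<in> carrier A \<Longrightarrow> cnorm Cp (cl (\<lambda>_. x)) = cnorm A x"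
  using norm_lim[OF cs_const] by (simp add: LIMSEQ_const_iff)

lemma star_algebra_Cp: "star_algebra Cp"
  using CN.star_algebra_Q by (simp add: Cp_eq)

lemma cl_tendsto: assumes s: "cs s" shows "(\<lambda>n. cnorm Cp (cl (\<lambda>_. s n) \<ominus>\<^bsub>Cp\<^esub> cl s)) \<longlonglongrightarrow> 0"
proof (rule LIMSEQ_I)
  fix e :: real assume e: "e > 0"
  obtain N where N: "\<forall>m\<ge>N. \<forall>n\<ge>N. cnorm A (s m \<ominus> s n) < e / 2" using csD[OF s, of "e / 2"] e by auto
  have "norm (cnorm Cp (cl (\<lambda>_. s n) \<ominus>\<^bsub>Cp\<^esub> cl s) - 0) < e" if n: "n \<ge> N" for n
  proof -
    have c: "cs (\<lambda>m. s n \<ominus> s m)"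
      unfolding A.minus_eq by (intro cs_add cs_const cs_uminus s cs_in)
    have l: "(\<lambda>m. cnorm A (s n \<ominus> s m)) \<longlonglongrightarrow> cnorm Cp (cl (\<lambda>_. s n) \<ominus>\<^bsub>Cp\<^esub> cl s)"
      using norm_lim[OF c] s by (simp add: cl_ops cs_const cs_in)
    have "cnorm Cp (cl (\<lambda>_. s n) \<ominus>\<^bsub>Cp\<^esub> cl s) \<le> e / 2"
      by (rule LIMSEQ_le_const2[OF l]) (use N n in \<open>auto intro!: exI[of _ N] less_imp_le\<close>)
    moreover have "0 \<le> cnorm Cp (cl (\<lambda>_. s n) \<ominus>\<^bsub>Cp\<^esub> cl s)"
      by (rule LIMSEQ_le_const[OF l]) (use sn_nonneg[OF cs_in[OF c]] in auto)
    ultimately show ?thesis using e by simp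
  qed
  then show "\<exists>no. \<forall>n\<ge>no. norm (cnorm Cp (cl (\<lambda>_. s n) \<ominus>\<^bsub>Cp\<^esub> cl s) - 0) < e" by blast
qed

text \<open>Every axiom is an equality or weak inequality between norms of terms of representing
  sequences and passes to the limit.\<close>

lemma cstar_seminorm_Cp: "cstar_seminorm Cp"
proof (intro cstar_seminorm.intro star_algebra_Cp cstar_seminorm_axioms.intro)
  fix X Y c assume "X \<in> carrier Cp"
  then obtain s where s: "cs s" "X = cl s" by (rule Cp_obtain)
  note S = norm_lim[OF s(1)]
  show "0 \<le> cnorm Cp X" unfolding s(2)
    by (rule LIMSEQ_le_const[OF S]) (use s in \<open>auto intro!: sn_nonneg cs_in\<close>)
  show "cnorm Cp (c \<odot>\<^bsub>Cp\<^esub> X) = cmod c * cnorm Cp X"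
  proof -
    have "(\<lambda>n. cmod c * cnorm A (s n)) \<longlonglongrightarrow> cnorm Cp (c \<odot>\<^bsub>Cp\<^esub> X)"
      using norm_lim[OF cs_smult[OF s(1)], of c] s by (simp add: cl_ops sn_smult cs_in)
    then show ?thesis using tendsto_mult_left[OF S, of "cmod c"] s(2) LIMSEQ_unique by blast
  qed
  show "cnorm Cp (star Cp X \<otimes>\<^bsub>Cp\<^esub> X) = (cnorm Cp X)\<^sup>2"
  proof -
    have "(\<lambda>n. (cnorm A (s n))\<^sup>2) \<longlonglongrightarrow> cnorm Cp (star Cp X \<otimes>\<^bsub>Cp\<^esub> X)"
      using norm_lim[OF cs_mult[OF cs_star s(1)], OF s(1)] s by (simp add: cl_ops cs_star sn_star cs_in)
    then show ?thesis using tendsto_power[OF S, of 2] s(2) LIMSEQ_unique by blast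
  qed
  assume "Y \<in> carrier Cp"
  then obtain t where t: "cs t" "Y = cl t" by (rule Cp_obtain)
  note T = norm_lim[OF t(1)]
  have "(\<lambda>n. cnorm A (s n \<oplus> t n)) \<longlonglongrightarrow> cnorm Cp (X \<oplus>\<^bsub>Cp\<^esub> Y)"
    using norm_lim[OF cs_add[OF s(1) t(1)]] s t by (simp add: cl_ops)
  from LIMSEQ_le[OF this tendsto_add[OF S T]] show "cnorm Cp (X \<oplus>\<^bsub>Cp\<^esub> Y) \<le> cnorm Cp X + cnorm Cp Y"
    using s t sn_add cs_in by blast
  have "(\<lambda>n. cnorm A (s n \<otimes> t n)) \<longlonglongrightarrow> cnorm Cp (X \<otimes>\<^bsub>Cp\<^esub> Y)"
    using norm_lim[OF cs_mult[OF s(1) t(1)]] s t by (simp add: cl_ops)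
  from LIMSEQ_le[OF this tendsto_mult[OF S T]] show "cnorm Cp (X \<otimes>\<^bsub>Cp\<^esub> Y) \<le> cnorm Cp X * cnorm Cp Y"
    using s t sn_mult cs_in by blast
qed

text \<open>Definiteness is gained here: norm 0 means that the representing sequence is null, hence
  that its class is 0.\<close>

lemma norm_cl_eq_0: assumes s: "cs s" shows "cnorm Cp (cl s) = 0 \<longleftrightarrow> cl s = \<zero>\<^bsub>Cp\<^esub>"
proof -
  have "cl s = \<zero>\<^bsub>Cp\<^esub> \<longleftrightarrow> (\<lambda>n. s n \<ominus> \<zero>) \<in> N" using s by (simp add: cl_ops cl_eq_iff cs_const)
  also have "(\<lambda>n. s n \<ominus> \<zero>) = s" using cs_in[OF s] by (simp add: A.minus_eq fun_eq_iff)
  also have "s \<in> N \<longleftrightarrow> cnorm Cp (cl s) = 0"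
    using norm_lim[OF s] cs_in[OF s] by (auto simp: N_iff dest: LIMSEQ_unique)
  finally show ?thesis ..
qed

text \<open>For completeness, classes of constant sequences are dense, and a Cauchy sequence of such
  classes is itself a Cauchy sequence in A, whose class is the limit.\<close>

theorem completion_cstar: "unital_cstar_algebra Cp"
proof -
  interpret Cp: cstar_seminorm Cp by (rule cstar_seminorm_Cp)
  define D where "D = (\<lambda>x. cl (\<lambda>_. x)) ` carrier A"
  have DC: "D \<subseteq> carrier Cp" by (auto simp: D_def cs_const cl_closed)
  have complete: "\<exists>X\<in>carrier Cp. (\<lambda>n. cnorm Cp (S n \<ominus>\<^bsub>Cp\<^esub> X)) \<longlonglongrightarrow> 0"
    if S: "\<And>n :: nat. S n \<in> carrier Cp"
      and cauchy: "\<And>e. e > 0 \<Longrightarrow> \<exists>N. \<forall>m\<ge>N. \<forall>n\<ge>N. cnorm Cp (S m \<ominus>\<^bsub>Cp\<^esub> S n) < e" for S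
  proof (rule cauchy_limit_of_dense[where D = D and d = "\<lambda>X Y. cnorm Cp (X \<ominus>\<^bsub>Cp\<^esub> Y)", OF _ _ _ DC _ _ S cauchy])
    show "\<exists>Y\<in>D. cnorm Cp (X \<ominus>\<^bsub>Cp\<^esub> Y) < e" if X: "X \<in> carrier Cp" and e: "e > 0" for X e
    proof -
      obtain s where s: "cs s" "X = cl s" using X by (rule Cp_obtain)
      obtain N where "\<forall>n\<ge>N. norm (cnorm Cp (cl (\<lambda>_. s n) \<ominus>\<^bsub>Cp\<^esub> cl s) - 0) < e"
        using LIMSEQ_D[OF cl_tendsto[OF s(1)] e] by blast
      then have "cnorm Cp (cl (\<lambda>_. s N) \<ominus>\<^bsub>Cp\<^esub> X) < e" using s(2) by force
      then show ?thesis
        using X s(1) by (intro bexI[of _ "cl (\<lambda>_. s N)"])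
          (auto simp: D_def cs_in Cp.sn_minus_commute cl_closed cs_const)
    qed
    fix T :: "nat \<Rightarrow> (nat \<Rightarrow> 'a) set"
    assume T: "\<And>n. T n \<in> D" and c: "\<And>e. e > 0 \<Longrightarrow> \<exists>N. \<forall>m\<ge>N. \<forall>n\<ge>N. cnorm Cp (T m \<ominus>\<^bsub>Cp\<^esub> T n) < e"
    have "\<forall>n. \<exists>x\<in>carrier A. T n = cl (\<lambda>_. x)" using T by (auto simp: D_def)
    then obtain x where x: "\<And>n. x n \<in> carrier A" "\<And>n. T n = cl (\<lambda>_. x n)" by metis
    have "cnorm Cp (T m \<ominus>\<^bsub>Cp\<^esub> T n) = cnorm A (x m \<ominus> x n)" for m n
      using x by (simp add: cl_ops cs_const norm_cl_const)
    then have "cs x" using x c by (intro csI) auto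
    then show "\<exists>X\<in>carrier Cp. (\<lambda>n. cnorm Cp (T n \<ominus>\<^bsub>Cp\<^esub> X)) \<longlonglongrightarrow> 0"
      using cl_tendsto[of x] cl_closed[of x] x(2) by auto
  qed (auto intro: Cp.sn_triangle Cp.sn_minus_commute Cp.sn_nonneg)
  show ?thesis
  proof (intro unital_cstar_algebra.intro unital_cstar_algebra_axioms.intro)
    show "ring Cp" by (rule Cp.A.ring_axioms)
    show "Module.module complex_ring Cp" by (rule Cp.module_axioms)
    show "cnorm Cp X = 0 \<longleftrightarrow> X = \<zero>\<^bsub>Cp\<^esub>" if X: "X \<in> carrier Cp" for X
      using X norm_cl_eq_0 by (metis Cp_obtain)
  qed (use complete in \<open>auto simp: Cp.smult_mult_left Cp.smult_mult_right Cp.star_closed Cp.star_star Cp.star_add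
      Cp.star_smult Cp.star_mult Cp.sn_nonneg Cp.sn_add Cp.sn_smult Cp.sn_mult Cp.sn_star\<close>)
qed

end

section \<open>Star-homomorphisms, their extension to completions, and sections\<close>

locale star_hom = A: star_algebra A + D: star_algebra D
  for A :: "('a, 'm) cstar_scheme" and D :: "('d, 'n) cstar_scheme" +
  fixes f :: "'a \<Rightarrow> 'd"
  assumes f_closed: "x \<in> carrier A \<Longrightarrow> f x \<in> carrier D"
    and f_add: "\<lbrakk>x \<in> carrier A; y \<in> carrier A\<rbrakk> \<Longrightarrow> f (x \<oplus>\<^bsub>A\<^esub> y) = f x \<oplus>\<^bsub>D\<^esub> f y"
    and f_mult: "\<lbrakk>x \<in> carrier A; y \<in> carrier A\<rbrakk> \<Longrightarrow> f (x \<otimes>\<^bsub>A\<^esub> y) = f x \<otimes>\<^bsub>D\<^esub> f y"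
    and f_smult: "x \<in> carrier A \<Longrightarrow> f (c \<odot>\<^bsub>A\<^esub> x) = c \<odot>\<^bsub>D\<^esub> f x"
    and f_star: "x \<in> carrier A \<Longrightarrow> f (star A x) = star D (f x)"
    and f_one: "f \<one>\<^bsub>A\<^esub> = \<one>\<^bsub>D\<^esub>"
begin

lemma f_zero: "f \<zero>\<^bsub>A\<^esub> = \<zero>\<^bsub>D\<^esub>"
proof -
  define z where "z = f \<zero>\<^bsub>A\<^esub>"
  have z: "z \<in> carrier D" "z \<oplus>\<^bsub>D\<^esub> z = z"
    using f_add[of "\<zero>\<^bsub>A\<^esub>" "\<zero>\<^bsub>A\<^esub>"] f_closed[of "\<zero>\<^bsub>A\<^esub>"] by (simp_all add: z_def)
  have "z = (z \<oplus>\<^bsub>D\<^esub> z) \<oplus>\<^bsub>D\<^esub> (\<ominus>\<^bsub>D\<^esub> z)" unfolding D.A.a_assoc[OF z(1) z(1) D.A.a_inv_closed[OF z(1)]]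
    using z(1) by (simp add: D.A.r_neg)
  then show ?thesis using z by (simp add: D.A.r_neg z_def)
qed

lemma f_uminus: "x \<in> carrier A \<Longrightarrow> f (\<ominus>\<^bsub>A\<^esub> x) = \<ominus>\<^bsub>D\<^esub> f x"
  using f_add[of "\<ominus>\<^bsub>A\<^esub> x" x] f_closed
  by (intro D.A.minus_equality[symmetric]) (simp_all add: A.A.l_neg f_zero)

lemma f_minus: "\<lbrakk>x \<in> carrier A; y \<in> carrier A\<rbrakk> \<Longrightarrow> f (x \<ominus>\<^bsub>A\<^esub> y) = f x \<ominus>\<^bsub>D\<^esub> f y"
  by (simp add: a_minus_def f_add f_uminus)

lemma f_finsum: "finite S \<Longrightarrow> (\<And>i. i \<in> S \<Longrightarrow> g i \<in> carrier A) \<Longrightarrow> f (finsum A g S) = finsum D (\<lambda>i. f (g i)) S"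
proof (induction S rule: finite_induct)
  case empty
  show ?case by (simp add: f_zero)
next
  case (insert x F)
  then have "finsum A g (insert x F) = g x \<oplus>\<^bsub>A\<^esub> finsum A g F"
    "finsum D (\<lambda>i. f (g i)) (insert x F) = f (g x) \<oplus>\<^bsub>D\<^esub> finsum D (\<lambda>i. f (g i)) F"
    "finsum A g F \<in> carrier A"
    using f_closed by (auto intro!: A.A.finsum_insert D.A.finsum_insert A.A.finsum_closed)
  then show ?case using insert by (simp add: f_add)
qed

lemma positive_matrix_image: assumes "positive_matrix A n a" shows "positive_matrix D n (\<lambda>i j. f (a i j))"
proof -
  obtain x where x: "\<forall>i<n. \<forall>j<n. x i j \<in> carrier A"
    "\<forall>i<n. \<forall>j<n. a i j = (\<Oplus>\<^bsub>A\<^esub>k\<in>{..<n}. star A (x k i) \<otimes>\<^bsub>A\<^esub> x k j)"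
    using assms by (auto simp: positive_matrix_def)
  have "f (a i j) = (\<Oplus>\<^bsub>D\<^esub>k\<in>{..<n}. star D (f (x k i)) \<otimes>\<^bsub>D\<^esub> f (x k j))" if "i < n" "j < n" for i j
  proof -
    have "f (a i j) = (\<Oplus>\<^bsub>D\<^esub>k\<in>{..<n}. f (star A (x k i) \<otimes>\<^bsub>A\<^esub> x k j))"
      using x that by (simp, subst f_finsum) (auto simp: A.star_closed)
    also have "\<dots> = (\<Oplus>\<^bsub>D\<^esub>k\<in>{..<n}. star D (f (x k i)) \<otimes>\<^bsub>D\<^esub> f (x k j))"
      using x that by (intro D.A.finsum_cong') (auto simp: f_mult f_star f_closed A.star_closed D.star_closed)
    finally show ?thesis .
  qed
  then show ?thesis unfolding positive_matrix_def using x f_closed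
    by (intro exI[of _ "\<lambda>i j. f (x i j)"]) auto
qed

lemma unital_cp: "unital_cp A D f"
  unfolding unital_cp_def completely_positive_def complex_linear_def
  by (auto simp: f_closed f_add f_smult f_one positive_matrix_image)

end

lemma (in cstar_seminorm) cl_self: "cs s \<Longrightarrow> s \<in> cl s"
  using sn_zero by (auto simp: cl_def CN.mem_coset C_simps N_iff cs_in intro!: bexI[of _ "\<lambda>_. \<zero>"])

locale contractive_star_hom = A: cstar_seminorm A + D: cstar_seminorm D + star_hom A D f
  for A :: "('a, 'm) cstar_scheme" and D :: "('d, 'n) cstar_scheme" and f +
  assumes f_contract: "x \<in> carrier A \<Longrightarrow> cnorm D (f x) \<le> cnorm A x"
begin

text \<open>Since the map is contractive, null sequences go to null sequences and the union runs
  over a constant family; see \<open>ext_cl\<close>.\<close>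

definition ext :: "(nat \<Rightarrow> 'a) set \<Rightarrow> (nat \<Rightarrow> 'd) set" where
  "ext X = (\<Union>s\<in>X. D.cl (\<lambda>n. f (s n)))"

lemma cs_image: "A.cs s \<Longrightarrow> D.cs (\<lambda>n. f (s n))"
proof (rule D.csI)
  assume s: "A.cs s"
  show "f (s n) \<in> carrier D" for n by (simp add: f_closed A.cs_in[OF s])
  fix e :: real assume "e > 0"
  then obtain N where N: "\<forall>m\<ge>N. \<forall>n\<ge>N. cnorm A (s m \<ominus>\<^bsub>A\<^esub> s n) < e" using A.csD[OF s] by blast
  have "cnorm D (f (s m) \<ominus>\<^bsub>D\<^esub> f (s n)) < e" if "m \<ge> N" "n \<ge> N" for m n
    using N that f_contract[of "s m \<ominus>\<^bsub>A\<^esub> s n"] A.cs_in[OF s] by (force simp: f_minus)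
  then show "\<exists>N. \<forall>m\<ge>N. \<forall>n\<ge>N. cnorm D (f (s m) \<ominus>\<^bsub>D\<^esub> f (s n)) < e" by blast
qed

lemma null_image: assumes "s \<in> A.N" shows "(\<lambda>n. f (s n)) \<in> D.N"
proof -
  have c: "s n \<in> carrier A" for n using assms by (simp add: A.N_iff)
  have l: "(\<lambda>n. cnorm A (s n)) \<longlonglongrightarrow> 0" using assms by (simp add: A.N_iff)
  have "(\<lambda>n. cnorm D (f (s n))) \<longlonglongrightarrow> 0"
    by (rule Lim_null_comparison[OF _ l]) (use c f_contract f_closed D.sn_nonneg in auto)
  then show ?thesis using c by (simp add: D.N_iff f_closed)
qed

lemma ext_cl: assumes s: "A.cs s" shows "ext (A.cl s) = D.cl (\<lambda>n. f (s n))"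
proof -
  have "D.cl (\<lambda>n. f (t n)) = D.cl (\<lambda>n. f (s n))" if t: "t \<in> A.cl s" for t
  proof -
    obtain h where h: "h \<in> A.N" "t = h \<oplus>\<^bsub>A.C\<^esub> s" using t by (auto simp: A.cl_def A.CN.mem_coset)
    have c: "h n \<in> carrier A" "s n \<in> carrier A" for n using h s by (auto simp: A.N_iff A.cs_in)
    have ct: "A.cs t" unfolding h(2) A.C_simps by (intro A.cs_add A.N_cs h(1) s)
    have "f (t n) \<ominus>\<^bsub>D\<^esub> f (s n) = f (h n)" for n
    proof -
      have "(h n \<oplus>\<^bsub>A\<^esub> s n) \<ominus>\<^bsub>A\<^esub> s n = h n" using c by (simp add: A.A.minus_eq A.A.a_assoc A.A.r_neg)
      then show ?thesis using c by (simp add: h(2) A.C_simps flip: f_minus)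
    qed
    then show ?thesis using null_image[OF h(1)] by (simp add: D.cl_eq_iff cs_image ct s)
  qed
  then show ?thesis unfolding ext_def by (intro UN_constant_eq[OF A.cl_self[OF s]] ballI)
qed

lemma star_hom_ext: "star_hom (cstar_completion A) (cstar_completion D) ext"
proof (intro star_hom.intro A.star_algebra_Cp D.star_algebra_Cp star_hom_axioms.intro)
  fix X Y c assume "X \<in> carrier A.Cp"
  then obtain s where s: "A.cs s" "X = A.cl s" by (rule A.Cp_obtain)
  note ss = s(1) cs_image[OF s(1)]
  show "ext X \<in> carrier D.Cp" using ss by (simp add: s(2) ext_cl D.cl_closed)
  show "ext (c \<odot>\<^bsub>A.Cp\<^esub> X) = c \<odot>\<^bsub>D.Cp\<^esub> ext X"
    using ss by (simp add: s(2) ext_cl A.cl_ops D.cl_ops A.cs_smult f_smult A.cs_in)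
  show "ext (star A.Cp X) = star D.Cp (ext X)"
    using ss by (simp add: s(2) ext_cl A.cl_ops D.cl_ops A.cs_star f_star A.cs_in)
  assume "Y \<in> carrier A.Cp"
  then obtain t where t: "A.cs t" "Y = A.cl t" by (rule A.Cp_obtain)
  note tt = t(1) cs_image[OF t(1)]
  show "ext (X \<oplus>\<^bsub>A.Cp\<^esub> Y) = ext X \<oplus>\<^bsub>D.Cp\<^esub> ext Y"
    using ss tt by (simp add: s(2) t(2) ext_cl A.cl_ops D.cl_ops A.cs_add f_add A.cs_in)
  show "ext (X \<otimes>\<^bsub>A.Cp\<^esub> Y) = ext X \<otimes>\<^bsub>D.Cp\<^esub> ext Y"
    using ss tt by (simp add: s(2) t(2) ext_cl A.cl_ops D.cl_ops A.cs_mult f_mult A.cs_in)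
next
  show "ext \<one>\<^bsub>A.Cp\<^esub> = \<one>\<^bsub>D.Cp\<^esub>" by (simp add: A.cl_ops D.cl_ops ext_cl A.cs_const f_one)
qed

lemma ext_contract: assumes "X \<in> carrier (cstar_completion A)"
  shows "cnorm (cstar_completion D) (ext X) \<le> cnorm (cstar_completion A) X"
proof -
  obtain s where s: "A.cs s" "X = A.cl s" using assms by (rule A.Cp_obtain)
  show ?thesis unfolding s(2) ext_cl[OF s(1)]
    by (rule LIMSEQ_le[OF D.norm_lim[OF cs_image[OF s(1)]] A.norm_lim[OF s(1)]])
      (use f_contract A.cs_in[OF s(1)] in auto)
qed

text \<open>A Cauchy sequence in D is thinned out until consecutive differences are below the powers
  of 1/2. Lifting these differences with the same bounds and summing up gives a Cauchy sequence in A
  that maps to the thinned sequence.\<close>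

lemma ext_surj:
  assumes lift: "\<And>d r. d \<in> carrier D \<Longrightarrow> cnorm D d < r \<Longrightarrow> \<exists>x\<in>carrier A. f x = d \<and> cnorm A x < r"
    and "Y \<in> carrier (cstar_completion D)"
  shows "\<exists>X\<in>carrier (cstar_completion A). ext X = Y"
proof -
  obtain t where t: "D.cs t" "Y = D.cl t" using assms(2) by (rule D.Cp_obtain)
  have "\<forall>n :: nat. \<exists>N. \<forall>i\<ge>N. \<forall>j\<ge>N. cnorm D (t i \<ominus>\<^bsub>D\<^esub> t j) < (1/2) ^ n"
    using D.csD[OF t(1)] by simp
  then obtain N where N: "\<And>n i j. i \<ge> N n \<Longrightarrow> j \<ge> N n \<Longrightarrow> cnorm D (t i \<ominus>\<^bsub>D\<^esub> t j) < (1/2) ^ n" by metis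
  \<comment> \<open>Adding all earlier N i puts both k n and k (n+1) beyond N n; the summand n makes
    the indices tend to infinity.\<close>
  define k where "k n = n + (\<Sum>i\<le>n. N i)" for n
  have kN: "k n \<ge> N n" for n unfolding k_def by (simp add: member_le_sum trans_le_add2)
  have kS: "k (Suc n) \<ge> N n" for n using kN[of n] by (simp add: k_def)
  define d where "d n = t (k (Suc n)) \<ominus>\<^bsub>D\<^esub> t (k n)" for n
  have dc: "d n \<in> carrier D" for n using D.cs_in[OF t(1)] by (simp add: d_def)
  have "\<forall>n. \<exists>x\<in>carrier A. f x = d n \<and> cnorm A x < (1/2) ^ n"
    using lift[OF dc] N kN kS by (simp add: d_def)
  then obtain y where y: "\<And>n. y n \<in> carrier A" "\<And>n. f (y n) = d n" "\<And>n. cnorm A (y n) < (1/2) ^ n" by metis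
  obtain x0 where x0: "x0 \<in> carrier A" "f x0 = t (k 0)"
    using lift[OF D.cs_in[OF t(1), of "k 0"], of "cnorm D (t (k 0)) + 1"] by auto
  define x where "x n = rec_nat x0 (\<lambda>n z. z \<oplus>\<^bsub>A\<^esub> y n) n" for n
  have x_0: "x 0 = x0" and x_Suc: "x (Suc n) = x n \<oplus>\<^bsub>A\<^esub> y n" for n by (simp_all add: x_def)
  have xc: "x n \<in> carrier A" for n by (induction n) (simp_all add: x_0 x_Suc x0 y)
  have fx: "f (x n) = t (k n)" for n
  proof (induction n)
    case (Suc n)
    have "t (k n) \<oplus>\<^bsub>D\<^esub> (t (k (Suc n)) \<ominus>\<^bsub>D\<^esub> t (k n)) = t (k (Suc n))"
      using D.cs_in[OF t(1)] D.minus_plus_cancel by (simp add: D.A.a_comm)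
    then show ?case using Suc xc y by (simp add: x_Suc f_add d_def)
  qed (simp add: x_0 x0)
  \<comment> \<open>The bound is the exact value of the geometric sum from n to n + p - 1, which
    lets the induction close.\<close>
  have step: "cnorm A (x (n + p) \<ominus>\<^bsub>A\<^esub> x n) \<le> 2 * (1/2) ^ n - 2 * (1/2) ^ (n + p)" for n p
  proof (induction p)
    case 0
    then show ?case using xc by (simp add: A.A.minus_eq A.A.r_neg A.sn_zero)
  next
    case (Suc p)
    have "x (n + Suc p) \<ominus>\<^bsub>A\<^esub> x (n + p) = y (n + p)"
      using xc y(1) by (simp add: x_Suc A.A.minus_eq A.A.a_comm[of "x (n + p)" "y (n + p)"] A.A.a_assoc A.A.r_neg)
    then have "cnorm A (x (n + Suc p) \<ominus>\<^bsub>A\<^esub> x (n + p)) \<le> (1/2) ^ (n + p)"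
      using y(3)[of "n + p"] by simp
    then have "cnorm A (x (n + Suc p) \<ominus>\<^bsub>A\<^esub> x n) \<le> (1/2) ^ (n + p) + (2 * (1/2) ^ n - 2 * (1/2) ^ (n + p))"
      using A.sn_triangle[OF xc[of "n + Suc p"] xc[of "n + p"] xc[of n]] Suc by linarith
    then show ?case by (simp add: power_add)
  qed
  have "A.cs x"
  proof (rule A.csI[OF xc])
    fix e :: real assume e: "e > 0"
    obtain M where M: "(1/2 :: real) ^ M < e / 4" using real_arch_pow_inv[of "e / 4" "1/2"] e by auto
    have near: "cnorm A (x m \<ominus>\<^bsub>A\<^esub> x M) < e / 2" if "m \<ge> M" for m
    proof -
      have "cnorm A (x m \<ominus>\<^bsub>A\<^esub> x M) \<le> 2 * (1/2) ^ M - 2 * (1/2) ^ m" using step[of M "m - M"] that by simp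
      moreover have "(1/2 :: real) ^ m \<ge> 0" by simp
      ultimately show ?thesis using M by linarith
    qed
    have "cnorm A (x m \<ominus>\<^bsub>A\<^esub> x n) < e" if "m \<ge> M" "n \<ge> M" for m n
      using near[OF that(1)] near[OF that(2)] A.sn_triangle[OF xc[of m] xc[of M] xc[of n]]
        A.sn_minus_commute[OF xc[of n] xc[of M]] by linarith
    then show "\<exists>N. \<forall>m\<ge>N. \<forall>n\<ge>N. cnorm A (x m \<ominus>\<^bsub>A\<^esub> x n) < e" by blast
  qed
  moreover have "D.cl (\<lambda>n. f (x n)) = D.cl t"
  proof -
    have c: "D.cs (\<lambda>n. t (k n))" using cs_image[OF \<open>A.cs x\<close>] by (simp add: fx)
    have "(\<lambda>n. cnorm D (t (k n) \<ominus>\<^bsub>D\<^esub> t n)) \<longlonglongrightarrow> 0"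
    proof (rule LIMSEQ_I)
      fix e :: real assume "e > 0"
      then obtain M where M: "\<forall>m\<ge>M. \<forall>n\<ge>M. cnorm D (t m \<ominus>\<^bsub>D\<^esub> t n) < e" using D.csD[OF t(1)] by blast
      have "norm (cnorm D (t (k n) \<ominus>\<^bsub>D\<^esub> t n) - 0) < e" if "n \<ge> M" for n
      proof -
        have "k n \<ge> M" using that by (simp add: k_def)
        then show ?thesis using M that D.sn_nonneg[of "t (k n) \<ominus>\<^bsub>D\<^esub> t n"] D.cs_in[OF t(1)] by simp
      qed
      then show "\<exists>no. \<forall>n\<ge>no. norm (cnorm D (t (k n) \<ominus>\<^bsub>D\<^esub> t n) - 0) < e" by blast
    qed
    then show ?thesis using c t(1) D.cs_in[OF t(1)] by (simp add: fx D.cl_eq_iff D.N_iff)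
  qed
  ultimately show ?thesis using t(2) ext_cl A.cl_closed by metis
qed

text \<open>The section is obtained by lifting the *-isomorphism of the target onto the quotient by the kernel.\<close>

lemma lifting_section:
  assumes surj: "\<And>Y. Y \<in> carrier (cstar_completion D) \<Longrightarrow> \<exists>X\<in>carrier (cstar_completion A). ext X = Y"
    and LP: "lifting_property TYPE((nat \<Rightarrow> 'a) set) (cstar_completion D)"
  obtains \<sigma> where "unital_cp (cstar_completion D) (cstar_completion A) \<sigma>"
    "\<And>Y. Y \<in> carrier (cstar_completion D) \<Longrightarrow> ext (\<sigma> Y) = Y"
proof -
  interpret AC: cstar_seminorm A.Cp by (rule A.cstar_seminorm_Cp)
  interpret DC: cstar_seminorm D.Cp by (rule D.cstar_seminorm_Cp)
  interpret E: star_hom A.Cp D.Cp ext by (rule star_hom_ext)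
  interpret DU: unital_cstar_algebra D.Cp by (rule D.completion_cstar)
  define B :: "(nat \<Rightarrow> 'a) set cstar" where "B = A.Cp"
  \<comment> \<open>The lifting problem is posed for the completion of A itself and the kernel of
    the extended map.\<close>
  define J where "J = {X \<in> carrier B. ext X = \<zero>\<^bsub>D.Cp\<^esub>}"
  have idJ: "ideal J B"
  proof (rule idealI)
    show "ring B" unfolding B_def by (rule AC.A.ring_axioms)
    show "subgroup J (add_monoid B)" unfolding B_def
    proof (rule AC.A.add.subgroupI)
      show "J \<noteq> {}" unfolding J_def B_def using E.f_zero by blast
    qed (auto simp: J_def B_def E.f_add E.f_uminus)
  qed (auto simp: J_def B_def E.f_mult E.f_closed)
  have sJ: "star_ideal B J"
  proof (intro star_ideal.intro idJ star_ideal_axioms.intro)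
    show "star_algebra B" unfolding B_def by (rule AC.star_algebra_axioms)
    show "c \<odot>\<^bsub>B\<^esub> X \<in> J" if "X \<in> J" for X c
    proof -
      have "c \<odot>\<^bsub>D.Cp\<^esub> \<zero>\<^bsub>D.Cp\<^esub> = \<zero>\<^bsub>D.Cp\<^esub>"
        using DC.sn_smult[of "\<zero>\<^bsub>D.Cp\<^esub>" c] DC.sn_zero DU.cnorm_eq_zero[of "c \<odot>\<^bsub>D.Cp\<^esub> \<zero>\<^bsub>D.Cp\<^esub>"] DC.A_smult_closed
        by simp
      then show ?thesis using that by (simp add: J_def B_def E.f_smult AC.A_smult_closed)
    qed
    show "star B X \<in> J" if "X \<in> J" for X
    proof -
      have "star D.Cp \<zero>\<^bsub>D.Cp\<^esub> = \<zero>\<^bsub>D.Cp\<^esub>"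
        using DC.sn_star_eq[of "\<zero>\<^bsub>D.Cp\<^esub>"] DC.sn_zero DU.cnorm_eq_zero[of "star D.Cp \<zero>\<^bsub>D.Cp\<^esub>"] DC.star_closed
        by simp
      then show ?thesis using that by (simp add: J_def B_def E.f_star AC.star_closed)
    qed
  qed
  interpret J: star_ideal B J by (rule sJ)
  have closed: "closed_ideal B J"
    unfolding closed_ideal_def
  proof (intro conjI idJ allI impI, elim conjE)
    fix S X assume S: "\<forall>n :: nat. S n \<in> J" and X: "X \<in> carrier B" and l: "(\<lambda>n. cnorm B (S n \<ominus>\<^bsub>B\<^esub> X)) \<longlonglongrightarrow> 0"
    have le: "cnorm D.Cp (ext X) \<le> cnorm B (S n \<ominus>\<^bsub>B\<^esub> X)" for n
    proof -
      have Sn: "S n \<in> carrier A.Cp" "ext (S n) = \<zero>\<^bsub>D.Cp\<^esub>" using S by (auto simp: J_def B_def)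
      have XC: "X \<in> carrier A.Cp" using X by (simp add: B_def)
      have "ext (S n \<ominus>\<^bsub>A.Cp\<^esub> X) = \<ominus>\<^bsub>D.Cp\<^esub> ext X"
        using Sn XC E.f_closed by (simp add: E.f_minus DC.A.minus_eq)
      then have "cnorm D.Cp (ext X) = cnorm D.Cp (ext (S n \<ominus>\<^bsub>A.Cp\<^esub> X))"
        using XC by (simp add: DC.sn_uminus E.f_closed)
      also have "\<dots> \<le> cnorm A.Cp (S n \<ominus>\<^bsub>A.Cp\<^esub> X)" using Sn XC by (intro ext_contract) simp
      finally show ?thesis by (simp add: B_def)
    qed
    have "cnorm D.Cp (ext X) \<le> 0" by (rule LIMSEQ_le_const[OF l]) (use le in auto)
    then have "ext X = \<zero>\<^bsub>D.Cp\<^esub>"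
      using DC.sn_nonneg[of "ext X"] DU.cnorm_eq_zero[of "ext X"] X E.f_closed by (auto simp: B_def)
    then show "X \<in> J" unfolding J_def using X by blast
  qed
  have "\<forall>Y. \<exists>X. Y \<in> carrier D.Cp \<longrightarrow> X \<in> carrier B \<and> ext X = Y"
    using surj unfolding B_def by blast
  from choice[OF this] obtain g where g: "\<And>Y. Y \<in> carrier D.Cp \<Longrightarrow> g Y \<in> carrier B \<and> ext (g Y) = Y"
    by blast
  \<comment> \<open>The inverse of the isomorphism from the quotient by the kernel. The choice of
    the preimage disappears in the coset, so \<theta> is a star-homomorphism, and therefore unital
    and completely positive.\<close>
  define \<theta> where "\<theta> Y = J +>\<^bsub>B\<^esub> g Y" for Y
  have \<theta>: "\<theta> (ext X) = J +>\<^bsub>B\<^esub> X" if X: "X \<in> carrier B" for X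
  proof -
    have XA: "X \<in> carrier A.Cp" using X by (simp add: B_def)
    have gX: "g (ext X) \<in> carrier A.Cp" "ext (g (ext X)) = ext X"
      using g[OF E.f_closed[OF XA]] by (simp_all add: B_def)
    have "ext (g (ext X) \<ominus>\<^bsub>A.Cp\<^esub> X) = \<zero>\<^bsub>D.Cp\<^esub>"
      using gX XA by (simp add: E.f_minus DC.A.minus_eq DC.A.r_neg E.f_closed)
    then have "g (ext X) \<ominus>\<^bsub>B\<^esub> X \<in> J" using gX XA by (simp add: J_def B_def)
    then show ?thesis unfolding \<theta>_def using gX(1) X by (subst J.coset_eq_iff) (simp_all add: B_def)
  qed
  have "star_hom D.Cp (cstar_quot B J) \<theta>"
  proof (intro star_hom.intro D.star_algebra_Cp J.star_algebra_Q star_hom_axioms.intro)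
    fix Y Z c assume "Y \<in> carrier D.Cp"
    then obtain X where X: "X \<in> carrier A.Cp" "Y = ext X" using surj[of Y] by blast
    have XB: "X \<in> carrier B" using X by (simp add: B_def)
    show "\<theta> Y \<in> carrier (cstar_quot B J)" using XB by (simp add: X(2) \<theta> J.Q_carrier)
    show "\<theta> (c \<odot>\<^bsub>D.Cp\<^esub> Y) = c \<odot>\<^bsub>cstar_quot B J\<^esub> \<theta> Y"
      using \<theta>[of "c \<odot>\<^bsub>B\<^esub> X"] J.Q_ops(3)[OF XB XB, of c] \<theta>[OF XB] J.B_smult_closed[OF XB, of c] E.f_smult[OF X(1), of c] X(2)
      unfolding B_def by simp
    show "\<theta> (star D.Cp Y) = star (cstar_quot B J) (\<theta> Y)"
      using \<theta>[of "star B X"] J.Q_ops(4)[OF XB XB] \<theta>[OF XB] J.star_closed[OF XB] E.f_star[OF X(1)] X(2)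
      unfolding B_def by simp
    assume "Z \<in> carrier D.Cp"
    then obtain W where W: "W \<in> carrier A.Cp" "Z = ext W" using surj[of Z] by blast
    have WB: "W \<in> carrier B" using W by (simp add: B_def)
    show "\<theta> (Y \<oplus>\<^bsub>D.Cp\<^esub> Z) = \<theta> Y \<oplus>\<^bsub>cstar_quot B J\<^esub> \<theta> Z"
      using \<theta>[of "X \<oplus>\<^bsub>B\<^esub> W"] J.Q_ops(1)[OF XB WB] \<theta>[OF XB] \<theta>[OF WB] AC.A.a_closed[OF X(1) W(1)]
        E.f_add[OF X(1) W(1)] X(2) W(2)
      unfolding B_def by simp
    show "\<theta> (Y \<otimes>\<^bsub>D.Cp\<^esub> Z) = \<theta> Y \<otimes>\<^bsub>cstar_quot B J\<^esub> \<theta> Z"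
      using \<theta>[of "X \<otimes>\<^bsub>B\<^esub> W"] J.Q_ops(2)[OF XB WB] \<theta>[OF XB] \<theta>[OF WB] AC.A.m_closed[OF X(1) W(1)]
        E.f_mult[OF X(1) W(1)] X(2) W(2)
      unfolding B_def by simp
  next
    show "\<theta> \<one>\<^bsub>D.Cp\<^esub> = \<one>\<^bsub>cstar_quot B J\<^esub>"
      using \<theta>[of "\<one>\<^bsub>B\<^esub>"] E.f_one J.Q_consts(2) AC.A.one_closed unfolding B_def by simp
  qed
  then have "unital_cp D.Cp (cstar_quot B J) \<theta>" by (rule star_hom.unital_cp)
  moreover have "unital_cstar_algebra B" unfolding B_def by (rule A.completion_cstar)
  ultimately obtain \<sigma> where \<sigma>: "unital_cp D.Cp B \<sigma>" "\<forall>Y\<in>carrier D.Cp. J +>\<^bsub>B\<^esub> \<sigma> Y = \<theta> Y"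
    using LP closed unfolding lifting_property_def by blast
  have "ext (\<sigma> Y) = Y" if Y: "Y \<in> carrier D.Cp" for Y
  proof -
    have sY: "\<sigma> Y \<in> carrier B" using \<sigma>(1) Y
      by (auto simp: unital_cp_def completely_positive_def complex_linear_def)
    have gY: "g Y \<in> carrier B" "ext (g Y) = Y" using g[OF Y] by auto
    have "\<sigma> Y \<ominus>\<^bsub>B\<^esub> g Y \<in> J" using J.coset_eq_iff[OF sY gY(1)] \<sigma>(2) Y by (simp add: \<theta>_def)
    then have z: "ext (\<sigma> Y) \<ominus>\<^bsub>D.Cp\<^esub> Y = \<zero>\<^bsub>D.Cp\<^esub>"
      using sY gY by (simp add: J_def B_def E.f_minus)
    have "ext (\<sigma> Y) \<in> carrier D.Cp" using sY E.f_closed by (simp add: B_def)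
    from DC.minus_plus_cancel[OF this Y] show ?thesis unfolding z DC.A.l_zero[OF Y] by (rule sym)
  qed
  then show thesis using that \<sigma>(1) by (simp add: B_def)
qed

end

section \<open>Quotient groups\<close>

lemma (in group) cstar_seminorm_group_algebra: "cstar_seminorm (group_algebra G)"
  by (intro cstar_seminorm.intro star_algebra_group_algebra cstar_seminorm_axioms.intro)
    (auto simp: group_algebra_simps full_norm_eq pnorm_nonneg pnorm_add pnorm_sc pnorm_mult pnorm_cstar
      cv_closed adj_closed CG_closed)

locale quotient_map = G: group G + K: group K for G :: "('a, 'm) monoid_scheme" and K :: "('b, 'n) monoid_scheme" +
  fixes q :: "'a \<Rightarrow> 'b"
  assumes q_hom: "q \<in> hom G K" and q_surj: "q ` carrier G = carrier K"
begin

lemma q_closed: "g \<in> carrier G \<Longrightarrow> q g \<in> carrier K"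
  using q_hom by (rule hom_in_carrier)

lemma q_mult: "\<lbrakk>g \<in> carrier G; h \<in> carrier G\<rbrakk> \<Longrightarrow> q (g \<otimes>\<^bsub>G\<^esub> h) = q g \<otimes>\<^bsub>K\<^esub> q h"
  using q_hom by (rule hom_mult)

sublocale group_hom G K q
  by unfold_locales (rule q_hom)

text \<open>Summation over the fibres of q; the formulation through \<open>Lf\<close> makes
  linearity immediate.\<close>

definition push :: "('a \<Rightarrow> complex) \<Rightarrow> 'b \<Rightarrow> complex" where
  "push x = (\<lambda>k. Lf (\<lambda>g. dl (q g) k) x)"

definition pull :: "('b \<Rightarrow> complex) \<Rightarrow> 'a \<Rightarrow> complex" where
  "pull \<phi> = (\<lambda>g. if g \<in> carrier G then \<phi> (q g) else 0)"

lemma push_linear: "\<lbrakk>x \<in> CG G; y \<in> CG G\<rbrakk> \<Longrightarrow> push (x + y) = push x + push y"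
  "x \<in> CG G \<Longrightarrow> push (c *\<^sub>c x) = c *\<^sub>c push x" "push (dl g) = dl (q g)" "push 0 = 0"
  by (auto simp: push_def fun_eq_iff Lf_add Lf_sc Lf_dl Lf_zero sc_def[of c "\<lambda>k. Lf (\<lambda>g. dl (q g) k) x"]
      simp del: plus_fun_apply zero_fun_apply) auto

lemma push_closed: "x \<in> CG G \<Longrightarrow> push x \<in> CG K"
  by (induction rule: CG_induct)
    (simp_all add: push_linear dl_CG CG_closed q_closed del: plus_fun_apply zero_fun_apply)

lemma push_cv: assumes x: "x \<in> CG G" and y: "y \<in> CG G" shows "push (cv G x y) = cv K (push x) (push y)"
  using x
proof (induction rule: CG_induct)
  case (add c g x)
  have "push (cv G (dl g) y) = cv K (dl (q g)) (push y)" using y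
  proof (induction rule: CG_induct)
    case (add d h y)
    then show ?case using \<open>g \<in> carrier G\<close>
      by (simp add: G.cv_bilinear K.cv_bilinear push_linear dl_CG CG_closed G.cv_closed G.cv_dl K.cv_dl
          q_closed q_mult del: plus_fun_apply)
  qed (simp add: push_linear G.cv_zero K.cv_zero del: zero_fun_apply)
  then show ?case using add y
    by (simp add: G.cv_bilinear K.cv_bilinear push_linear dl_CG CG_closed G.cv_closed push_closed q_closed
        del: plus_fun_apply)
qed (simp add: push_linear G.cv_zero K.cv_zero del: zero_fun_apply)

lemma push_adj: "x \<in> CG G \<Longrightarrow> push (adj G x) = adj K (push x)"
proof (induction rule: CG_induct)
  case (add c g x)
  then show ?case
    by (simp add: G.adj_add K.adj_add G.adj_sc K.adj_sc G.adj_dl K.adj_dl push_linear dl_CG CG_closed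
        G.adj_closed q_closed del: plus_fun_apply)
qed (simp add: push_linear G.adj_zero K.adj_zero del: zero_fun_apply)

lemma push_surj: "y \<in> CG K \<Longrightarrow> \<exists>x\<in>CG G. push x = y"
proof (induction rule: CG_induct)
  case zero
  show ?case by (rule bexI[of _ 0]) (rule push_linear, rule CG_closed)
next
  case (add c k y)
  have "k \<in> q ` carrier G" using add.hyps(1) by (simp add: q_surj)
  then obtain g where g: "g \<in> carrier G" "q g = k" by auto
  from add.IH obtain x where x: "x \<in> CG G" "push x = y" by (rule bexE)
  show ?case
  proof (rule bexI)
    show "push (c *\<^sub>c dl g + x) = c *\<^sub>c dl k + y"
      using g x by (simp add: push_linear CG_closed dl_CG del: plus_fun_apply)
    show "c *\<^sub>c dl g + x \<in> CG G" by (intro CG_closed dl_CG g x)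
  qed
qed

lemma Lf_push: "x \<in> CG G \<Longrightarrow> Lf \<phi> (push x) = Lf (pull \<phi>) x"
proof (induction rule: CG_induct)
  case (add c g x)
  then show ?case
    by (simp add: push_linear Lf_add[where G = K] Lf_add[where G = G] Lf_sc[where G = K] Lf_sc[where G = G]
        CG_closed dl_CG push_closed q_closed Lf_dl del: plus_fun_apply) (simp add: pull_def)
qed (simp add: push_linear Lf_zero del: zero_fun_apply)

lemma fm_push: "x \<in> CG G \<Longrightarrow> K.fm \<phi> (push x) (push x) = G.fm (pull \<phi>) x x"
  by (simp add: K.fm_def G.fm_def Lf_push G.cv_closed G.adj_closed flip: push_adj push_cv)

lemma nrmf_push: "x \<in> CG G \<Longrightarrow> K.nrmf \<phi> (push x) = G.nrmf (pull \<phi>) x"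
  by (simp add: K.nrmf_def G.nrmf_def fm_push)

lemma pull_P1: assumes "\<phi> \<in> K.P1" shows "pull \<phi> \<in> G.P1"
proof -
  have "G.posdef (pull \<phi>)"
    using assms push_closed unfolding G.posdef_def K.P1_def K.posdef_def
    by (auto simp: fm_push[symmetric]) (simp add: pull_def)
  then show ?thesis using assms by (simp add: G.P1_def K.P1_def pull_def)
qed

lemma pnorm_push: "x \<in> CG G \<Longrightarrow> K.pnorm (push x) \<le> G.pnorm x"
  by (rule K.pnorm_least) (simp add: nrmf_push G.nrmf_le_pnorm pull_P1)

text \<open>If \<psi> is 1 at n and at its inverse, then n - 1 has norm 0 in the GNS form, and by
  Cauchy-Schwarz right translation by n leaves \<psi> unchanged. So \<psi> is constant on cosets of
  the kernel.\<close>

lemma descend_P1: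
  assumes \<psi>: "\<psi> \<in> G.P1" and ker: "\<And>n. n \<in> kernel G K q \<Longrightarrow> \<psi> n = 1"
  obtains \<phi> where "\<phi> \<in> K.P1" "pull \<phi> = \<psi>"
proof -
  note pd = G.P1_D(1)[OF \<psi>] and one = G.P1_D(2)[OF \<psi>]
  have inv: "\<psi> (g \<otimes>\<^bsub>G\<^esub> n) = \<psi> g" if g: "g \<in> carrier G" and n: "n \<in> kernel G K q" for g n
  proof -
    have nG: "n \<in> carrier G" and n': "inv\<^bsub>G\<^esub> n \<in> kernel G K q"
      using n by (auto simp: kernel_def)
    define z :: "'a \<Rightarrow> complex" where "z = dl n + (-1) *\<^sub>c dl \<one>\<^bsub>G\<^esub>"
    have z: "z \<in> CG G" unfolding z_def by (intro CG_closed dl_CG nG G.one_closed)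
    have fz: "G.fm \<psi> z w = G.fm \<psi> (dl n) w - G.fm \<psi> (dl \<one>\<^bsub>G\<^esub>) w" if "w \<in> CG G" for w
      unfolding z_def using nG that by (simp add: G.fm_linear dl_CG CG_closed del: plus_fun_apply)
    have "G.fm \<psi> z z = 0"
      unfolding fz[OF z] unfolding z_def using nG ker[OF n] ker[OF n'] one
      by (simp add: G.fm_linear dl_CG CG_closed G.fm_dl del: plus_fun_apply)
    then have "G.nrmf \<psi> z = 0" by (simp add: G.nrmf_def)
    then have "G.fm \<psi> z (dl (inv\<^bsub>G\<^esub> g)) = 0"
      using G.fm_cauchy_schwarz[OF pd z dl_CG[of "inv\<^bsub>G\<^esub> g" G]] g by simp
    then show ?thesis using fz[of "dl (inv\<^bsub>G\<^esub> g)"] g nG by (simp add: dl_CG G.fm_dl)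
  qed
  define \<phi> where "\<phi> k = (if k \<in> carrier K then \<psi> (SOME g. g \<in> carrier G \<and> q g = k) else 0)" for k
  have pull: "pull \<phi> = \<psi>"
  proof
    fix g
    show "pull \<phi> g = \<psi> g"
    proof (cases "g \<in> carrier G")
      case True
      define h where "h = (SOME h. h \<in> carrier G \<and> q h = q g)"
      have h: "h \<in> carrier G" "q h = q g" using someI[of "\<lambda>h. h \<in> carrier G \<and> q h = q g" g] True by (auto simp: h_def)
      have "inv\<^bsub>G\<^esub> g \<otimes>\<^bsub>G\<^esub> h \<in> kernel G K q" using True h by (simp add: kernel_def q_closed)
      then have "\<psi> (g \<otimes>\<^bsub>G\<^esub> (inv\<^bsub>G\<^esub> g \<otimes>\<^bsub>G\<^esub> h)) = \<psi> g" by (rule inv[OF True])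
      then have "\<psi> h = \<psi> g" using True h by (simp add: G.m_assoc[symmetric])
      then show ?thesis using True by (simp add: pull_def \<phi>_def h_def q_closed)
    qed (simp add: pull_def G.posdef_off[OF pd])
  qed
  have "K.posdef \<phi>" unfolding K.posdef_def
  proof (intro conjI allI impI ballI)
    fix y assume "y \<in> CG K"
    then obtain x where x: "x \<in> CG G" "push x = y" using push_surj by blast
    then have "K.fm \<phi> y y = G.fm \<psi> x x" using fm_push[of x \<phi>] pull by simp
    then show "Im (K.fm \<phi> y y) = 0" "0 \<le> Re (K.fm \<phi> y y)" using pd x(1) by (auto simp: G.posdef_def)
  qed (simp add: \<phi>_def)
  moreover have "\<phi> \<one>\<^bsub>K\<^esub> = 1" using fun_cong[OF pull, of "\<one>\<^bsub>G\<^esub>"] one by (simp add: pull_def)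
  ultimately show thesis using that pull by (simp add: K.P1_def)
qed

text \<open>Cesaro means of the powers of the average \<open>w\<close> of a finite subset of the kernel are lifts of the identity
  that are almost invariant under this subset.\<close>

lemma almost_invariant_state:
  assumes T: "finite T" "T \<noteq> {}" "T \<subseteq> kernel G K q" and \<epsilon>: "\<epsilon> > 0" and x: "x \<in> CG G" and r: "0 < r" "r < r'"
    and big: "\<And>y. y \<in> CG G \<Longrightarrow> push y = push x \<Longrightarrow> r' \<le> G.pnorm y"
  shows "\<exists>\<psi>\<in>G.P1. r \<le> G.nrmf \<psi> x \<and> (\<forall>t\<in>T. Re (1 - \<psi> t) \<le> \<epsilon>)"
proof -
  have TG: "t \<in> carrier G" "q t = \<one>\<^bsub>K\<^esub>" if "t \<in> T" for t using T(3) that by (auto simp: kernel_def)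
  define a where "a = complex_of_real (1 / card T)"
  have a: "of_nat (card T) * a = 1" "cmod a = 1 / card T" using T by (auto simp: a_def norm_divide)
  define w where "w = a *\<^sub>c (\<Sum>t\<in>T. dl t)"
  have sT: "(\<Sum>t\<in>T'. dl t) \<in> CG G" if "T' \<subseteq> T" for T' using that TG by (intro CG_sum dl_CG) auto
  have w: "w \<in> CG G" unfolding w_def by (intro CG_closed sT) simp
  have "push (\<Sum>t\<in>T'. dl t) = of_nat (card T') *\<^sub>c dl \<one>\<^bsub>K\<^esub> \<and> G.pnorm (\<Sum>t\<in>T'. dl t) \<le> card T'" if "T' \<subseteq> T" for T'
    using finite_subset[OF that T(1)] that
  proof (induction T' rule: finite_induct)
    case empty
    show ?case by (simp add: push_linear G.pnorm_zero sc_simps del: zero_fun_apply)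
  next
    case (insert t F)
    have "G.pnorm (dl t + (\<Sum>t\<in>F. dl t)) \<le> G.pnorm (dl t) + G.pnorm (\<Sum>t\<in>F. dl t)"
      using insert.prems TG by (intro G.pnorm_add dl_CG sT) auto
    moreover have "G.pnorm (dl t) \<le> 1" using insert.prems TG by (intro G.pnorm_dl) auto
    moreover have "push (dl t + (\<Sum>t\<in>F. dl t)) = dl \<one>\<^bsub>K\<^esub> + push (\<Sum>t\<in>F. dl t)"
      using insert.prems TG by (subst push_linear) (auto intro!: dl_CG sT simp: push_linear)
    ultimately show ?case using insert by (simp add: sc_distrib sc_simps del: plus_fun_apply)
  qed
  note sumT = this[OF subset_refl]
  have "cmod a * G.pnorm (\<Sum>t\<in>T. dl t) \<le> cmod a * card T" using sumT by (intro mult_left_mono) auto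
  then have pw: "push w = dl \<one>\<^bsub>K\<^esub>" "G.pnorm w \<le> 1"
    using sumT a sT T by (simp_all add: w_def push_linear sc_simps G.pnorm_sc mult.commute[of a])
  define u where "u j = rec_nat (dl \<one>\<^bsub>G\<^esub>) (\<lambda>_ v. cv G w v) j" for j
  have u0: "u 0 = dl \<one>\<^bsub>G\<^esub>" and uS: "u (Suc j) = cv G w (u j)" for j by (simp_all add: u_def)
  have u: "u j \<in> CG G \<and> push (u j) = dl \<one>\<^bsub>K\<^esub> \<and> G.pnorm (u j) \<le> 1" for j
  proof (induction j)
    case 0
    show ?case by (simp add: u0 G.one_CG push_linear G.pnorm_dl)
  next
    case (Suc j)
    have "G.pnorm (cv G w (u j)) \<le> G.pnorm w * G.pnorm (u j)" using Suc w by (intro G.pnorm_mult) auto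
    also have "\<dots> \<le> 1 * 1" using Suc pw w by (intro mult_mono) (auto intro: G.pnorm_nonneg)
    finally show ?case using Suc w pw by (simp add: uS G.cv_closed push_cv K.cv_dl)
  qed
  have uC: "(\<Sum>j<m. u j) \<in> CG G" for m using u by (intro CG_sum) auto
  define px where "px = G.pnorm x"
  have px: "r' \<le> px" "px > 0" using big[OF x refl] r by (auto simp: px_def)
  \<comment> \<open>The number of averaged powers, chosen so that the last estimate in the proof
    stays below \<epsilon>.\<close>
  obtain m :: nat where m: "m > 0" "card T * (2 * px / r) / \<epsilon> < m"
    using reals_Archimedean2[of "max 1 (card T * (2 * px / r) / \<epsilon>)"] by (metis max_less_iff_conj of_nat_0_less_iff zero_less_one less_trans)
  define b where "b = complex_of_real (1 / m)"
  have b: "of_nat m * b = 1" "cmod b = 1 / m" using m by (auto simp: b_def norm_divide)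
  define \<mu> where "\<mu> = b *\<^sub>c (\<Sum>j<m. u j)"
  have \<mu>: "\<mu> \<in> CG G" unfolding \<mu>_def by (intro CG_closed uC)
  have sums: "push (\<Sum>j<k. u j) = of_nat k *\<^sub>c dl \<one>\<^bsub>K\<^esub> \<and> G.pnorm (\<Sum>j<k. u j) \<le> k
     \<and> (\<Sum>j<k. u j) - cv G w (\<Sum>j<k. u j) = dl \<one>\<^bsub>G\<^esub> - u k" for k
  proof (induction k)
    case 0
    show ?case by (simp add: push_linear G.pnorm_zero sc_simps G.cv_zero u0 del: zero_fun_apply)
  next
    case (Suc k)
    have "push ((\<Sum>j<k. u j) + u k) = push (\<Sum>j<k. u j) + dl \<one>\<^bsub>K\<^esub>"
      using push_linear(1)[OF uC] u by simp
    moreover have "G.pnorm ((\<Sum>j<k. u j) + u k) \<le> G.pnorm (\<Sum>j<k. u j) + G.pnorm (u k)"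
      using u by (intro G.pnorm_add uC) auto
    moreover have "((\<Sum>j<k. u j) + u k) - cv G w ((\<Sum>j<k. u j) + u k)
        = ((\<Sum>j<k. u j) - cv G w (\<Sum>j<k. u j)) + (u k - u (Suc k))"
      unfolding G.cv_add_right uS by simp
    moreover have "G.pnorm (u k) \<le> 1" using u by blast
    ultimately show ?case using Suc by (simp add: sc_distrib sc_simps add.commute del: plus_fun_apply minus_apply)
  qed
  have "cmod b * G.pnorm (\<Sum>j<m. u j) \<le> cmod b * m" using sums[of m] by (intro mult_left_mono) auto
  then have push_\<mu>: "push \<mu> = dl \<one>\<^bsub>K\<^esub>" and norm_\<mu>: "G.pnorm \<mu> \<le> 1"
    using sums[of m] b uC[of m] m(1) by (simp_all add: \<mu>_def push_linear sc_simps G.pnorm_sc mult.commute[of b])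
  have gap: "G.pnorm (\<mu> - cv G w \<mu>) \<le> 2 / m"
  proof -
    \<comment> \<open>The sum telescopes: multiplying the mean of m powers by w only exchanges the
      first power for the m-th.\<close>
    have eq: "\<mu> - cv G w \<mu> = b *\<^sub>c (dl \<one>\<^bsub>G\<^esub> - u m)"
      using sums[of m] by (simp add: \<mu>_def G.cv_sc_right flip: sc_distrib(3))
    have "G.pnorm (dl \<one>\<^bsub>G\<^esub> + (-1) *\<^sub>c u m) \<le> 1 + 1"
      using G.pnorm_add[OF G.one_CG CG_closed(3)[of "u m" G "-1"]] G.pnorm_dl[of "\<one>\<^bsub>G\<^esub>"] u[of m]
      by (simp add: G.pnorm_sc)
    then have le: "G.pnorm (dl \<one>\<^bsub>G\<^esub> - u m) \<le> 2" by (simp add: sc_simps)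
    have d: "dl \<one>\<^bsub>G\<^esub> - u m \<in> CG G" using u by (intro CG_closed G.one_CG) auto
    have "G.pnorm (\<mu> - cv G w \<mu>) = cmod b * G.pnorm (dl \<one>\<^bsub>G\<^esub> - u m)"
      unfolding eq by (rule G.pnorm_sc[OF d])
    also have "\<dots> \<le> cmod b * 2" using le by (intro mult_left_mono) auto
    finally show ?thesis by (simp add: b(2))
  qed
  \<comment> \<open>As \<mu> lifts the unit, the product is another lift of the same element, to
    which the assumed lower bound applies.\<close>
  have "r' \<le> G.pnorm (cv G x \<mu>)"
  proof (rule big)
    have "push (cv G x \<mu>) = cv K (push x) (dl \<one>\<^bsub>K\<^esub>)" by (simp add: push_cv x \<mu> push_\<mu>)
    also have "\<dots> = push x" by (rule K.cv_one) (rule push_closed[OF x])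
    finally show "push (cv G x \<mu>) = push x" .
  qed (intro G.cv_closed x \<mu>)
  then obtain \<phi> where \<phi>: "\<phi> \<in> G.P1" "r < G.nrmf \<phi> (cv G x \<mu>)"
    using G.pnorm_least[of "cv G x \<mu>" r] r by (meson not_le order_trans)
  note pd = G.P1_D(1)[OF \<phi>(1)]
  define c where "c = G.nrmf \<phi> \<mu>"
  have c1: "c \<le> 1" using G.nrmf_le_pnorm[OF \<mu> \<phi>(1)] norm_\<mu> by (simp add: c_def)
  have "r < px * c" using \<phi>(2) G.nrmf_cv[OF pd x \<mu>] by (simp add: c_def px_def)
  \<comment> \<open>This lower bound does not depend on m, although \<phi> and \<mu> do; so
    normalizing the vector functional costs only a fixed factor.\<close>
  then have c0: "c > r / px" using px by (simp add: field_simps)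
  then have cpos: "c > 0" using r px by (smt (verit) divide_pos_pos)
  define \<kappa> where "\<kappa> = 1 / Re (G.tr \<phi> \<mu> \<one>\<^bsub>G\<^esub>)"
  \<comment> \<open>The normalized vector functional at \<mu>. The vector is nearly fixed by w, and
    an average of unitaries nearly fixes a vector only if each of them does.\<close>
  define \<psi> where "\<psi> = (\<lambda>g. of_real \<kappa> * G.tr \<phi> \<mu> g)"
  have t1: "Re (G.tr \<phi> \<mu> \<one>\<^bsub>G\<^esub>) = c\<^sup>2" using G.tr_one[OF \<mu>] G.nrmf_sq[OF pd \<mu>] by (simp add: c_def)
  have \<kappa>: "\<kappa> = 1 / c\<^sup>2" by (simp add: \<kappa>_def t1)
  have \<psi>: "\<psi> \<in> G.P1" unfolding \<psi>_def \<kappa>_def using cpos t1 by (intro G.normalize_P1 G.posdef_tr pd \<mu>) simp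
  have "(G.nrmf \<psi> x)\<^sup>2 = \<kappa> * (G.nrmf \<phi> (cv G x \<mu>))\<^sup>2"
    using G.nrmf_sq[OF G.P1_D(1)[OF \<psi>] x] G.nrmf_sq[OF pd G.cv_closed[OF x \<mu>]] G.fm_tr[OF \<mu> x, of \<phi>]
    unfolding \<psi>_def G.fm_def by (simp add: Lf_fun_sc)
  \<comment> \<open>As c is at most 1, normalization can only increase the value at x.\<close>
  moreover have "1 * (G.nrmf \<phi> (cv G x \<mu>))\<^sup>2 \<le> \<kappa> * (G.nrmf \<phi> (cv G x \<mu>))\<^sup>2"
    using c1 cpos by (intro mult_right_mono) (simp_all add: \<kappa> power_le_one)
  moreover have "r\<^sup>2 \<le> (G.nrmf \<phi> (cv G x \<mu>))\<^sup>2" using \<phi>(2) r by (intro power_mono) auto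
  ultimately have "r \<le> G.nrmf \<psi> x"
    using G.nrmf_nonneg[OF G.P1_D(1)[OF \<psi>] x] by (intro power2_le_imp_le[of r "G.nrmf \<psi> x"]) linarith
  moreover have "Re (1 - \<psi> t) \<le> \<epsilon>" if t: "t \<in> T" for t
  proof -
    have nn: "0 \<le> Re (1 - \<psi> s)" for s
      using G.P1_bound[OF \<psi>, of s] complex_Re_le_cmod[of "\<psi> s"] by simp
    \<comment> \<open>All defects are nonnegative, so a bound for their sum, which is expressed by
      the average w, bounds each one.\<close>
    have "Re (1 - \<psi> t) \<le> (\<Sum>s\<in>T. Re (1 - \<psi> s))" using t T(1) nn by (intro member_le_sum) auto
    also have "\<dots> = card T - Re (\<Sum>s\<in>T. \<psi> s)" by (simp add: sum_subtractf)
    also have "(\<Sum>s\<in>T. \<psi> s) = of_nat (card T) * Lf \<psi> w"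
    proof -
      have "Lf \<psi> (\<Sum>s\<in>T'. dl s) = (\<Sum>s\<in>T'. \<psi> s)" if "T' \<subseteq> T" for T'
        using finite_subset[OF that T(1)] that
      proof (induction T' rule: finite_induct)
        case (insert t F)
        then show ?case using TG sT[of F] by (simp add: Lf_add[where G = G] Lf_dl dl_CG del: plus_fun_apply)
      qed (simp add: Lf_zero del: zero_fun_apply)
      then show ?thesis using a(1) sT by (simp add: w_def Lf_sc[where G = G] mult.assoc[symmetric])
    qed
    also have "Lf \<psi> w = of_real (1 / c\<^sup>2) * G.fm \<phi> (cv G w \<mu>) \<mu>"
      unfolding \<psi>_def \<kappa>[symmetric] by (simp add: Lf_fun_sc G.Lf_tr \<mu> w)
    also have "G.fm \<phi> (cv G w \<mu>) \<mu> = of_real (c\<^sup>2) - G.fm \<phi> (\<mu> - cv G w \<mu>) \<mu>"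
    proof -
      have "\<mu> - cv G w \<mu> = \<mu> + (-1) *\<^sub>c cv G w \<mu>" by (simp add: sc_simps)
      then have "G.fm \<phi> (\<mu> - cv G w \<mu>) \<mu> = G.fm \<phi> (\<mu> + (-1) *\<^sub>c cv G w \<mu>) \<mu>" by (rule arg_cong)
      also have "\<dots> = G.fm \<phi> \<mu> \<mu> - G.fm \<phi> (cv G w \<mu>) \<mu>"
        using \<mu> w by (simp add: G.fm_linear G.cv_closed CG_closed del: plus_fun_apply)
      finally show ?thesis using G.fm_self[OF pd \<mu>] by (simp add: c_def)
    qed
    also have "card T - Re (of_nat (card T) * (of_real (1 / c\<^sup>2) * (of_real (c\<^sup>2) - G.fm \<phi> (\<mu> - cv G w \<mu>) \<mu>)))
        = card T * (Re (G.fm \<phi> (\<mu> - cv G w \<mu>) \<mu>) / c\<^sup>2)"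
      using cpos by (simp add: field_simps)
    also have "\<dots> \<le> card T * (2 / m * c / c\<^sup>2)"
    proof (intro mult_left_mono divide_right_mono)
      have d: "\<mu> - cv G w \<mu> \<in> CG G" by (intro CG_closed \<mu> G.cv_closed w)
      have "Re (G.fm \<phi> (\<mu> - cv G w \<mu>) \<mu>) \<le> G.nrmf \<phi> (\<mu> - cv G w \<mu>) * c"
        using G.fm_cauchy_schwarz[OF pd d \<mu>] complex_Re_le_cmod[of "G.fm \<phi> (\<mu> - cv G w \<mu>) \<mu>"] by (simp add: c_def)
      also have "\<dots> \<le> 2 / m * c"
        using G.nrmf_le_pnorm[OF d \<phi>(1)] gap cpos by (intro mult_right_mono) auto
      finally show "Re (G.fm \<phi> (\<mu> - cv G w \<mu>) \<mu>) \<le> 2 / m * c" .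
    qed auto
    also have "\<dots> = card T * (2 / (m * c))" using cpos by (simp add: power2_eq_square)
    also have "\<dots> \<le> card T * (2 / (m * (r / px)))"
      using c0 cpos m(1) r px by (intro mult_left_mono divide_left_mono mult_pos_pos) auto
    also have "\<dots> \<le> \<epsilon>" using m r px \<epsilon> by (simp add: field_simps)
    finally show ?thesis .
  qed
  ultimately show ?thesis using \<psi> by blast
qed

text \<open>The norm of the quotient group's algebra is the quotient norm. If all lifts of an
  element were too large, the functions from \<open>almost_invariant_state\<close> and compactness
  would give a normalized positive definite function that is 1 on the whole kernel and large at x.
  It descends to the quotient group and contradicts the norm there.\<close>

lemma approximate_lift:
  assumes x: "x \<in> CG G" and r': "K.pnorm (push x) < r'"
  shows "\<exists>y\<in>CG G. push y = push x \<and> G.pnorm y < r'"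
proof (rule ccontr)
  assume "\<not> ?thesis"
  then have big: "\<And>y. y \<in> CG G \<Longrightarrow> push y = push x \<Longrightarrow> r' \<le> G.pnorm y" by force
  define r where "r = (K.pnorm (push x) + r') / 2"
  have r: "0 < r" "r < r'" "K.pnorm (push x) < r"
    using r' K.pnorm_nonneg[OF push_closed[OF x]] by (auto simp: r_def)
  \<comment> \<open>Being 1 at t is split into countably many approximate conditions, because for
    finitely many of them only approximate solutions are available.\<close>
  define F where "F = (\<lambda>(t, n). {\<psi> :: 'a \<Rightarrow> complex. Re (1 - \<psi> t) \<le> inverse (real (Suc n))})"
  define S where "S = G.P1 \<inter> {\<psi>. r \<le> G.nrmf \<psi> x}"
  have "compact S" unfolding S_def G.nrmf_def G.fm_def
    by (intro compact_Int_closed G.compact_P1 closed_Collect_le continuous_intros continuous_on_Lf)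
  then have "S \<inter> \<Inter>(F ` (kernel G K q \<times> UNIV)) \<noteq> {}"
  proof (rule compact_imp_fip)
    show "closed B" if "B \<in> F ` (kernel G K q \<times> UNIV)" for B
      using that by (auto simp: F_def intro!: closed_Collect_le continuous_intros continuous_on_coordinate)
    fix \<F> assume "finite \<F>" "\<F> \<subseteq> F ` (kernel G K q \<times> UNIV)"
    then obtain Z where Z: "Z \<subseteq> kernel G K q \<times> UNIV" "finite Z" "\<F> = F ` Z" by (meson finite_subset_image)
    \<comment> \<open>The unit is inserted to keep the averaging set nonempty when no conditions are
      imposed.\<close>
    define T where "T = insert \<one>\<^bsub>G\<^esub> (fst ` Z)"
    define \<epsilon> where "\<epsilon> = Min (insert 1 ((\<lambda>z. inverse (real (Suc (snd z)))) ` Z))"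
    have T: "finite T" "T \<noteq> {}" "T \<subseteq> kernel G K q" using Z by (auto simp: T_def kernel_def)
    have \<epsilon>: "\<epsilon> > 0" unfolding \<epsilon>_def using Z(2) by (subst Min_gr_iff) auto
    obtain \<psi> where \<psi>: "\<psi> \<in> G.P1" "r \<le> G.nrmf \<psi> x" "\<forall>t\<in>T. Re (1 - \<psi> t) \<le> \<epsilon>"
      using almost_invariant_state[OF T \<epsilon> x r(1,2) big] by blast
    have "\<psi> \<in> F z" if z: "z \<in> Z" for z
    proof -
      have "\<epsilon> \<le> inverse (real (Suc (snd z)))" unfolding \<epsilon>_def using z Z(2) by (intro Min_le) auto
      moreover have "Re (1 - \<psi> (fst z)) \<le> \<epsilon>" using \<psi>(3) z by (auto simp: T_def)
      ultimately show ?thesis by (simp add: F_def case_prod_beta)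
    qed
    then show "S \<inter> \<Inter>\<F> \<noteq> {}" using \<psi> Z(3) by (auto simp: S_def)
  qed
  then obtain \<psi> where \<psi>: "\<psi> \<in> G.P1" "r \<le> G.nrmf \<psi> x" and F: "\<And>t n. t \<in> kernel G K q \<Longrightarrow> \<psi> \<in> F (t, n)"
    by (auto simp: S_def)
  have "\<psi> t = 1" if t: "t \<in> kernel G K q" for t
  proof -
    have "Re (1 - \<psi> t) \<le> 0"
      by (rule LIMSEQ_le_const[OF LIMSEQ_inverse_real_of_nat]) (use F[OF t] in \<open>auto simp: F_def\<close>)
    \<comment> \<open>The only point of the closed unit disc with real part at least 1 is 1.\<close>
    then have re: "Re (\<psi> t) \<ge> 1" by simp
    have "(cmod (\<psi> t))\<^sup>2 \<le> 1" using G.P1_bound[OF \<psi>(1), of t] by (simp add: power_le_one)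
    then have "(Re (\<psi> t))\<^sup>2 + (Im (\<psi> t))\<^sup>2 \<le> 1" by (simp add: cmod_power2)
    moreover have "(Re (\<psi> t))\<^sup>2 \<ge> 1" using re by simp
    ultimately have "(Im (\<psi> t))\<^sup>2 \<le> 0" by linarith
    moreover have "Re (\<psi> t) \<le> 1" using G.P1_bound[OF \<psi>(1), of t] complex_Re_le_cmod[of "\<psi> t"] by linarith
    ultimately show ?thesis using re by (simp add: complex_eq_iff)
  qed
  then obtain \<phi> where \<phi>: "\<phi> \<in> K.P1" "pull \<phi> = \<psi>" using descend_P1[OF \<psi>(1)] by blast
  have "G.nrmf \<psi> x = K.nrmf \<phi> (push x)" by (simp add: nrmf_push x \<phi>(2))
  also have "\<dots> \<le> K.pnorm (push x)" by (intro K.nrmf_le_pnorm push_closed x \<phi>(1))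
  finally show False using \<psi>(2) r(3) by simp
qed

lemma contractive_push: "contractive_star_hom (group_algebra G) (group_algebra K) push"
  by (intro contractive_star_hom.intro star_hom.intro contractive_star_hom_axioms.intro star_hom_axioms.intro
      G.cstar_seminorm_group_algebra K.cstar_seminorm_group_algebra
      G.star_algebra_group_algebra K.star_algebra_group_algebra)
    (auto simp: G.group_algebra_simps K.group_algebra_simps push_closed push_linear push_cv push_adj
      G.full_norm_eq K.full_norm_eq pnorm_push)

sublocale E: contractive_star_hom "group_algebra G" "group_algebra K" push
  by (rule contractive_push)

lemma ext_push_surj:
  assumes "Y \<in> carrier (full_group_cstar K)" shows "\<exists>X\<in>carrier (full_group_cstar G). E.ext X = Y"
proof (rule E.ext_surj[folded full_group_cstar_def, OF _ assms])
  fix d r assume d: "d \<in> carrier (group_algebra K)" and r: "cnorm (group_algebra K) d < r"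
  have dK: "d \<in> CG K" using d by (simp add: K.group_algebra_simps)
  then obtain x where x: "x \<in> CG G" "push x = d" using push_surj by blast
  have "K.pnorm (push x) < r" using r dK x by (simp add: K.group_algebra_simps K.full_norm_eq)
  then obtain y where "y \<in> CG G" "push y = d" "G.pnorm y < r" using approximate_lift[OF x(1)] x(2) by blast
  then show "\<exists>x\<in>carrier (group_algebra G). push x = d \<and> cnorm (group_algebra G) x < r"
    by (auto simp: G.group_algebra_simps G.full_norm_eq)
qed

end

section \<open>States on the full group C*-algebra\<close>

context group
begin

definition U :: "'a \<Rightarrow> (nat \<Rightarrow> 'a \<Rightarrow> complex) set" where
  "U g = null_sequences (group_algebra G) +>\<^bsub>cauchy_algebra (group_algebra G)\<^esub> (\<lambda>_. dl g)"

text \<open>The extension by continuity of the functional of \<phi>; by \<open>state_lim\<close> any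
  representing sequence may be used instead of the chosen one.\<close>

definition state :: "('a \<Rightarrow> complex) \<Rightarrow> (nat \<Rightarrow> 'a \<Rightarrow> complex) set \<Rightarrow> complex" where
  "state \<phi> X = lim (\<lambda>n. Lf \<phi> ((SOME s. s \<in> X) n))"

text \<open>The canonical trace as the characteristic function of the trivial subgroup, in the form
  to which \<open>P1_subgroup\<close> applies.\<close>

definition trace :: "'a \<Rightarrow> complex" where
  "trace = (\<lambda>g. if g \<in> {\<one>} then 1 else 0)"

lemma trace_P1: "trace \<in> P1"
  unfolding trace_def by (rule P1_subgroup[OF triv_subgroup])

interpretation GA: cstar_seminorm "group_algebra G"
  by (rule cstar_seminorm_group_algebra)

lemma GA_minus: "\<lbrakk>x \<in> CG G; y \<in> CG G\<rbrakk> \<Longrightarrow> x \<ominus>\<^bsub>group_algebra G\<^esub> y = x - y"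
  by (simp add: GA.A.minus_eq group_algebra_simps sc_simps flip: GA.smult_minus_one)

lemma U_cl: "U g = GA.cl (\<lambda>_. dl g)"
  by (simp add: U_def GA.cl_def)

lemma cs_dl: "g \<in> carrier G \<Longrightarrow> GA.cs (\<lambda>_. dl g)"
  by (simp add: GA.cs_const group_algebra_simps dl_CG)

lemma cs_CG: "GA.cs s \<Longrightarrow> s n \<in> CG G"
  using GA.cs_in[of s n] by (simp add: group_algebra_simps)

lemma U_closed: "g \<in> carrier G \<Longrightarrow> U g \<in> carrier (full_group_cstar G)"
  by (simp add: U_cl full_group_cstar_def GA.cl_closed cs_dl)

lemma U_mult: "\<lbrakk>g \<in> carrier G; h \<in> carrier G\<rbrakk> \<Longrightarrow> U g \<otimes>\<^bsub>full_group_cstar G\<^esub> U h = U (g \<otimes> h)"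
  by (simp add: U_cl full_group_cstar_def GA.cl_ops cs_dl group_algebra_simps cv_dl)

lemma U_star: "g \<in> carrier G \<Longrightarrow> star (full_group_cstar G) (U g) = U (inv g)"
  by (simp add: U_cl full_group_cstar_def GA.cl_ops cs_dl group_algebra_simps adj_dl)

lemma U_one: "U \<one> = \<one>\<^bsub>full_group_cstar G\<^esub>"
  by (simp add: U_cl full_group_cstar_def GA.cl_ops group_algebra_simps)

lemma U_norm: "g \<in> carrier G \<Longrightarrow> cnorm (full_group_cstar G) (U g) \<le> 1"
  by (simp add: U_cl full_group_cstar_def GA.norm_cl_const group_algebra_simps dl_CG full_norm_eq pnorm_dl)

text \<open>The functional of a normalized \<phi> is bounded by the norm of the algebra. Hence it
  maps Cauchy sequences to convergent ones and null sequences to null ones.\<close>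

lemma state_lim:
  assumes \<phi>: "\<phi> \<in> P1" and s: "GA.cs s"
  shows "(\<lambda>n. Lf \<phi> (s n)) \<longlonglongrightarrow> state \<phi> (GA.cl s)"
proof -
  have le: "cmod (Lf \<phi> x) \<le> cnorm (group_algebra G) x" if "x \<in> CG G" for x
    using Lf_bound[OF \<phi> that] nrmf_le_pnorm[OF that \<phi>] that by (simp add: group_algebra_simps full_norm_eq)
  have conv: "convergent (\<lambda>n. Lf \<phi> (t n))" if t: "GA.cs t" for t
  proof (rule Cauchy_convergent, rule metric_CauchyI)
    fix e :: real assume "e > 0"
    then obtain N where N: "\<forall>m\<ge>N. \<forall>n\<ge>N. cnorm (group_algebra G) (t m \<ominus>\<^bsub>group_algebra G\<^esub> t n) < e"
      using GA.csD[OF t] by blast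
    have "dist (Lf \<phi> (t m)) (Lf \<phi> (t n)) < e" if "m \<ge> N" "n \<ge> N" for m n
    proof -
      have "dist (Lf \<phi> (t m)) (Lf \<phi> (t n)) = cmod (Lf \<phi> (t m - t n))"
        using cs_CG[OF t] by (simp add: dist_norm Lf_diff[where G = G])
      also have "\<dots> \<le> cnorm (group_algebra G) (t m - t n)" using cs_CG[OF t] by (intro le CG_closed)
      also have "\<dots> < e" using N that cs_CG[OF t] by (simp add: GA_minus)
      finally show ?thesis .
    qed
    then show "\<exists>M. \<forall>m\<ge>M. \<forall>n\<ge>M. dist (Lf \<phi> (t m)) (Lf \<phi> (t n)) < e" by blast
  qed
  define t where "t = (SOME t. t \<in> GA.cl s)"
  have t: "t \<in> GA.cl s" unfolding t_def by (rule someI[of "\<lambda>t. t \<in> GA.cl s", OF GA.cl_self[OF s]])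
  obtain h where h: "h \<in> GA.N" "t = h \<oplus>\<^bsub>GA.C\<^esub> s" using t by (auto simp: GA.cl_def GA.CN.mem_coset)
  have ct: "GA.cs t" unfolding h(2) GA.C_simps by (intro GA.cs_add GA.N_cs h(1) s)
  have hC: "h n \<in> CG G" for n using cs_CG[OF GA.N_cs[OF h(1)]] .
  have "(\<lambda>n. cnorm (group_algebra G) (h n)) \<longlonglongrightarrow> 0" using h(1) by (simp add: GA.N_iff)
  then have "(\<lambda>n. Lf \<phi> (h n)) \<longlonglongrightarrow> 0"
    by (rule Lim_null_comparison[rotated]) (use le hC in auto)
  moreover have "(\<lambda>n. Lf \<phi> (t n)) \<longlonglongrightarrow> state \<phi> (GA.cl s)"
    using conv[OF ct] unfolding state_def t_def[symmetric] by (simp add: convergent_LIMSEQ_iff)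
  moreover have "Lf \<phi> (t n) = Lf \<phi> (h n) + Lf \<phi> (s n)" for n
    using hC cs_CG[OF s] by (simp add: h(2) GA.C_simps group_algebra_simps Lf_add[where G = G])
  ultimately show ?thesis using tendsto_diff[of "\<lambda>n. Lf \<phi> (t n)" _ sequentially "\<lambda>n. Lf \<phi> (h n)" 0] by simp
qed

lemma full_obtain: assumes "X \<in> carrier (full_group_cstar G)" obtains s where "GA.cs s" "X = GA.cl s"
  using assms unfolding full_group_cstar_def by (rule GA.Cp_obtain)

lemma state_linear:
  assumes \<phi>: "\<phi> \<in> P1" and X: "X \<in> carrier (full_group_cstar G)"
  shows "Y \<in> carrier (full_group_cstar G) \<Longrightarrow> state \<phi> (X \<oplus>\<^bsub>full_group_cstar G\<^esub> Y) = state \<phi> X + state \<phi> Y"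
    and "state \<phi> (c \<odot>\<^bsub>full_group_cstar G\<^esub> X) = c * state \<phi> X"
    and "cmod (state \<phi> X) \<le> cnorm (full_group_cstar G) X"
    and "Im (state \<phi> (star (full_group_cstar G) X \<otimes>\<^bsub>full_group_cstar G\<^esub> X)) = 0"
    and "0 \<le> Re (state \<phi> (star (full_group_cstar G) X \<otimes>\<^bsub>full_group_cstar G\<^esub> X))"
proof -
  obtain s where s: "GA.cs s" "X = GA.cl s" using X by (rule full_obtain)
  note S = state_lim[OF \<phi> s(1)] and sC = cs_CG[OF s(1)]
  show "state \<phi> (X \<oplus>\<^bsub>full_group_cstar G\<^esub> Y) = state \<phi> X + state \<phi> Y"
    if Y: "Y \<in> carrier (full_group_cstar G)"
  proof -
    obtain t where t: "GA.cs t" "Y = GA.cl t" using Y by (rule full_obtain)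
    have "(\<lambda>n. Lf \<phi> (s n) + Lf \<phi> (t n)) \<longlonglongrightarrow> state \<phi> (X \<oplus>\<^bsub>full_group_cstar G\<^esub> Y)"
      using state_lim[OF \<phi> GA.cs_add[OF s(1) t(1)]] s t sC cs_CG[OF t(1)]
      by (simp add: full_group_cstar_def GA.cl_ops group_algebra_simps Lf_add[where G = G])
    then show ?thesis using tendsto_add[OF S state_lim[OF \<phi> t(1)]] s(2) t(2) LIMSEQ_unique by blast
  qed
  have "(\<lambda>n. c * Lf \<phi> (s n)) \<longlonglongrightarrow> state \<phi> (c \<odot>\<^bsub>full_group_cstar G\<^esub> X)"
    using state_lim[OF \<phi> GA.cs_smult[OF s(1), of c]] s sC
    by (simp add: full_group_cstar_def GA.cl_ops group_algebra_simps Lf_sc[where G = G])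
  then show "state \<phi> (c \<odot>\<^bsub>full_group_cstar G\<^esub> X) = c * state \<phi> X"
    using tendsto_mult_left[OF S, of c] s(2) LIMSEQ_unique by blast
  show "cmod (state \<phi> X) \<le> cnorm (full_group_cstar G) X"
    unfolding s(2) full_group_cstar_def
    by (rule LIMSEQ_le[OF tendsto_norm[OF S] GA.norm_lim[OF s(1)]])
      (use sC order_trans[OF Lf_bound[OF \<phi> sC] nrmf_le_pnorm[OF sC \<phi>]] in
        \<open>auto simp: group_algebra_simps full_norm_eq\<close>)
  have cst: "GA.cs (\<lambda>n. adj G (s n))" using GA.cs_star[OF s(1)] by (simp add: group_algebra_simps)
  have P: "(\<lambda>n. fm \<phi> (s n) (s n)) \<longlonglongrightarrow> state \<phi> (star (full_group_cstar G) X \<otimes>\<^bsub>full_group_cstar G\<^esub> X)"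
    using state_lim[OF \<phi> GA.cs_mult[OF GA.cs_star s(1)], OF s(1)] s
    by (simp add: full_group_cstar_def GA.cl_ops cst group_algebra_simps fm_def)
  have pos: "Im (fm \<phi> (s n) (s n)) = 0" "0 \<le> Re (fm \<phi> (s n) (s n))" for n
    using P1_D(1)[OF \<phi>] sC by (auto simp: posdef_def)
  show "Im (state \<phi> (star (full_group_cstar G) X \<otimes>\<^bsub>full_group_cstar G\<^esub> X)) = 0"
    using tendsto_Im[OF P] pos by (simp add: LIMSEQ_const_iff)
  show "0 \<le> Re (state \<phi> (star (full_group_cstar G) X \<otimes>\<^bsub>full_group_cstar G\<^esub> X))"
    by (rule LIMSEQ_le_const[OF tendsto_Re[OF P]]) (use pos in auto)
qed

lemma state_U: "\<phi> \<in> P1 \<Longrightarrow> g \<in> carrier G \<Longrightarrow> state \<phi> (U g) = \<phi> g"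
  using state_lim[OF _ cs_dl, of \<phi> g] by (simp add: U_cl Lf_dl LIMSEQ_const_iff)

text \<open>On group elements this says that g h = 1 exactly if h g = 1; linearity and passage to
  the limit extend it. One factor being a group unitary is enough for the twisting below.\<close>

lemma trace_commute:
  assumes g: "g \<in> carrier G" and X: "X \<in> carrier (full_group_cstar G)"
  shows "state trace (X \<otimes>\<^bsub>full_group_cstar G\<^esub> U g) = state trace (U g \<otimes>\<^bsub>full_group_cstar G\<^esub> X)"
proof -
  have comm: "Lf trace (cv G x (dl g)) = Lf trace (cv G (dl g) x)" if "x \<in> CG G" for x
    using that
  proof (induction rule: CG_induct)
    case (add c h x)
    have "trace (h \<otimes> g) = trace (g \<otimes> h)"
      using g add.hyps(1) by (auto simp: trace_def) (metis inv_comm)+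
    then show ?case using g add
      by (simp add: cv_bilinear Lf_add[where G = G] Lf_sc[where G = G] CG_closed cv_closed dl_CG cv_dl Lf_dl
          del: plus_fun_apply)
  qed (simp add: cv_zero del: zero_fun_apply)
  obtain s where s: "GA.cs s" "X = GA.cl s" using X by (rule full_obtain)
  have "(\<lambda>n. Lf trace (cv G (s n) (dl g))) \<longlonglongrightarrow> state trace (X \<otimes>\<^bsub>full_group_cstar G\<^esub> U g)"
    using state_lim[OF trace_P1 GA.cs_mult[OF s(1) cs_dl[OF g]]] s(1) g
    by (simp add: s(2) U_cl full_group_cstar_def GA.cl_ops cs_dl group_algebra_simps)
  moreover have "(\<lambda>n. Lf trace (cv G (dl g) (s n))) \<longlonglongrightarrow> state trace (U g \<otimes>\<^bsub>full_group_cstar G\<^esub> X)"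
    using state_lim[OF trace_P1 GA.cs_mult[OF cs_dl[OF g] s(1)]] s(1) g
    by (simp add: s(2) U_cl full_group_cstar_def GA.cl_ops cs_dl group_algebra_simps)
  ultimately show ?thesis using comm cs_CG[OF s(1)] by (simp add: LIMSEQ_unique)
qed

lemma full_seminorm: "cstar_seminorm (full_group_cstar G)"
  unfolding full_group_cstar_def by (rule GA.cstar_seminorm_Cp)

text \<open>Combinations of group elements with coefficients from a countable dense set, encoded by
  finite lists, are dense in the group algebra, and the group algebra is dense in its
  completion.\<close>

lemma full_separable:
  assumes "countable (carrier G)"
  obtains D where "countable D" "D \<subseteq> carrier (full_group_cstar G)"
    "\<And>X e. X \<in> carrier (full_group_cstar G) \<Longrightarrow> e > 0 \<Longrightarrow>
      \<exists>Y\<in>D. cnorm (full_group_cstar G) (X \<ominus>\<^bsub>full_group_cstar G\<^esub> Y) < e"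
proof -
  obtain B :: "complex set" where B: "countable B" "\<And>V. open V \<Longrightarrow> V \<noteq> {} \<Longrightarrow> \<exists>d\<in>B. d \<in> V"
    using countable_dense_exists[where 'a = complex] by blast
  define comb :: "(complex \<times> 'a) list \<Rightarrow> 'a \<Rightarrow> complex" where
    "comb l = foldr (\<lambda>(c, g) x. c *\<^sub>c dl g + x) l 0" for l
  define R where "R = comb ` lists (B \<times> carrier G)"
  have cR: "countable R" unfolding R_def using B(1) assms by (intro countable_image countable_lists countable_SIGMA) auto
  have RC: "comb l \<in> CG G" if "l \<in> lists (B \<times> carrier G)" for l
    using that unfolding comb_def
    by (induction l) (auto intro!: CG_closed dl_CG simp del: plus_fun_apply zero_fun_apply)
  have dense: "\<exists>l\<in>lists (B \<times> carrier G). pnorm (x - comb l) < e" if "x \<in> CG G" "e > 0" for x e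
    using that
  proof (induction arbitrary: e rule: CG_induct)
    case zero
    then show ?case by (intro bexI[of _ "[]"]) (auto simp: comb_def pnorm_zero simp del: zero_fun_apply)
  next
    case (add c g x)
    obtain l where l: "l \<in> lists (B \<times> carrier G)" "pnorm (x - comb l) < e / 2"
      using add.IH[of "e / 2"] add.prems by (auto simp del: minus_apply)
    obtain d where d: "d \<in> B" "d \<in> ball c (e / 2)" using B(2)[of "ball c (e / 2)"] add.prems by auto
    have eq: "(c *\<^sub>c dl g + x) - comb ((d, g) # l) = (c - d) *\<^sub>c dl g + (x - comb l)"
      by (simp add: comb_def sc_def fun_eq_iff algebra_simps)
    have le: "pnorm ((c - d) *\<^sub>c dl g + (x - comb l)) \<le> pnorm ((c - d) *\<^sub>c dl g) + pnorm (x - comb l)"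
      using add.hyps RC[OF l(1)] by (intro pnorm_add CG_closed dl_CG)
    have small: "pnorm ((c - d) *\<^sub>c dl g) < e / 2"
    proof -
      have "pnorm ((c - d) *\<^sub>c dl g) = cmod (c - d) * pnorm (dl g)" using add.hyps by (simp add: pnorm_sc dl_CG)
      also have "\<dots> \<le> cmod (c - d) * 1" using add.hyps by (intro mult_left_mono pnorm_dl) auto
      also have "\<dots> < e / 2" using d(2) by (simp add: dist_norm)
      finally show ?thesis .
    qed
    have "pnorm ((c - d) *\<^sub>c dl g) + pnorm (x - comb l) < e / 2 + e / 2"
      by (rule add_strict_mono[OF small l(2)])
    from le_less_trans[OF le this] have lt: "pnorm ((c *\<^sub>c dl g + x) - comb ((d, g) # l)) < e"
      unfolding eq by simp
    show ?case
    proof (rule bexI)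
      show "pnorm ((c *\<^sub>c dl g + x) - comb ((d, g) # l)) < e" by (rule lt)
      show "(d, g) # l \<in> lists (B \<times> carrier G)" using l(1) d(1) add.hyps(1) by simp
    qed
  qed
  define D where "D = (\<lambda>x. GA.cl (\<lambda>_. x)) ` R"
  interpret F: cstar_seminorm "full_group_cstar G" by (rule full_seminorm)
  have cs_R: "GA.cs (\<lambda>_. x)" if "x \<in> R" for x
  proof -
    have "x \<in> CG G" using that RC unfolding R_def by blast
    then show ?thesis by (simp add: GA.cs_const group_algebra_simps)
  qed
  have DC: "D \<subseteq> carrier (full_group_cstar G)"
    unfolding D_def full_group_cstar_def using cs_R GA.cl_closed by blast
  show thesis
  proof (rule that[OF _ DC])
    show "countable D" unfolding D_def using cR by simp
    fix X e assume X: "X \<in> carrier (full_group_cstar G)" and e: "(e :: real) > 0"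
    obtain s where s: "GA.cs s" "X = GA.cl s" using X by (rule full_obtain)
    have "(\<lambda>n. cnorm (full_group_cstar G) (GA.cl (\<lambda>_. s n) \<ominus>\<^bsub>full_group_cstar G\<^esub> X)) \<longlonglongrightarrow> 0"
      using GA.cl_tendsto[OF s(1)] by (simp add: full_group_cstar_def s(2))
    from LIMSEQ_D[OF this, of "e / 2"] obtain n
      where "norm (cnorm (full_group_cstar G) (GA.cl (\<lambda>_. s n) \<ominus>\<^bsub>full_group_cstar G\<^esub> X) - 0) < e / 2"
      using e by auto
    then have n: "cnorm (full_group_cstar G) (GA.cl (\<lambda>_. s n) \<ominus>\<^bsub>full_group_cstar G\<^esub> X) < e / 2" by simp
    obtain l where l: "l \<in> lists (B \<times> carrier G)" "pnorm (s n - comb l) < e / 2"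
      using dense[OF cs_CG[OF s(1)], of "e / 2"] e by auto
    have lR: "comb l \<in> R" using l(1) by (simp add: R_def)
    define S Y where "S = GA.cl (\<lambda>_. s n)" and "Y = GA.cl (\<lambda>_. comb l)"
    have SY: "S \<in> carrier (full_group_cstar G)" "Y \<in> carrier (full_group_cstar G)" "Y \<in> D"
      using cs_R[OF lR] lR GA.cs_const[OF GA.cs_in[OF s(1)], of n]
      by (auto simp: S_def Y_def D_def full_group_cstar_def GA.cl_closed)
    have "cnorm (full_group_cstar G) (S \<ominus>\<^bsub>full_group_cstar G\<^esub> Y) = pnorm (s n - comb l)"
      unfolding S_def Y_def full_group_cstar_def
      using cs_R[OF lR] GA.cs_const[OF GA.cs_in[OF s(1)], of n] cs_CG[OF s(1), of n] RC[OF l(1)]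
      by (simp add: GA.cl_ops GA_minus GA.norm_cl_const group_algebra_simps CG_closed full_norm_eq)
    then have "cnorm (full_group_cstar G) (X \<ominus>\<^bsub>full_group_cstar G\<^esub> Y) < e"
      using F.sn_triangle[OF X SY(1,2)] n l(2) F.sn_minus_commute[OF X SY(1)] by (simp add: S_def)
    then show "\<exists>Y\<in>D. cnorm (full_group_cstar G) (X \<ominus>\<^bsub>full_group_cstar G\<^esub> Y) < e" using SY(3) by blast
  qed
qed

end

section \<open>The comparison function of two quotients\<close>

lemma (in star_algebra) functional_finsum:
  fixes L :: "'a \<Rightarrow> complex"
  assumes L: "\<And>X Y. \<lbrakk>X \<in> carrier A; Y \<in> carrier A\<rbrakk> \<Longrightarrow> L (X \<oplus> Y) = L X + L Y"
    and S: "finite S" "\<And>i. i \<in> S \<Longrightarrow> g i \<in> carrier A"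
  shows "L (finsum A g S) = (\<Sum>i\<in>S. L (g i))"
proof -
  have "L (\<zero> \<oplus> \<zero>) = L \<zero> + L \<zero>" by (rule L) simp_all
  then have L0: "L \<zero> = 0" by simp
  show ?thesis using S
  proof (induction S rule: finite_induct)
    case empty
    show ?case by (simp add: L0)
  next
    case (insert x F)
    then have "finsum A g (insert x F) = g x \<oplus> finsum A g F" "finsum A g F \<in> carrier A"
      by (auto intro!: A.finsum_insert A.finsum_closed)
    then show ?case using insert by (simp add: L)
  qed
qed

text \<open>Two quotients \<open>K1\<close> and \<open>K2\<close> of \<open>G\<close> and a unital completely positive map \<open>\<sigma>\<close> from the C*-algebra of \<open>K2\<close> to
  that of \<open>G\<close>. Composing \<open>\<sigma>\<close> with the quotient map onto the C*-algebra of \<open>K1\<close> and twisting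
  with the unitaries of \<open>K1\<close> gives a positive definite function on \<open>G\<close>.\<close>

locale two_quotients = Q1: quotient_map G K1 q1 + Q2: quotient_map G K2 q2
  for G :: "('a, 'm) monoid_scheme" and K1 :: "('b, 'n) monoid_scheme" and q1
    and K2 :: "('c, 'k) monoid_scheme" and q2 +
  fixes \<sigma>
  assumes \<sigma>: "unital_cp (full_group_cstar K2) (full_group_cstar G) \<sigma>"
begin

abbreviation C0 where "C0 \<equiv> full_group_cstar G"
abbreviation C1 where "C1 \<equiv> full_group_cstar K1"
abbreviation C2 where "C2 \<equiv> full_group_cstar K2"

definition F :: "'a \<Rightarrow> complex" where
  "F g = (if g \<in> carrier G then
     Q1.K.state Q1.K.trace (Q1.E.ext (\<sigma> (Q2.K.U (q2 g))) \<otimes>\<^bsub>C1\<^esub> Q1.K.U (q1 (inv\<^bsub>G\<^esub> g))) else 0)"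

lemma ext_hom: "star_hom C0 C1 Q1.E.ext"
  unfolding full_group_cstar_def by (rule Q1.E.star_hom_ext)

lemma \<sigma>_props: "X \<in> carrier C2 \<Longrightarrow> \<sigma> X \<in> carrier C0" "\<sigma> \<one>\<^bsub>C2\<^esub> = \<one>\<^bsub>C0\<^esub>"
  "positive_matrix C2 n a \<Longrightarrow> positive_matrix C0 n (\<lambda>i j. \<sigma> (a i j))"
  using \<sigma> by (auto simp: unital_cp_def completely_positive_def complex_linear_def)

text \<open>The matrix is the product of the adjoint of a row of unitaries with that row. Since
  \<open>positive_matrix\<close> asks for a square factor, the row is padded with zeros
  below.\<close>

lemma unitary_matrix_positive:
  assumes e: "\<And>i. i < n \<Longrightarrow> e i \<in> carrier G"
  shows "positive_matrix C2 n (\<lambda>i j. Q2.K.U (q2 (inv\<^bsub>G\<^esub> (e i) \<otimes>\<^bsub>G\<^esub> e j)))"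
proof -
  interpret S2: cstar_seminorm C2 by (rule Q2.K.full_seminorm)
  define x where "x k j = (if k = 0 then Q2.K.U (q2 (e j)) else \<zero>\<^bsub>C2\<^esub>)" for k j :: nat
  have xc: "x k j \<in> carrier C2" if "j < n" for k j
    using e that by (simp add: x_def Q2.K.U_closed Q2.q_closed)
  have "Q2.K.U (q2 (inv\<^bsub>G\<^esub> (e i) \<otimes>\<^bsub>G\<^esub> e j)) = (\<Oplus>\<^bsub>C2\<^esub>k\<in>{..<n}. star C2 (x k i) \<otimes>\<^bsub>C2\<^esub> x k j)"
    if ij: "i < n" "j < n" for i j
  proof -
    have "Q2.K.U (q2 (inv\<^bsub>G\<^esub> (e i) \<otimes>\<^bsub>G\<^esub> e j)) = star C2 (x 0 i) \<otimes>\<^bsub>C2\<^esub> x 0 j"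
      using e ij by (simp add: x_def Q2.K.U_star Q2.K.U_mult Q2.q_closed Q2.q_mult)
    also have "\<dots> = (\<Oplus>\<^bsub>C2\<^esub>k\<in>{..<n}. if 0 = k then star C2 (x k i) \<otimes>\<^bsub>C2\<^esub> x k j else \<zero>\<^bsub>C2\<^esub>)"
      by (rule S2.A.finsum_singleton[symmetric]) (use ij xc in \<open>auto simp: S2.star_closed\<close>)
    also have "\<dots> = (\<Oplus>\<^bsub>C2\<^esub>k\<in>{..<n}. star C2 (x k i) \<otimes>\<^bsub>C2\<^esub> x k j)"
    proof (rule S2.A.finsum_cong')
      fix k :: nat
      have "star C2 \<zero>\<^bsub>C2\<^esub> \<otimes>\<^bsub>C2\<^esub> \<zero>\<^bsub>C2\<^esub> = \<zero>\<^bsub>C2\<^esub>" by (simp add: S2.star_closed)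
      then show "(if 0 = k then star C2 (x k i) \<otimes>\<^bsub>C2\<^esub> x k j else \<zero>\<^bsub>C2\<^esub>) = star C2 (x k i) \<otimes>\<^bsub>C2\<^esub> x k j"
        by (simp add: x_def)
    qed (use ij xc in \<open>auto simp: S2.star_closed\<close>)
    finally show ?thesis .
  qed
  then show ?thesis unfolding positive_matrix_def using xc by (intro exI[of _ x]) auto
qed

text \<open>Complete positivity of \<sigma> and of the quotient map gives a positive matrix P = star
  y y over the C*-algebra of K1. Conjugating P by the unitaries V i keeps it positive, and by
  traciality the trace of the conjugated entries is F at \<open>inv (e i) \<otimes> e j\<close>. So
  the form of F is a sum of traces of elements star Z Z.\<close>

lemma F_P1: "F \<in> Q1.G.P1"
proof -
  interpret S1: cstar_seminorm C1 by (rule Q1.K.full_seminorm)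
  interpret E: star_hom C0 C1 Q1.E.ext by (rule ext_hom)
  let ?\<tau> = "Q1.K.state Q1.K.trace"
  note \<tau> = Q1.K.state_linear[OF Q1.K.trace_P1]
  have "Im (Q1.G.fm F x x) = 0 \<and> 0 \<le> Re (Q1.G.fm F x x)" if x: "x \<in> CG G" for x
  proof -
    obtain S where S: "finite S" "S \<subseteq> carrier G" "{g. x g \<noteq> 0} \<subseteq> S" using x by (rule CG_supp)
    define n where "n = card S"
    obtain e where e: "bij_betw e {0..<n} S" using ex_bij_betw_nat_finite[OF S(1)] by (auto simp: n_def)
    then have e': "bij_betw e {..<n} S" by (simp add: atLeast0LessThan)
    have eG: "e i \<in> carrier G" if "i < n" for i using bij_betwE[OF e'] that S(2) by auto
    define P where "P i j = Q1.E.ext (\<sigma> (Q2.K.U (q2 (inv\<^bsub>G\<^esub> (e i) \<otimes>\<^bsub>G\<^esub> e j))))" for i j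
    have "positive_matrix C1 n P"
      unfolding P_def using E.positive_matrix_image[OF \<sigma>_props(3)[OF unitary_matrix_positive[OF eG]]] .
    then obtain y where yc: "\<And>k j. k < n \<Longrightarrow> j < n \<Longrightarrow> y k j \<in> carrier C1"
      and y: "\<And>i j. i < n \<Longrightarrow> j < n \<Longrightarrow> P i j = (\<Oplus>\<^bsub>C1\<^esub>k\<in>{..<n}. star C1 (y k i) \<otimes>\<^bsub>C1\<^esub> y k j)"
      unfolding positive_matrix_def by blast
    define V where "V i = Q1.K.U (q1 (e i))" for i
    have Vc: "V i \<in> carrier C1" if "i < n" for i using eG that by (simp add: V_def Q1.K.U_closed Q1.q_closed)
    \<comment> \<open>The factor of the conjugated matrix, whose entry at (i, j) is the product of V
      i, P i j and the adjoint of V j.\<close>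
    define z where "z k j = y k j \<otimes>\<^bsub>C1\<^esub> star C1 (V j)" for k j
    have zc: "z k j \<in> carrier C1" if "k < n" "j < n" for k j
      using that yc Vc by (simp add: z_def S1.star_closed)
    have F_eq: "F (inv\<^bsub>G\<^esub> (e i) \<otimes>\<^bsub>G\<^esub> e j) = (\<Sum>k<n. ?\<tau> (star C1 (z k i) \<otimes>\<^bsub>C1\<^esub> z k j))" if ij: "i < n" "j < n" for i j
    proof -
      have Pc: "P i j \<in> carrier C1" unfolding P_def using ij eG
        by (intro E.f_closed \<sigma>_props(1) Q2.K.U_closed Q2.q_closed) auto
      have "Q1.K.U (q1 (inv\<^bsub>G\<^esub> (inv\<^bsub>G\<^esub> (e i) \<otimes>\<^bsub>G\<^esub> e j))) = star C1 (V j) \<otimes>\<^bsub>C1\<^esub> V i"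
        using ij eG by (simp add: V_def Q1.G.inv_mult_group Q1.q_mult Q1.q_closed Q1.K.U_star Q1.K.U_mult)
      then have "F (inv\<^bsub>G\<^esub> (e i) \<otimes>\<^bsub>G\<^esub> e j) = ?\<tau> (P i j \<otimes>\<^bsub>C1\<^esub> (star C1 (V j) \<otimes>\<^bsub>C1\<^esub> V i))"
        using ij eG by (simp add: F_def P_def)
      also have "P i j \<otimes>\<^bsub>C1\<^esub> (star C1 (V j) \<otimes>\<^bsub>C1\<^esub> V i) = (P i j \<otimes>\<^bsub>C1\<^esub> star C1 (V j)) \<otimes>\<^bsub>C1\<^esub> V i"
        using Pc Vc ij by (intro S1.A.m_assoc[symmetric]) (auto simp: S1.star_closed)
      \<comment> \<open>The definition of F puts both unitaries to the right of P i j; the trace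
        property brings V i to the left.\<close>
      also have "?\<tau> \<dots> = ?\<tau> (V i \<otimes>\<^bsub>C1\<^esub> (P i j \<otimes>\<^bsub>C1\<^esub> star C1 (V j)))"
        unfolding V_def using ij eG Pc Vc[of j]
        by (intro Q1.K.trace_commute Q1.q_closed S1.A.m_closed) (auto simp: S1.star_closed V_def)
      also have "\<dots> = ?\<tau> (V i \<otimes>\<^bsub>C1\<^esub> ((\<Oplus>\<^bsub>C1\<^esub>k\<in>{..<n}. star C1 (y k i) \<otimes>\<^bsub>C1\<^esub> y k j) \<otimes>\<^bsub>C1\<^esub> star C1 (V j)))"
        by (simp only: y[OF ij])
      also have "\<dots> = (\<Sum>k<n. ?\<tau> (V i \<otimes>\<^bsub>C1\<^esub> ((star C1 (y k i) \<otimes>\<^bsub>C1\<^esub> y k j) \<otimes>\<^bsub>C1\<^esub> star C1 (V j))))"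
        by (rule S1.functional_finsum[where L = "\<lambda>X. ?\<tau> (V i \<otimes>\<^bsub>C1\<^esub> (X \<otimes>\<^bsub>C1\<^esub> star C1 (V j)))"])
          (use ij yc Vc in \<open>auto simp: S1.A.l_distr S1.A.r_distr S1.star_closed \<tau>\<close>)
      also have "\<dots> = (\<Sum>k<n. ?\<tau> (star C1 (z k i) \<otimes>\<^bsub>C1\<^esub> z k j))"
        using ij yc Vc
        by (intro sum.cong refl arg_cong[where f = ?\<tau>]) (simp add: z_def S1.star_mult S1.star_star S1.star_closed S1.A.m_assoc)
      finally show ?thesis .
    qed
    \<comment> \<open>Summing the k-th row against x turns the double sum over i and j into one
      trace of star Z Z for each k.\<close>
    define Z where "Z k = (\<Oplus>\<^bsub>C1\<^esub>j\<in>{..<n}. x (e j) \<odot>\<^bsub>C1\<^esub> z k j)" for k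
    have xz: "x (e j) \<odot>\<^bsub>C1\<^esub> z k j \<in> carrier C1" if "k < n" "j < n" for k j
      using zc[OF that] by (rule S1.A_smult_closed)
    have Zc: "Z k \<in> carrier C1" if "k < n" for k
      unfolding Z_def using xz that by (intro S1.A.finsum_closed) auto
    have ZZ: "?\<tau> (star C1 (Z k) \<otimes>\<^bsub>C1\<^esub> Z k) = (\<Sum>i<n. \<Sum>j<n. cnj (x (e i)) * x (e j) * ?\<tau> (star C1 (z k i) \<otimes>\<^bsub>C1\<^esub> z k j))"
      if k: "k < n" for k
    proof -
      have one: "?\<tau> (star C1 (x (e i) \<odot>\<^bsub>C1\<^esub> z k i) \<otimes>\<^bsub>C1\<^esub> (x (e j) \<odot>\<^bsub>C1\<^esub> z k j))
          = cnj (x (e i)) * x (e j) * ?\<tau> (star C1 (z k i) \<otimes>\<^bsub>C1\<^esub> z k j)" if "i < n" "j < n" for i j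
        using zc k that
        by (simp add: S1.star_smult S1.smult_mult_left S1.smult_mult_right S1.A_smult_closed S1.star_closed \<tau>)
      have "?\<tau> (star C1 (Z k) \<otimes>\<^bsub>C1\<^esub> Z k) = (\<Sum>i<n. ?\<tau> (star C1 (x (e i) \<odot>\<^bsub>C1\<^esub> z k i) \<otimes>\<^bsub>C1\<^esub> Z k))"
        unfolding Z_def[of k]
        by (rule S1.functional_finsum[where L = "\<lambda>X. ?\<tau> (star C1 X \<otimes>\<^bsub>C1\<^esub> finsum C1 (\<lambda>j. x (e j) \<odot>\<^bsub>C1\<^esub> z k j) {..<n})"])
          (use xz k Zc in \<open>auto simp: S1.star_add S1.A.l_distr S1.star_closed \<tau> Z_def[symmetric]\<close>)
      also have "\<dots> = (\<Sum>i<n. \<Sum>j<n. ?\<tau> (star C1 (x (e i) \<odot>\<^bsub>C1\<^esub> z k i) \<otimes>\<^bsub>C1\<^esub> (x (e j) \<odot>\<^bsub>C1\<^esub> z k j)))"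
      proof (intro sum.cong refl)
        fix i assume "i \<in> {..<n}"
        then show "?\<tau> (star C1 (x (e i) \<odot>\<^bsub>C1\<^esub> z k i) \<otimes>\<^bsub>C1\<^esub> Z k)
            = (\<Sum>j<n. ?\<tau> (star C1 (x (e i) \<odot>\<^bsub>C1\<^esub> z k i) \<otimes>\<^bsub>C1\<^esub> (x (e j) \<odot>\<^bsub>C1\<^esub> z k j)))"
          unfolding Z_def
          by (intro S1.functional_finsum[where L = "\<lambda>X. ?\<tau> (star C1 (x (e i) \<odot>\<^bsub>C1\<^esub> z k i) \<otimes>\<^bsub>C1\<^esub> X)"])
            (use xz k in \<open>auto simp: S1.A.r_distr S1.star_closed \<tau>\<close>)
      qed
      also have "\<dots> = (\<Sum>i<n. \<Sum>j<n. cnj (x (e i)) * x (e j) * ?\<tau> (star C1 (z k i) \<otimes>\<^bsub>C1\<^esub> z k j))"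
        by (intro sum.cong refl one) auto
      finally show ?thesis .
    qed
    have "Q1.G.fm F x x = (\<Sum>h\<in>S. \<Sum>g\<in>S. cnj (x h) * x g * F (inv\<^bsub>G\<^esub> h \<otimes>\<^bsub>G\<^esub> g))" by (rule Q1.G.fm_expand[OF S])
    also have "\<dots> = (\<Sum>i<n. \<Sum>j<n. cnj (x (e i)) * x (e j) * F (inv\<^bsub>G\<^esub> (e i) \<otimes>\<^bsub>G\<^esub> e j))"
      by (simp only: sum.reindex_bij_betw[OF e', symmetric])
    also have "\<dots> = (\<Sum>i<n. \<Sum>j<n. \<Sum>k<n. cnj (x (e i)) * x (e j) * ?\<tau> (star C1 (z k i) \<otimes>\<^bsub>C1\<^esub> z k j))"
      by (intro sum.cong refl) (simp add: F_eq sum_distrib_left)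
    also have "\<dots> = (\<Sum>i<n. \<Sum>k<n. \<Sum>j<n. cnj (x (e i)) * x (e j) * ?\<tau> (star C1 (z k i) \<otimes>\<^bsub>C1\<^esub> z k j))"
      by (intro sum.cong refl sum.swap)
    also have "\<dots> = (\<Sum>k<n. \<Sum>i<n. \<Sum>j<n. cnj (x (e i)) * x (e j) * ?\<tau> (star C1 (z k i) \<otimes>\<^bsub>C1\<^esub> z k j))"
      by (rule sum.swap)
    also have "\<dots> = (\<Sum>k<n. ?\<tau> (star C1 (Z k) \<otimes>\<^bsub>C1\<^esub> Z k))"
      by (intro sum.cong refl ZZ[symmetric]) auto
    finally have "Q1.G.fm F x x = (\<Sum>k<n. ?\<tau> (star C1 (Z k) \<otimes>\<^bsub>C1\<^esub> Z k))" .
    then show ?thesis using \<tau>(4,5)[OF Zc] by (auto intro!: sum_nonneg)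
  qed
  moreover have "F \<one>\<^bsub>G\<^esub> = 1"
  proof -
    have "F \<one>\<^bsub>G\<^esub> = ?\<tau> (\<one>\<^bsub>C1\<^esub> \<otimes>\<^bsub>C1\<^esub> \<one>\<^bsub>C1\<^esub>)"
      by (simp add: F_def Q2.K.U_one Q1.K.U_one \<sigma>_props(2) E.f_one)
    also have "\<dots> = ?\<tau> (Q1.K.U \<one>\<^bsub>K1\<^esub>)" using S1.A.one_closed by (simp add: Q1.K.U_one)
    also have "\<dots> = 1" by (simp add: Q1.K.state_U Q1.K.trace_P1) (simp add: Q1.K.trace_def)
    finally show ?thesis .
  qed
  ultimately show ?thesis by (simp add: Q1.G.P1_def Q1.G.posdef_def F_def)
qed

text \<open>As \<sigma> and the quotient map are unital, F n is the trace of a group unitary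
  different from the unit.\<close>

lemma F_kernel: assumes n: "n \<in> carrier G" "q2 n = \<one>\<^bsub>K2\<^esub>" "q1 n \<noteq> \<one>\<^bsub>K1\<^esub>" shows "F n = 0"
proof -
  interpret S1: cstar_seminorm C1 by (rule Q1.K.full_seminorm)
  interpret E: star_hom C0 C1 Q1.E.ext by (rule ext_hom)
  have u: "Q1.K.U (q1 (inv\<^bsub>G\<^esub> n)) \<in> carrier C1" using n by (intro Q1.K.U_closed Q1.q_closed) auto
  have ne: "q1 (inv\<^bsub>G\<^esub> n) \<noteq> \<one>\<^bsub>K1\<^esub>"
    using n Q1.q_closed[OF n(1)] by simp
  have "F n = Q1.K.state Q1.K.trace (\<one>\<^bsub>C1\<^esub> \<otimes>\<^bsub>C1\<^esub> Q1.K.U (q1 (inv\<^bsub>G\<^esub> n)))"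
    using n(1,2) by (simp add: F_def Q2.K.U_one \<sigma>_props(2) E.f_one)
  also have "\<one>\<^bsub>C1\<^esub> \<otimes>\<^bsub>C1\<^esub> Q1.K.U (q1 (inv\<^bsub>G\<^esub> n)) = Q1.K.U (q1 (inv\<^bsub>G\<^esub> n))" by (rule S1.A.l_one[OF u])
  also have "Q1.K.state Q1.K.trace \<dots> = Q1.K.trace (q1 (inv\<^bsub>G\<^esub> n))"
    using n(1) by (intro Q1.K.state_U Q1.K.trace_P1 Q1.q_closed) auto
  also have "\<dots> = 0" using ne by (simp add: Q1.K.trace_def)
  finally show ?thesis .
qed

text \<open>The lift Y contributes exactly 1, because its image cancels against the twisting
  unitary. What remains is the trace of the image of the difference times a unitary, and none of
  these operations increases the norm.\<close>

lemma F_close: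
  assumes g: "g \<in> carrier G" and Y: "Y \<in> carrier C0" "Q1.E.ext Y = Q1.K.U (q1 g)"
  shows "cmod (F g - 1) \<le> cnorm C0 (\<sigma> (Q2.K.U (q2 g)) \<ominus>\<^bsub>C0\<^esub> Y)"
proof -
  interpret S0: cstar_seminorm C0 by (rule Q1.G.full_seminorm)
  interpret S1: cstar_seminorm C1 by (rule Q1.K.full_seminorm)
  interpret E: star_hom C0 C1 Q1.E.ext by (rule ext_hom)
  let ?\<tau> = "Q1.K.state Q1.K.trace"
  note \<tau> = Q1.K.state_linear[OF Q1.K.trace_P1]
  define X where "X = \<sigma> (Q2.K.U (q2 g))"
  define V where "V = Q1.K.U (q1 (inv\<^bsub>G\<^esub> g))"
  have X: "X \<in> carrier C0" unfolding X_def using g by (intro \<sigma>_props(1) Q2.K.U_closed Q2.q_closed)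
  have V: "V \<in> carrier C1" "cnorm C1 V \<le> 1" unfolding V_def using g
    by (auto intro!: Q1.K.U_closed Q1.q_closed Q1.K.U_norm)
  have D: "X \<ominus>\<^bsub>C0\<^esub> Y \<in> carrier C0" using X Y(1) by simp
  have YV: "Q1.E.ext Y \<otimes>\<^bsub>C1\<^esub> V = Q1.K.U \<one>\<^bsub>K1\<^esub>"
    unfolding V_def Y(2) using g by (simp add: Q1.K.U_mult Q1.q_closed)
  have "F g = ?\<tau> (Q1.E.ext X \<otimes>\<^bsub>C1\<^esub> V)" using g by (simp add: F_def X_def V_def)
  also have "Q1.E.ext X = Q1.E.ext (X \<ominus>\<^bsub>C0\<^esub> Y) \<oplus>\<^bsub>C1\<^esub> Q1.E.ext Y"
    using E.f_add[OF D Y(1)] S0.minus_plus_cancel[OF X Y(1)] by simp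
  also have "(Q1.E.ext (X \<ominus>\<^bsub>C0\<^esub> Y) \<oplus>\<^bsub>C1\<^esub> Q1.E.ext Y) \<otimes>\<^bsub>C1\<^esub> V
      = Q1.E.ext (X \<ominus>\<^bsub>C0\<^esub> Y) \<otimes>\<^bsub>C1\<^esub> V \<oplus>\<^bsub>C1\<^esub> Q1.E.ext Y \<otimes>\<^bsub>C1\<^esub> V"
    by (intro S1.A.l_distr E.f_closed D Y(1) V(1))
  also have "?\<tau> \<dots> = ?\<tau> (Q1.E.ext (X \<ominus>\<^bsub>C0\<^esub> Y) \<otimes>\<^bsub>C1\<^esub> V) + ?\<tau> (Q1.E.ext Y \<otimes>\<^bsub>C1\<^esub> V)"
    by (intro \<tau>(1) S1.A.m_closed E.f_closed D Y(1) V(1))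
  also have "?\<tau> (Q1.E.ext Y \<otimes>\<^bsub>C1\<^esub> V) = 1"
    unfolding YV by (simp add: Q1.K.state_U Q1.K.trace_P1) (simp add: Q1.K.trace_def)
  finally have "cmod (F g - 1) = cmod (?\<tau> (Q1.E.ext (X \<ominus>\<^bsub>C0\<^esub> Y) \<otimes>\<^bsub>C1\<^esub> V))" by simp
  also have "\<dots> \<le> cnorm C1 (Q1.E.ext (X \<ominus>\<^bsub>C0\<^esub> Y) \<otimes>\<^bsub>C1\<^esub> V)"
    by (intro \<tau>(3) S1.A.m_closed E.f_closed D V(1))
  also have "\<dots> \<le> cnorm C1 (Q1.E.ext (X \<ominus>\<^bsub>C0\<^esub> Y)) * cnorm C1 V"
    by (intro S1.sn_mult E.f_closed D V(1))
  also have "\<dots> \<le> cnorm C0 (X \<ominus>\<^bsub>C0\<^esub> Y) * 1"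
    using D V Q1.E.ext_contract[of "X \<ominus>\<^bsub>C0\<^esub> Y"]
    by (intro mult_mono S0.sn_nonneg S1.sn_nonneg) (auto simp: full_group_cstar_def)
  finally show ?thesis by (simp add: X_def)
qed

end

section \<open>Quotients by normal subgroups and the pigeonhole argument\<close>

lemma quotient_map_Mod:
  assumes "group G" "N \<lhd> G" shows "quotient_map G (G Mod N) (\<lambda>g. N #>\<^bsub>G\<^esub> g)"
proof -
  interpret normal N G by (rule assms(2))
  show ?thesis
  proof (intro quotient_map.intro quotient_map_axioms.intro assms(1) factorgroup_is_group r_coset_hom_Mod)
    show "(\<lambda>g. N #>\<^bsub>G\<^esub> g) ` carrier G = carrier (G Mod N)"
      by (auto simp: FactGroup_def RCOSETS_def)
  qed
qed

lemma coset_eq_one_iff: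
  assumes "group G" "N \<lhd> G" "g \<in> carrier G" shows "N #>\<^bsub>G\<^esub> g = \<one>\<^bsub>G Mod N\<^esub> \<longleftrightarrow> g \<in> N"
proof -
  interpret normal N G by (rule assms(2))
  show ?thesis
    using assms(3) rcos_self[OF assms(3) subgroup_axioms] coset_join2[OF assms(3) subgroup_axioms]
    by (auto simp: FactGroup_def)
qed

text \<open>The image of M in the simple quotient is normal, hence trivial or everything; as M
  contains N, it is recovered from its image. This upgrades a single inclusion of kernels to an
  equality.\<close>

lemma simple_quotient_maximal:
  assumes G: "group G" and M: "M \<lhd> G" and N: "N \<lhd> G" and le: "N \<subseteq> M" and simple: "is_simple (G Mod N)"
  shows "M = N \<or> M = carrier G"
proof -
  define q where "q g = N #>\<^bsub>G\<^esub> g" for g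
  interpret Q: quotient_map G "G Mod N" q
    unfolding q_def by (rule quotient_map_Mod[OF G N])
  have sM: "subgroup M G" using M by (rule normal_imp_subgroup)
  have iM: "x \<otimes>\<^bsub>G\<^esub> h \<otimes>\<^bsub>G\<^esub> inv\<^bsub>G\<^esub> x \<in> M" if "x \<in> carrier G" "h \<in> M" for x h
    using M that by (simp add: Q.G.normal_inv_iff)
  have MG: "h \<in> carrier G" if "h \<in> M" for h using sM that by (rule subgroup.mem_carrier)
  have "q ` M \<lhd> G Mod N"
    unfolding Q.K.normal_inv_iff
  proof (intro conjI ballI)
    show "subgroup (q ` M) (G Mod N)" by (rule Q.subgroup_img_is_subgroup[OF sM])
    fix k l assume k: "k \<in> carrier (G Mod N)" and l: "l \<in> q ` M"
    obtain x where x: "x \<in> carrier G" "k = q x" using k Q.q_surj by (metis imageE)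
    obtain h where h: "h \<in> M" "l = q h" using l by blast
    have "k \<otimes>\<^bsub>G Mod N\<^esub> l \<otimes>\<^bsub>G Mod N\<^esub> inv\<^bsub>G Mod N\<^esub> k = q (x \<otimes>\<^bsub>G\<^esub> h \<otimes>\<^bsub>G\<^esub> inv\<^bsub>G\<^esub> x)"
      using x h MG[OF h(1)] by (simp add: Q.q_mult)
    then show "k \<otimes>\<^bsub>G Mod N\<^esub> l \<otimes>\<^bsub>G Mod N\<^esub> inv\<^bsub>G Mod N\<^esub> k \<in> q ` M" using iM[OF x(1) h(1)] by blast
  qed
  then consider "q ` M = {\<one>\<^bsub>G Mod N\<^esub>}" | "q ` M = carrier (G Mod N)"
    using simple unfolding is_simple_def by blast
  then show ?thesis
  proof cases
    case 1
    have "h \<in> N" if "h \<in> M" for h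
      using 1 that coset_eq_one_iff[OF G N MG[OF that]] by (auto simp: q_def)
    then show ?thesis using le by blast
  next
    case 2
    have "g \<in> M" if g: "g \<in> carrier G" for g
    proof -
      have "q g \<in> q ` M" using 2 Q.q_closed[OF g] by simp
      then obtain h where h: "h \<in> M" "q g = q h" by blast
      have "q (g \<otimes>\<^bsub>G\<^esub> inv\<^bsub>G\<^esub> h) = q h \<otimes>\<^bsub>G Mod N\<^esub> inv\<^bsub>G Mod N\<^esub> q h"
        by (simp only: Q.q_mult[OF g Q.G.inv_closed[OF MG[OF h(1)]]] h(2) Q.hom_inv[OF MG[OF h(1)]])
      also have "\<dots> = \<one>\<^bsub>G Mod N\<^esub>" by (rule Q.K.r_inv[OF Q.q_closed[OF MG[OF h(1)]]])
      finally have "q (g \<otimes>\<^bsub>G\<^esub> inv\<^bsub>G\<^esub> h) = \<one>\<^bsub>G Mod N\<^esub>" .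
      then have "g \<otimes>\<^bsub>G\<^esub> inv\<^bsub>G\<^esub> h \<in> N"
        using coset_eq_one_iff[OF G N, of "g \<otimes>\<^bsub>G\<^esub> inv\<^bsub>G\<^esub> h"] g MG[OF h(1)] by (simp add: q_def)
      then have "(g \<otimes>\<^bsub>G\<^esub> inv\<^bsub>G\<^esub> h) \<otimes>\<^bsub>G\<^esub> h \<in> M" using le h(1) sM by (blast intro: subgroup.m_closed)
      then show ?thesis using g MG[OF h(1)] by (simp add: Q.G.m_assoc)
    qed
    then show ?thesis using MG by blast
  qed
qed

definition (in quotient_map) is_section where
  "is_section \<sigma> \<longleftrightarrow> unital_cp (full_group_cstar K) (full_group_cstar G) \<sigma> \<and>
     (\<forall>Y\<in>carrier (full_group_cstar K). E.ext (\<sigma> Y) = Y)"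

lemma (in quotient_map) ex_section:
  assumes "lifting_property TYPE((nat \<Rightarrow> 'a \<Rightarrow> complex) set) (full_group_cstar K)"
  shows "\<exists>\<sigma>. is_section \<sigma>"
proof -
  obtain \<sigma> where "unital_cp (full_group_cstar K) (full_group_cstar G) \<sigma>"
    "\<And>Y. Y \<in> carrier (full_group_cstar K) \<Longrightarrow> E.ext (\<sigma> Y) = Y"
    using E.lifting_section[folded full_group_cstar_def, OF ext_push_surj assms] by metis
  then show ?thesis by (auto simp: is_section_def)
qed

text \<open>On Q the comparison function differs from 1 by at most \<epsilon>, so by the Kazhdan
  inequality its real part is positive on the whole group. At an element of the kernel of q2 outside
  the kernel of q1 it would be 0.\<close>

lemma kernel_inclusion:
  fixes \<kappa> \<epsilon> :: real
  assumes q1: "quotient_map G K1 q1" and q2: "quotient_map G K2 q2"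
    and s1: "quotient_map.is_section G K1 q1 \<sigma>1" and s2: "quotient_map.is_section G K2 q2 \<sigma>2"
    and Q: "Q \<subseteq> carrier G" and \<kappa>: "\<kappa> > 0"
    and kazhdan: "\<And>\<phi> g. \<phi> \<in> group.P1 G \<Longrightarrow> g \<in> carrier G \<Longrightarrow> \<kappa> * Re (1 - \<phi> g) \<le> (\<Sum>s\<in>Q. Re (1 - \<phi> s))"
    and close: "\<And>s. s \<in> Q \<Longrightarrow> cnorm (full_group_cstar G)
      (\<sigma>2 (group.U K2 (q2 s)) \<ominus>\<^bsub>full_group_cstar G\<^esub> \<sigma>1 (group.U K1 (q1 s))) \<le> \<epsilon>"
    and \<epsilon>: "card Q * \<epsilon> < \<kappa>"
    and n: "n \<in> carrier G" "q2 n = \<one>\<^bsub>K2\<^esub>"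
  shows "q1 n = \<one>\<^bsub>K1\<^esub>"
proof (rule ccontr)
  assume ne: "q1 n \<noteq> \<one>\<^bsub>K1\<^esub>"
  have cp: "unital_cp (full_group_cstar K2) (full_group_cstar G) \<sigma>2"
    using s2 by (simp add: quotient_map.is_section_def[OF q2])
  interpret two_quotients G K1 q1 K2 q2 \<sigma>2
    by (intro two_quotients.intro q1 q2 two_quotients_axioms.intro cp)
  have sec: "unital_cp C1 C0 \<sigma>1" "\<And>Y. Y \<in> carrier C1 \<Longrightarrow> Q1.E.ext (\<sigma>1 Y) = Y"
    using s1 by (auto simp: Q1.is_section_def)
  have "Re (1 - F s) \<le> \<epsilon>" if s: "s \<in> Q" for s
  proof -
    have sG: "s \<in> carrier G" using s Q by blast
    have u: "Q1.K.U (q1 s) \<in> carrier C1" using sG by (intro Q1.K.U_closed Q1.q_closed)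
    have "\<sigma>1 (Q1.K.U (q1 s)) \<in> carrier C0"
      using sec(1) u by (auto simp: unital_cp_def completely_positive_def complex_linear_def)
    from F_close[OF sG this sec(2)[OF u]] have "cmod (F s - 1) \<le> \<epsilon>" using close[OF s] by linarith
    then show ?thesis using complex_Re_le_cmod[of "1 - F s"] by (simp add: norm_minus_commute)
  qed
  then have "(\<Sum>s\<in>Q. Re (1 - F s)) \<le> card Q * \<epsilon>" using sum_bounded_above[of Q "\<lambda>s. Re (1 - F s)" \<epsilon>] by simp
  then have "\<kappa> * Re (1 - F n) < \<kappa>" using kazhdan[OF F_P1 n(1)] \<epsilon> by linarith
  then show False using F_kernel[OF n ne] by simp
qed

theorem corollary5:
  fixes \<Gamma> :: "('g, 'm) monoid_scheme"
    and N :: "'i \<Rightarrow> 'g set"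
    and I :: "'i set"
  assumes "group \<Gamma>"
    and "kazhdan_property_T \<Gamma>"
    and "uncountable I"
    and "\<And>\<alpha>. \<alpha> \<in> I \<Longrightarrow> N \<alpha> \<lhd> \<Gamma>"
    and "\<And>\<alpha> \<beta>. \<lbrakk>\<alpha> \<in> I; \<beta> \<in> I; \<alpha> \<noteq> \<beta>\<rbrakk> \<Longrightarrow> \<not> (\<Gamma> Mod N \<alpha> \<cong> \<Gamma> Mod N \<beta>)"
    and "\<And>\<alpha>. \<alpha> \<in> I \<Longrightarrow> is_simple (\<Gamma> Mod N \<alpha>)"
    and "\<And>\<alpha>. \<alpha> \<in> I \<Longrightarrow> is_icc (\<Gamma> Mod N \<alpha>)"
  shows "\<exists>\<alpha>\<in>I. \<not> lifting_property TYPE((nat \<Rightarrow> 'g \<Rightarrow> complex) set)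
                  (full_group_cstar (\<Gamma> Mod N \<alpha>))"
proof (rule ccontr)
  assume neg: "\<not> ?thesis"
  interpret G: group \<Gamma> by (rule assms(1))
  define K where "K \<alpha> = \<Gamma> Mod N \<alpha>" for \<alpha>
  define q where "q \<alpha> g = N \<alpha> #>\<^bsub>\<Gamma>\<^esub> g" for \<alpha> g
  let ?A = "full_group_cstar \<Gamma>"
  have qm: "quotient_map \<Gamma> (K \<alpha>) (q \<alpha>)" if "\<alpha> \<in> I" for \<alpha>
    unfolding K_def q_def[abs_def] by (rule quotient_map_Mod[OF assms(1) assms(4)[OF that]])
  have "\<exists>\<sigma>. quotient_map.is_section \<Gamma> (K \<alpha>) (q \<alpha>) \<sigma>" if "\<alpha> \<in> I" for \<alpha>
    using neg that by (intro quotient_map.ex_section[OF qm[OF that]]) (auto simp: K_def)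
  then obtain \<sigma> where \<sigma>: "\<And>\<alpha>. \<alpha> \<in> I \<Longrightarrow> quotient_map.is_section \<Gamma> (K \<alpha>) (q \<alpha>) (\<sigma> \<alpha>)" by metis
  obtain Q \<kappa> where Q: "finite Q" "Q \<subseteq> carrier \<Gamma>" and \<kappa>: "\<kappa> > 0"
    and kazhdan: "\<And>\<phi> g. \<phi> \<in> G.P1 \<Longrightarrow> g \<in> carrier \<Gamma> \<Longrightarrow> \<kappa> * Re (1 - \<phi> g) \<le> (\<Sum>s\<in>Q. Re (1 - \<phi> s))"
    using G.kazhdan_inequality[OF assms(2)] by metis
  \<comment> \<open>The added 1 makes card Q times \<epsilon> strictly less than \<kappa>, also for
    empty Q.\<close>
  define \<epsilon> where "\<epsilon> = \<kappa> / (card Q + 1)"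
  have \<epsilon>: "\<epsilon> > 0" "card Q * \<epsilon> < \<kappa>" using \<kappa> by (auto simp: \<epsilon>_def field_simps)
  define v where "v \<alpha> s = \<sigma> \<alpha> (group.U (K \<alpha>) (q \<alpha> s))" for \<alpha> s
  interpret A: cstar_seminorm ?A by (rule G.full_seminorm)
  have v: "v \<alpha> s \<in> carrier ?A" if "\<alpha> \<in> I" "s \<in> Q" for \<alpha> s
  proof -
    interpret M: quotient_map \<Gamma> "K \<alpha>" "q \<alpha>" by (rule qm[OF that(1)])
    have "M.K.U (q \<alpha> s) \<in> carrier (full_group_cstar (K \<alpha>))" using that Q by (intro M.K.U_closed M.q_closed) auto
    then show ?thesis using \<sigma>[OF that(1)]
      by (auto simp: v_def M.is_section_def unital_cp_def completely_positive_def complex_linear_def)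
  qed
  obtain D where D: "countable D" "D \<subseteq> carrier ?A"
    "\<And>X e. X \<in> carrier ?A \<Longrightarrow> e > 0 \<Longrightarrow> \<exists>Y\<in>D. cnorm ?A (X \<ominus>\<^bsub>?A\<^esub> Y) < e"
    using G.full_separable[OF G.kazhdan_countable[OF assms(2)]] by metis
  have "\<forall>\<alpha> s. \<exists>Y. \<alpha> \<in> I \<longrightarrow> s \<in> Q \<longrightarrow> Y \<in> D \<and> cnorm ?A (v \<alpha> s \<ominus>\<^bsub>?A\<^esub> Y) < \<epsilon> / 2"
    using D(3)[OF v, of _ _ "\<epsilon> / 2"] \<epsilon>(1) by (simp add: Bex_def)
  then obtain d where d: "\<And>\<alpha> s. \<alpha> \<in> I \<Longrightarrow> s \<in> Q \<Longrightarrow> d \<alpha> s \<in> D \<and> cnorm ?A (v \<alpha> s \<ominus>\<^bsub>?A\<^esub> d \<alpha> s) < \<epsilon> / 2"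
    by metis
  \<comment> \<open>Restriction to the finite set Q leaves only countably many possible values, so
    two of uncountably many indices share the same approximants.\<close>
  define r where "r \<alpha> = restrict (d \<alpha>) Q" for \<alpha>
  have "r ` I \<subseteq> PiE Q (\<lambda>_. D)" using d by (auto simp: r_def)
  moreover have "countable (PiE Q (\<lambda>_. D))" using Q(1) D(1) by (intro countable_PiE)
  ultimately have "countable (r ` I)" by (rule countable_subset)
  then have "\<not> inj_on r I" using assms(3) by (auto dest: countable_image_inj_on)
  then obtain \<alpha> \<beta> where \<alpha>\<beta>: "\<alpha> \<in> I" "\<beta> \<in> I" "\<alpha> \<noteq> \<beta>" "r \<alpha> = r \<beta>" by (auto simp: inj_on_def)
  \<comment> \<open>Both elements lie within \<epsilon>/2 of the common approximant.\<close>
  have close: "cnorm ?A (v \<beta> s \<ominus>\<^bsub>?A\<^esub> v \<alpha> s) \<le> \<epsilon>" if s: "s \<in> Q" for s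
  proof -
    have eq: "d \<alpha> s = d \<beta> s" using fun_cong[OF \<alpha>\<beta>(4), of s] s by (simp add: r_def)
    have dA: "d \<beta> s \<in> carrier ?A" using d[OF \<alpha>\<beta>(2) s] D(2) by blast
    have "cnorm ?A (v \<beta> s \<ominus>\<^bsub>?A\<^esub> v \<alpha> s)
        \<le> cnorm ?A (v \<beta> s \<ominus>\<^bsub>?A\<^esub> d \<beta> s) + cnorm ?A (d \<beta> s \<ominus>\<^bsub>?A\<^esub> v \<alpha> s)"
      by (rule A.sn_triangle[OF v[OF \<alpha>\<beta>(2) s] dA v[OF \<alpha>\<beta>(1) s]])
    then show ?thesis using d[OF \<alpha>\<beta>(1) s] d[OF \<alpha>\<beta>(2) s] A.sn_minus_commute[OF dA v[OF \<alpha>\<beta>(1) s]] eq by simp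
  qed
  have le: "N \<beta> \<subseteq> N \<alpha>"
  proof
    fix n assume n: "n \<in> N \<beta>"
    have nG: "n \<in> carrier \<Gamma>"
      using subgroup.mem_carrier[OF normal_imp_subgroup[OF assms(4)[OF \<alpha>\<beta>(2)]] n] .
    have qn: "q \<beta> n = \<one>\<^bsub>K \<beta>\<^esub>"
      using coset_eq_one_iff[OF assms(1) assms(4)[OF \<alpha>\<beta>(2)] nG] n by (simp add: q_def K_def)
    have "q \<alpha> n = \<one>\<^bsub>K \<alpha>\<^esub>"
    proof (rule kernel_inclusion[OF qm[OF \<alpha>\<beta>(1)] qm[OF \<alpha>\<beta>(2)] \<sigma>[OF \<alpha>\<beta>(1)] \<sigma>[OF \<alpha>\<beta>(2)] Q(2) \<kappa> _ _ \<epsilon>(2) nG qn])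
      show "\<kappa> * Re (1 - \<phi> g) \<le> (\<Sum>s\<in>Q. Re (1 - \<phi> s))" if "\<phi> \<in> G.P1" "g \<in> carrier \<Gamma>" for \<phi> g
        using that by (rule kazhdan)
      show "cnorm ?A (\<sigma> \<beta> (group.U (K \<beta>) (q \<beta> s)) \<ominus>\<^bsub>?A\<^esub> \<sigma> \<alpha> (group.U (K \<alpha>) (q \<alpha> s))) \<le> \<epsilon>"
        if "s \<in> Q" for s using close[OF that] by (simp only: v_def)
    qed
    then show "n \<in> N \<alpha>"
      using coset_eq_one_iff[OF assms(1) assms(4)[OF \<alpha>\<beta>(1)] nG] by (simp add: q_def K_def)
  qed
  have "N \<alpha> = N \<beta> \<or> N \<alpha> = carrier \<Gamma>"
    by (rule simple_quotient_maximal[OF assms(1) assms(4)[OF \<alpha>\<beta>(1)] assms(4)[OF \<alpha>\<beta>(2)] le assms(6)[OF \<alpha>\<beta>(2)]])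
  then show False
  proof
    assume "N \<alpha> = N \<beta>"
    then show False using assms(5)[OF \<alpha>\<beta>(1,2,3)] by (simp add: iso_refl)
  next
    \<comment> \<open>Then the quotient by N \<alpha> would be trivial, which simplicity
      excludes.\<close>
    assume full: "N \<alpha> = carrier \<Gamma>"
    interpret M: quotient_map \<Gamma> "K \<alpha>" "q \<alpha>" by (rule qm[OF \<alpha>\<beta>(1)])
    have "q \<alpha> g = \<one>\<^bsub>K \<alpha>\<^esub>" if "g \<in> carrier \<Gamma>" for g
      using coset_eq_one_iff[OF assms(1) assms(4)[OF \<alpha>\<beta>(1)] that] that full by (simp add: q_def K_def)
    then have "carrier (K \<alpha>) = {\<one>\<^bsub>K \<alpha>\<^esub>}" using M.q_surj by auto
    then show False using assms(6)[OF \<alpha>\<beta>(1)] by (simp add: is_simple_def K_def)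
  qed
qed

end
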